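(* For every $m\ge1$ we have, in $\mathrm{Y}(\mathfrak{gl}_{1|1})[[x^{-1}]]$, $$\mathfrak T^Q_m(x)\prod_{i=1}^{m-1}\big(1-\mathrm{Ber}^Q(x-i)\big)=\prod_{i=1}^m\mathcal T_Q(x-i+1),$$ $$\mathfrak H^Q_m(x)\prod_{i=1}^{m-1}\big(\mathrm{Ber}^Q(x-i)-1\big)=\prod_{i=1}^m\mathcal T_Q(x-i+1)\prod_{i=1}^{m-1}\mathrm{Ber}^Q(x-i).$$
   Context: Superspace $\mathbb{C}^{1|1}$ with basis $v_1$ (even), $v_2$ (odd), $|1|=\bar0$, $|2|=\bar1$; $E_{ij}$ matrix units of parity $|i|+|j|$; $P=\sum_{i,j}(-1)^{|j|}E_{ij}\otimes E_{ji}$ graded flip; $\mathcal R(x)=1+P/x$. $\mathrm{Y}(\mathfrak{gl}_{1|1})$ is generated by $T^{(r)}_{ij}$, $r\ge1$, parity $|i|+|j|$, subject to $\mathcal R^{(12)}(x_1-x_2)T^{(13)}(x_1)T^{(23)}(x_2)=T^{(23)}(x_2)T^{(13)}(x_1)\mathcal R^{(12)}(x_1-x_2)$, where $T(x)=\sum_{i,j}E_{ij}\otimes T_{ij}(x)$, $T_{ij}(x)=\delta_{ij}+\sum_{r\ge1}T^{(r)}_{ij}x^{-r}$. $Q=\mathrm{diag}(q_1,q_2)$, $q_i\in\mathbb{C}^\times$; $\mathcal T_Q(x)=q_1T_{11}(x)-q_2T_{22}(x)$; $\mathrm{Ber}^Q(x)=\frac{q_1}{q_2}T_{11}(x)\big(T_{22}(x)-T_{12}(x)T_{11}(x)^{-1}T_{21}(x)\big)^{-1}$.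 Shifted series $F(x-i)$ are re-expanded in $x^{-1}$. Supertrace on $\mathrm{End}(\mathbb{C}^{1|1})$: $\mathrm{str}(E_{ij})=(-1)^{|j|}\delta_{ij}$. $\mathfrak S_m$ acts on $(\mathbb{C}^{1|1})^{\otimes m}$ with $s_i\mapsto P^{(i,i+1)}$; $A_m=\frac1{m!}\sum_\sigma\mathrm{sign}(\sigma)\sigma$ and $H_m=\frac1{m!}\sum_\sigma\sigma$ (images in $\mathrm{End}((\mathbb{C}^{1|1})^{\otimes m})$). Define $\mathfrak T^Q_m(x)=\mathrm{str}\big(A_mQ^{(1)}T^{(1,m+1)}(x)Q^{(2)}T^{(2,m+1)}(x-1)\cdots Q^{(m)}T^{(m,m+1)}(x-m+1)\big)$ and $\mathfrak H^Q_m(x)$ the same with $H_m$ in place of $A_m$, where the superscripts indicate the tensor factors ($1,\dots,m$ copies of $\mathrm{End}(\mathbb{C}^{1|1})$, $m+1$ the Yangian) and the supertrace is taken over all $m$ copies of $\mathrm{End}(\mathbb{C}^{1|1})$. *)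

theory Defs
  imports "HOL-Computational_Algebra.Formal_Power_Series" "HOL-Combinatorics.Permutations"
begin

text \<open>Conventions. Basis indices of C^{1|1} are 1 (even) and 2 (odd).
  A series F(x) = sum_r F_r x^{-r} is represented as an fps in the variable x^{-1}.
  An even element sum_{I,J} E_{IJ} (x) a_{IJ} of End(V^{(x)m}) (x) B (super tensor product,
  a_{IJ} of parity |I|+|J|) is represented by its coefficient function on multi-indices
  (lists of length m with entries in {1,2}).\<close>

definition pty :: "nat \<Rightarrow> nat" where
  "pty i = (if i = 2 then 1 else 0)"

definition ptys :: "nat list \<Rightarrow> nat" where
  "ptys I = sum_list (map pty I)"

definition idx :: "nat \<Rightarrow> nat list set" where
  "idx m = {I. length I = m \<and> set I \<subseteq> {1, 2}}"

text \<open>Koszul sign exponent of (E_{IJ} (x) a)(E_{JL} (x) b) = +- E_{IL} (x) ab,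
  with a of parity |I|+|J|.\<close>
definition msgn_exp :: "nat list \<Rightarrow> nat list \<Rightarrow> nat list \<Rightarrow> nat" where
  "msgn_exp I J L = (ptys I + ptys J) * (ptys J + ptys L)
     + (\<Sum>t<length I. \<Sum>s<t. (pty (I!t) + pty (J!t)) * (pty (J!s) + pty (L!s)))"

definition mmul :: "nat \<Rightarrow> (nat list \<Rightarrow> nat list \<Rightarrow> 'b::ring_1) \<Rightarrow> (nat list \<Rightarrow> nat list \<Rightarrow> 'b)
    \<Rightarrow> nat list \<Rightarrow> nat list \<Rightarrow> 'b" where
  "mmul m X Y = (\<lambda>I L. \<Sum>J\<in>idx m. (-1) ^ msgn_exp I J L * X I J * Y J L)"

definition mone :: "nat list \<Rightarrow> nat list \<Rightarrow> 'b::ring_1" where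
  "mone I J = (if I = J then 1 else 0)"

definition mprod :: "nat \<Rightarrow> (nat list \<Rightarrow> nat list \<Rightarrow> 'b::ring_1) list \<Rightarrow> nat list \<Rightarrow> nat list \<Rightarrow> 'b" where
  "mprod m Xs = foldr (mmul m) Xs mone"

definition str :: "nat \<Rightarrow> (nat list \<Rightarrow> nat list \<Rightarrow> 'b::ring_1) \<Rightarrow> 'b" where
  "str m X = (\<Sum>I\<in>idx m. (-1) ^ ptys I * X I I)"

text \<open>X^{(k)}: sum_{ij} 1 (x) .. (x) E_{ij} (x) .. (x) 1 (x) F_{ij}, copy k (0-based).\<close>
definition embk :: "nat \<Rightarrow> (nat \<Rightarrow> nat \<Rightarrow> 'b::ring_1) \<Rightarrow> nat list \<Rightarrow> nat list \<Rightarrow> 'b" where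
  "embk k F I J = (if length I = length J \<and> (\<forall>s<length I. s \<noteq> k \<longrightarrow> I!s = J!s)
                   then F (I!k) (J!k) else 0)"

text \<open>P^{(k,k+1)} (0-based), P = sum_{ij} (-1)^{|j|} E_{ij} (x) E_{ji}.\<close>
definition Pk :: "nat \<Rightarrow> nat list \<Rightarrow> nat list \<Rightarrow> 'b::ring_1" where
  "Pk k I J = (if length I = length J \<and> (\<forall>s<length I. s \<noteq> k \<and> s \<noteq> Suc k \<longrightarrow> I!s = J!s)
                  \<and> I!k = J!(Suc k) \<and> I!(Suc k) = J!k
               then (-1) ^ pty (I!(Suc k)) else 0)"

definition perm_of_word :: "nat list \<Rightarrow> nat \<Rightarrow> nat" where
  "perm_of_word w = foldr (\<lambda>i p. Transposition.transpose i (Suc i) \<circ> p) w id"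

text \<open>Image of sigma in S_m under s_i |-> P^{(i,i+1)}.\<close>
definition rho :: "nat \<Rightarrow> (nat \<Rightarrow> nat) \<Rightarrow> nat list \<Rightarrow> nat list \<Rightarrow> 'b::ring_1" where
  "rho m \<sigma> = mprod m (map Pk (SOME w. (\<forall>i\<in>set w. Suc i < m) \<and> perm_of_word w = \<sigma>))"

definition Asym :: "(complex \<Rightarrow> 'a::ring_1) \<Rightarrow> nat \<Rightarrow> nat list \<Rightarrow> nat list \<Rightarrow> 'a fps" where
  "Asym c m = (\<lambda>I J. fps_const (c (inverse (of_nat (fact m))))
      * (\<Sum>\<sigma>\<in>{\<sigma>. \<sigma> permutes {..<m}}. of_int (sign \<sigma>) * rho m \<sigma> I J))"

definition Hsym :: "(complex \<Rightarrow> 'a::ring_1) \<Rightarrow> nat \<Rightarrow> nat list \<Rightarrow> nat list \<Rightarrow> 'a fps" where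
  "Hsym c m = (\<lambda>I J. fps_const (c (inverse (of_nat (fact m))))
      * (\<Sum>\<sigma>\<in>{\<sigma>. \<sigma> permutes {..<m}}. rho m \<sigma> I J))"

definition tcoef :: "(nat \<Rightarrow> nat \<Rightarrow> nat \<Rightarrow> 'a::ring_1) \<Rightarrow> nat \<Rightarrow> nat \<Rightarrow> nat \<Rightarrow> 'a" where
  "tcoef t r i j = (if r = 0 then (if i = j then 1 else 0) else t r i j)"

definition Tser :: "(nat \<Rightarrow> nat \<Rightarrow> nat \<Rightarrow> 'a::ring_1) \<Rightarrow> nat \<Rightarrow> nat \<Rightarrow> 'a fps" where
  "Tser t i j = Abs_fps (\<lambda>r. tcoef t r i j)"

text \<open>F(x - a) re-expanded in x^{-1}:  (x-a)^{-r} = sum_k binom(r+k-1,k) a^k x^{-r-k}.\<close>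
definition shiftx :: "int \<Rightarrow> 'a::ring_1 fps \<Rightarrow> 'a fps" where
  "shiftx a f = Abs_fps (\<lambda>n. if n = 0 then fps_nth f 0
      else (\<Sum>r\<in>{1..n}. of_nat ((n - 1) choose (n - r)) * of_int a ^ (n - r) * fps_nth f r))"

definition sinv :: "'b::ring_1 \<Rightarrow> 'b" where
  "sinv f = (THE g. f * g = 1 \<and> g * f = 1)"

text \<open>RTT relation R^{(12)}(x1-x2) T^{(13)}(x1) T^{(23)}(x2) = T^{(23)}(x2) T^{(13)}(x1) R^{(12)}(x1-x2),
  multiplied by (x1 - x2), coefficient of x1^{-r} x2^{-s} (r, s >= 0).\<close>
definition yangian_rtt :: "(nat \<Rightarrow> nat \<Rightarrow> nat \<Rightarrow> 'a::ring_1) \<Rightarrow> bool" where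
  "yangian_rtt t \<longleftrightarrow> (\<forall>r s. \<forall>I\<in>idx 2. \<forall>L\<in>idx 2.
     (let M = (\<lambda>r s. mmul 2 (embk 0 (tcoef t r)) (embk 1 (tcoef t s)));
          N = (\<lambda>r s. mmul 2 (embk 1 (tcoef t s)) (embk 0 (tcoef t r)))
      in M (Suc r) s I L - M r (Suc s) I L + mmul 2 (Pk 0) (M r s) I L
       = N (Suc r) s I L - N r (Suc s) I L + mmul 2 (N r s) (Pk 0) I L))"

definition Qk :: "(complex \<Rightarrow> 'a::ring_1) \<Rightarrow> complex \<Rightarrow> complex \<Rightarrow> nat \<Rightarrow> nat list \<Rightarrow> nat list \<Rightarrow> 'a fps" where
  "Qk c q1 q2 k = embk k (\<lambda>i j. if i = j then fps_const (c (if i = 1 then q1 else q2)) else 0)"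

definition TQchain :: "(complex \<Rightarrow> 'a::ring_1) \<Rightarrow> complex \<Rightarrow> complex \<Rightarrow> (nat \<Rightarrow> nat \<Rightarrow> nat \<Rightarrow> 'a) \<Rightarrow> nat
    \<Rightarrow> (nat list \<Rightarrow> nat list \<Rightarrow> 'a fps) list" where
  "TQchain c q1 q2 t m = concat (map (\<lambda>k. [Qk c q1 q2 k, embk k (\<lambda>i j. shiftx (int k) (Tser t i j))]) [0..<m])"

definition Tfrak :: "(complex \<Rightarrow> 'a::ring_1) \<Rightarrow> complex \<Rightarrow> complex \<Rightarrow> (nat \<Rightarrow> nat \<Rightarrow> nat \<Rightarrow> 'a) \<Rightarrow> nat \<Rightarrow> 'a fps" where
  "Tfrak c q1 q2 t m = str m (mprod m (Asym c m # TQchain c q1 q2 t m))"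

definition Hfrak :: "(complex \<Rightarrow> 'a::ring_1) \<Rightarrow> complex \<Rightarrow> complex \<Rightarrow> (nat \<Rightarrow> nat \<Rightarrow> nat \<Rightarrow> 'a) \<Rightarrow> nat \<Rightarrow> 'a fps" where
  "Hfrak c q1 q2 t m = str m (mprod m (Hsym c m # TQchain c q1 q2 t m))"

definition TcalQ :: "(complex \<Rightarrow> 'a::ring_1) \<Rightarrow> complex \<Rightarrow> complex \<Rightarrow> (nat \<Rightarrow> nat \<Rightarrow> nat \<Rightarrow> 'a) \<Rightarrow> 'a fps" where
  "TcalQ c q1 q2 t = fps_const (c q1) * Tser t 1 1 - fps_const (c q2) * Tser t 2 2"

definition BerQ :: "(complex \<Rightarrow> 'a::ring_1) \<Rightarrow> complex \<Rightarrow> complex \<Rightarrow> (nat \<Rightarrow> nat \<Rightarrow> nat \<Rightarrow> 'a) \<Rightarrow> 'a fps" where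
  "BerQ c q1 q2 t = fps_const (c (q1 / q2)) * Tser t 1 1
     * sinv (Tser t 2 2 - Tser t 1 2 * sinv (Tser t 1 1) * Tser t 2 1)"

end

theory Submission
  imports Defs
begin

text \<open>
  The sign \<open>(-1)^g(I,J)\<close> with \<open>g(I,J) = \<Sum>\<^sub>t\<^sub>\<le>\<^sub>s (|I\<^sub>t| + |J\<^sub>t|) |J\<^sub>s|\<close> has the Koszul cocycle
  as its coboundary, so it turns the super product into the ordinary matrix product. The image of \<open>A\<^sub>m\<close> on
  \<open>(C^{1|1})^{\<otimes>m}\<close> is spanned by the classes of the words with at most one letter 1 and that of \<open>H\<^sub>m\<close> by
  those with at most one letter 2. Hence, writing \<open>A, B, C, D\<close> for \<open>T\<^sub>1\<^sub>1, T\<^sub>1\<^sub>2, T\<^sub>2\<^sub>1, T\<^sub>2\<^sub>2\<close>, the transfer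
  matrix for \<open>A\<^sub>m\<close> is, up to a power of \<open>-q\<^sub>2\<close>, \<open>q\<^sub>1 Y\<^sub>m - q\<^sub>2 X\<^sub>m\<close> with \<open>X\<^sub>m(x) = D(x) \<dots> D(x-m+1)\<close>
  and \<open>Y\<^sub>m\<close> a signed sum over the entries in any one row of the fused block.

  Let \<open>d = D - B A\<^sup>-\<^sup>1 C\<close> and \<open>\<beta> = A d\<^sup>-\<^sup>1\<close>. The series \<open>\<beta>\<close> is central, and at shift 1 the RTT relation gives
  \<open>B(x) B(x-1) = 0\<close> and lets \<open>B\<close> trade arguments with \<open>A\<close> and \<open>D\<close>. These facts yield
  \<open>(q\<^sub>1 Y\<^sub>m\<^sub>+\<^sub>1 - q\<^sub>2 X\<^sub>m\<^sub>+\<^sub>1)(x) (q\<^sub>1 \<beta> - q\<^sub>2)(x-m) = (q\<^sub>1 Y\<^sub>m - q\<^sub>2 X\<^sub>m)(x) (q\<^sub>1 A - q\<^sub>2 D)(x-m)\<close>,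
  and the product formula follows by induction. The case of \<open>H\<^sub>m\<close> is the image of this one under
  \<open>A \<leftrightarrow> D\<close>, \<open>C \<mapsto> -C\<close>, \<open>\<beta> \<mapsto> \<beta>\<^sup>-\<^sup>1\<close>.
\<close>

text \<open>The Yangian enters only through a ring with elements satisfying the RTT relation:
  neither a grading nor a basis is at hand, so every identity has to be drawn from coefficients of
  RTT. Centrality of \<open>\<beta>\<close> requires division by u - v in a noncommutative setting.
  It is therefore proved for series in two independent variables, where the cleared factor
  \<open>y\<close> is central and cancellable; only afterwards are u and v set to x - a and x - b.
  The step in m is an identity between quadratic polynomials in q1 and q2, and it holds coefficient
  by coefficient. The hardest coefficient is that of q1^2, which says that Y_(m+1)
  \<open>\<beta>\<close> = Y_m A with \<open>\<beta>\<close> and A taken at x - m. No commutation of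
  Y with A or D is needed, because new factors are always appended on the right. The supertraces
  average over all permutations, so that single entries of the fused block need not be known: it is
  enough that its signed row sums (column sums for \<open>H_m\<close>) are all equal.\<close>

unbundle fps_syntax

subsection \<open>Schur complements and commutation up to a central factor\<close>

text \<open>Cleared form of \<open>u - v\<close>: with \<open>y = z - w\<close> and \<open>e = w z\<close>, where \<open>w = 1/u\<close> and \<open>z = 1/v\<close>, one has \<open>u - v = y/e\<close>.
  In the locales below the variables \<open>a, b, c, d\<close> stand for the entries of \<open>T(u)\<close> and \<open>A, B, C, D\<close> for those of \<open>T(v)\<close>.\<close>
locale central_pair =
  fixes y e :: "'b::ring_1"
  assumes y_comm: "y * x = x * y" and e_comm: "e * x = x * e"
    and y_cancel: "y * x = 0 \<Longrightarrow> x = 0"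
begin

lemma pull:
  "x * y = y * x" "x * (y * z) = y * (x * z)"
  "x * e = e * x" "x * (e * z) = e * (x * z)"
proof -
  show y: "x * y = y * x" for x by (rule y_comm[symmetric])
  show e: "x * e = e * x" for x by (rule e_comm[symmetric])
  show "x * (y * z) = y * (x * z)" by (metis y mult.assoc)
  show "x * (e * z) = e * (x * z)" by (metis e mult.assoc)
qed

lemma y_cancel_eq: "y * a = y * b \<Longrightarrow> a = b"
  using y_cancel[of "a - b"] by (simp add: right_diff_distrib)

end

text \<open>Block elimination: the second equation gives z, and the first then determines x. In the
  commutation lemmas x is a product that is to be reordered.\<close>

lemma schur_solve:
  fixes A :: "'b::ring_1"
  assumes "A' * A = 1" and s: "s * (D - B * A' * C) = 1"
    and 1: "D * x + B * z = f" and 2: "C * x + A * z = g"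
  shows "x = s * (f - B * A' * g)"
proof -
  have "z = A' * (g - C * x)"
    using assms(1) 2 by (metis add_diff_cancel_left' mult.assoc mult_1)
  then have "f - B * A' * g = (D - B * A' * C) * x"
    using 1 by (auto simp: right_diff_distrib left_diff_distrib mult.assoc)
  then show ?thesis
    using s by (metis mult.assoc mult_1)
qed

text \<open>The column (s, p) is a column of the inverse of the matrix with rows (D, B) and (C, A);
  \<open>row2\<close> and \<open>row1\<close> record this.\<close>

locale schur_data = central_pair y e for y e :: "'b::ring_1" +
  fixes A B C D A' s p :: 'b
  assumes A'_left: "A' * A = 1" and A'_right: "A * A' = 1"
    and s_left: "s * (D - B * A' * C) = 1" and s_right: "(D - B * A' * C) * s = 1"
    and p_def: "p = - (A' * C * s)"
begin

lemmas pull_letters = pull[where x = A] pull[where x = B] pull[where x = C] pull[where x = D]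
  pull[where x = A'] pull[where x = s] pull[where x = p] pull(1,2)[where x = e]

lemma row2: "D * s + B * p = 1"
  using s_right by (simp add: p_def algebra_simps)

lemma row1: "C * s + A * p = 0"
  using A'_right by (simp add: p_def) (metis mult.assoc mult_1)

text \<open>Multiply \<open>row2\<close> and \<open>row1\<close> by a from the left and move a
  inwards with RTT. The commutators reproduce the same rows, so \<open>y * a * s\<close> solves a
  linear system with right side (y a, 0), whose solution is \<open>s * (y * a)\<close>.\<close>

lemma comm_A:
  assumes "y * (a * D - D * a) = e * (b * C - B * c)"
    and "y * (a * B - B * a) = e * (b * A - B * a)"
    and "y * (a * C - C * a) = e * (a * C - A * c)"
    and "a * A = A * a"
  shows "s * a = a * s"
proof -
  note pulls = pull_letters pull[where x = a] pull[where x = b] pull[where x = c]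
  \<comment> \<open>The row (c, a) of T(u) applied to the column (s, p); it absorbs the terms in
    which RTT has exchanged the two arguments.\<close>
  let ?K = "c * s + a * p"
  have "D * (y * a * s) + B * (y * a * p - e * ?K)
      = y * a * (D * s + B * p) - y * (a * D - D * a) * s - y * (a * B - B * a) * p - B * e * ?K"
    by (simp add: algebra_simps pulls)
  also have "\<dots> = y * a * (D * s + B * p) - e * b * (C * s + A * p)"
    unfolding assms by (simp add: algebra_simps pulls)
  finally have 1: "D * (y * a * s) + B * (y * a * p - e * ?K) = y * a"
    by (simp add: row1 row2)
  have "C * (y * a * s) + A * (y * a * p - e * ?K)
      = y * a * (C * s + A * p) - y * (a * C - C * a) * s - y * (a * A - A * a) * p - A * e * ?K"
    by (simp add: algebra_simps pulls)
  also have "\<dots> = y * a * (C * s + A * p) - e * a * (C * s + A * p)"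
    unfolding assms(3) using assms(4) by (simp add: algebra_simps pulls) (simp flip: mult.assoc)
  finally have 2: "C * (y * a * s) + A * (y * a * p - e * ?K) = 0"
    by (simp add: row1)
  have "y * a * s = s * (y * a)"
    using schur_solve[OF A'_left s_left 1 2] by simp
  then have "y * (a * s) = y * (s * a)"
    by (simp add: pulls mult.assoc)
  then show ?thesis
    using y_cancel_eq by metis
qed

text \<open>The linear system now has right side ((y + e) b, e a), and the extra terms are
  compensated by the factor A. \<open>BA\<close> and \<open>BA'\<close> are two expressions for one
  commutator: the first serves the elimination, the second the final reordering.\<close>

lemma comm_B:
  assumes BD: "y * (b * D - D * b) = e * (B * d - b * D)"
    and BB: "y * (b * B + B * b) = e * (B * b - b * B)"
    and BC: "y * (b * C + C * b) = e * (a * D - A * d)"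
    and BA: "y * (b * A - A * b) = e * (a * B - A * b)"
    and BA': "y * (b * A - A * b) = e * (B * a - b * A)"
    and AA: "a * A = A * a" and As: "s * A = A * s"
  shows "A * s * b = b * (A * s)"
proof -
  note pulls = pull_letters pull[where x = a] pull[where x = b] pull[where x = d]
  let ?L = "d * s + b * p"
  have "D * (y * b * s) + B * (e * ?L - y * b * p)
      = y * b * (D * s + B * p) - y * (b * D - D * b) * s - y * (b * B + B * b) * p + B * e * ?L"
    by (simp add: algebra_simps pulls)
  also have "\<dots> = (y + e) * b * (D * s + B * p)"
    unfolding BD BB by (simp add: algebra_simps pulls)
  finally have 1: "D * (y * b * s) + B * (e * ?L - y * b * p) = (y + e) * b"
    by (simp add: row2)
  have "C * (y * b * s) + A * (e * ?L - y * b * p)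
      = y * (b * C + C * b) * s + y * (b * A - A * b) * p - y * b * (C * s + A * p) + A * e * ?L"
    by (simp add: algebra_simps pulls)
  also have "\<dots> = e * a * (D * s + B * p) - y * b * (C * s + A * p)"
    unfolding BC BA by (simp add: algebra_simps pulls)
  finally have 2: "C * (y * b * s) + A * (e * ?L - y * b * p) = e * a"
    by (simp add: row1 row2)
  have x: "y * b * s = s * ((y + e) * b - B * A' * (e * a))"
    using schur_solve[OF A'_left s_left 1 2] .
  have A: "A' * a * A = a"
    using AA A'_left by (metis mult.assoc mult_1)
  have "y * (b * (A * s)) = y * b * s * A"
    by (simp add: mult.assoc flip: As)
  also have "\<dots> = s * ((y + e) * b * A - e * B * (A' * a * A))"
    unfolding x by (simp add: algebra_simps pulls)
  also have "\<dots> = s * (y * (b * A - A * b) - e * (B * a - b * A) + y * A * b)"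
    unfolding A by (simp add: algebra_simps pulls)
  also have "\<dots> = s * (y * A * b)"
    unfolding BA' by simp
  also have "\<dots> = y * (A * s * b)"
    by (simp add: pulls mult.assoc flip: As) 
  finally show ?thesis
    using y_cancel_eq by metis
qed

text \<open>The unknown is \<open>y * c * s + e * ?K\<close>, with right side (y c, 0). Multiplying
  by A and inserting the definition of p turns the \<open>e\<close> terms into (A c - a C) s, which
  \<open>CA'\<close> trades for the commutator of c and A.\<close>

lemma comm_C:
  assumes CC: "y * (c * C + C * c) = e * (c * C - C * c)"
    and CA: "y * (c * A - A * c) = e * (c * A - C * a)"
    and CA': "y * (c * A - A * c) = e * (A * c - a * C)"
    and CB: "y * (c * B + B * c) = e * (D * a - d * A)"
    and CD: "y * (c * D - D * c) = e * (D * c - d * C)"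
    and AA: "a * A = A * a" and As: "s * A = A * s"
  shows "A * s * c = c * (A * s)"
proof -
  note pulls = pull_letters pull[where x = a] pull[where x = c] pull[where x = d]
  let ?K = "c * s + a * p"
  have "D * (y * c * s + e * ?K) + B * (- (y * c * p))
      = y * c * (D * s + B * p) - y * (c * D - D * c) * s - y * (c * B + B * c) * p + D * e * ?K"
    by (simp add: algebra_simps pulls)
  also have "\<dots> = y * c * (D * s + B * p) + e * d * (C * s + A * p)"
    unfolding CD CB by (simp add: algebra_simps pulls)
  finally have 1: "D * (y * c * s + e * ?K) + B * (- (y * c * p)) = y * c"
    by (simp add: row1 row2)
  have "C * (y * c * s + e * ?K) + A * (- (y * c * p))
      = y * (c * C + C * c) * s + y * (c * A - A * c) * p - y * c * (C * s + A * p) + C * e * ?K"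
    by (simp add: algebra_simps pulls)
  also have "\<dots> = e * c * (C * s + A * p) - y * c * (C * s + A * p)"
    unfolding CC CA by (simp add: algebra_simps pulls)
  finally have 2: "C * (y * c * s + e * ?K) + A * (- (y * c * p)) = 0"
    by (simp add: row1)
  have x: "y * c * s + e * ?K = s * (y * c)"
    using schur_solve[OF A'_left s_left 1 2] by simp
  have A: "A * a * A' = a"
    using AA A'_right by (metis mult.assoc mult.right_neutral)
  have "y * (A * s * c) = A * (s * (y * c))"
    by (simp add: pulls mult.assoc)
  also have "\<dots> = y * A * c * s + e * A * c * s - e * (A * a * A') * C * s"
    unfolding x[symmetric] p_def by (simp add: algebra_simps pulls)
  also have "\<dots> = (e * (A * c - a * C) - y * (c * A - A * c)) * s + y * c * A * s"
    unfolding A by (simp add: algebra_simps pulls)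
  also have "\<dots> = y * (c * (A * s))"
    unfolding CA' by (simp add: mult.assoc)
  finally show ?thesis
    using y_cancel_eq by metis
qed

end

subsection \<open>Substitution into power series and the shift of the spectral parameter\<close>

lemma mult_power_nth_eq_0:
  fixes f X :: "'a::ring_1 fps"
  assumes "X $ 0 = 0" "n < r"
  shows "(f * X ^ r) $ n = 0"
  using assms(2)
proof (induction r arbitrary: n)
  case (Suc r)
  have "(f * X ^ r) $ i * X $ (n - i) = 0" if "i \<le> n" for i
    using Suc that assms(1) by (cases "i = n") auto
  then have "(f * X ^ r * X) $ n = 0"
    unfolding fps_mult_nth[of "f * X ^ r"] by (intro sum.neutral) auto
  then show ?case
    by (simp only: power_Suc2 mult.assoc)
qed simp

text \<open>The sum may stop at n because X^r has no terms below degree r when X has no constant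
  term. With \<open>\<phi>\<close> = \<open>fps_const\<close> this is the shift in one variable;
  with \<open>\<phi>\<close> = \<open>shiftx b\<close> it evaluates a two-variable series.\<close>

definition fps_ev :: "('r \<Rightarrow> 'a fps) \<Rightarrow> 'a fps \<Rightarrow> 'r::ring_1 fps \<Rightarrow> 'a::ring_1 fps" where
  "fps_ev \<phi> X f = Abs_fps (\<lambda>n. \<Sum>r\<le>n. (\<phi> (f $ r) * X ^ r) $ n)"

locale fps_subst =
  fixes \<phi> :: "'r::ring_1 \<Rightarrow> 'a::ring_1 fps" and X :: "'a fps"
  assumes \<phi>_add: "\<phi> (a + b) = \<phi> a + \<phi> b"
    and \<phi>_mult: "\<phi> (a * b) = \<phi> a * \<phi> b"
    and \<phi>_one: "\<phi> 1 = 1"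
    and X_0: "X $ 0 = 0"
    and X_comm: "\<And>f. X * f = f * X"
begin

lemma \<phi>_zero: "\<phi> 0 = 0"
  using \<phi>_add[of 0 0] by simp

lemma \<phi>_diff: "\<phi> (a - b) = \<phi> a - \<phi> b"
  using \<phi>_add[of "a - b" b] by simp

lemma \<phi>_sum: "\<phi> (sum g S) = (\<Sum>i\<in>S. \<phi> (g i))"
  by (induction S rule: infinite_finite_induct) (auto simp: \<phi>_zero \<phi>_add)

lemma power_X_comm: "X ^ n * f = f * X ^ n"
  by (rule power_commuting_commutes[OF X_comm])

lemma ev_add: "fps_ev \<phi> X (f + g) = fps_ev \<phi> X f + fps_ev \<phi> X g"
  by (rule fps_ext) (simp add: fps_ev_def \<phi>_add algebra_simps sum.distrib)

lemma ev_diff: "fps_ev \<phi> X (f - g) = fps_ev \<phi> X f - fps_ev \<phi> X g"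
  by (rule fps_ext) (simp add: fps_ev_def \<phi>_diff left_diff_distrib sum_subtractf)

lemma ev_const: "fps_ev \<phi> X (fps_const a) = \<phi> a"
proof (rule fps_ext)
  fix n
  have "(\<Sum>r\<le>n. (\<phi> (fps_const a $ r) * X ^ r) $ n) = (\<Sum>r\<le>n. if r = 0 then \<phi> a $ n else 0)"
    by (intro sum.cong) (auto simp: \<phi>_zero)
  then show "fps_ev \<phi> X (fps_const a) $ n = \<phi> a $ n"
    by (simp add: fps_ev_def)
qed

lemma ev_1: "fps_ev \<phi> X 1 = 1"
  using ev_const[of 1] by (simp add: \<phi>_one)

lemma ev_X: "fps_ev \<phi> X fps_X = X"
proof (rule fps_ext)
  fix n
  have "(\<Sum>r\<le>n. (\<phi> (fps_X $ r) * X ^ r) $ n) = (\<Sum>r\<le>n. if r = 1 then X $ n else 0)"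
    by (intro sum.cong) (auto simp: \<phi>_zero \<phi>_one)
  then show "fps_ev \<phi> X fps_X $ n = X $ n"
    by (cases "n = 0") (auto simp: fps_ev_def X_0)
qed

lemma ev_mult: "fps_ev \<phi> X (f * g) = fps_ev \<phi> X f * fps_ev \<phi> X g"
proof (rule fps_ext)
  fix n
  define F where "F i = \<phi> (f $ i) * X ^ i" for i
  define G where "G i = \<phi> (g $ i) * X ^ i" for i
  have FG: "F i * G j = \<phi> (f $ i) * \<phi> (g $ j) * X ^ (i + j)" for i j
    unfolding F_def G_def power_add by (metis power_X_comm mult.assoc)
  have F0: "F i $ k = 0" and G0: "G i $ k = 0" if "k < i" for i k
    using mult_power_nth_eq_0[OF X_0 that] by (simp_all add: F_def G_def)
  have evF: "fps_ev \<phi> X f $ k = (\<Sum>i\<le>n. F i $ k)"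
    and evG: "fps_ev \<phi> X g $ k = (\<Sum>i\<le>n. G i $ k)" if "k \<le> n" for k
  proof -
    show "fps_ev \<phi> X f $ k = (\<Sum>i\<le>n. F i $ k)"
      unfolding fps_ev_def fps_nth_Abs_fps F_def[symmetric] using that
      by (intro sum.mono_neutral_left) (auto simp: F0)
    show "fps_ev \<phi> X g $ k = (\<Sum>i\<le>n. G i $ k)"
      unfolding fps_ev_def fps_nth_Abs_fps G_def[symmetric] using that
      by (intro sum.mono_neutral_left) (auto simp: G0)
  qed
  have "(fps_ev \<phi> X f * fps_ev \<phi> X g) $ n
      = (\<Sum>k=0..n. (\<Sum>i\<le>n. F i $ k) * (\<Sum>j\<le>n. G j $ (n - k)))"
    by (simp add: fps_mult_nth evF evG)
  also have "\<dots> = (\<Sum>k=0..n. \<Sum>i\<le>n. \<Sum>j\<le>n. F i $ k * G j $ (n - k))"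
    by (simp add: sum_product)
  also have "\<dots> = (\<Sum>i\<le>n. \<Sum>k=0..n. \<Sum>j\<le>n. F i $ k * G j $ (n - k))"
    by (rule sum.swap)
  also have "\<dots> = (\<Sum>i\<le>n. \<Sum>j\<le>n. \<Sum>k=0..n. F i $ k * G j $ (n - k))"
    by (intro sum.cong refl sum.swap)
  also have "\<dots> = (\<Sum>i\<le>n. \<Sum>j\<le>n. (F i * G j) $ n)"
    by (simp add: fps_mult_nth)
  also have "\<dots> = (\<Sum>(i, j)\<in>{..n} \<times> {..n}. (F i * G j) $ n)"
    by (simp add: sum.cartesian_product)
  \<comment> \<open>\<open>F i * G j\<close> is a multiple of X^(i+j), hence has no coefficient at n
    once i + j > n.\<close>
  also have "\<dots> = (\<Sum>(i, j)\<in>{(i, j). i + j \<le> n}. (F i * G j) $ n)"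
    by (rule sum.mono_neutral_right)
       (auto simp: FG intro!: mult_power_nth_eq_0[OF X_0])
  also have "\<dots> = (\<Sum>r\<le>n. \<Sum>i\<le>r. (F i * G (r - i)) $ n)"
    by (rule sum.triangle_reindex_eq)
  also have "\<dots> = fps_ev \<phi> X (f * g) $ n"
    by (simp add: fps_ev_def fps_mult_nth \<phi>_sum \<phi>_mult FG sum_distrib_right fps_sum_nth
        atLeast0AtMost)
  finally show "fps_ev \<phi> X (f * g) $ n = (fps_ev \<phi> X f * fps_ev \<phi> X g) $ n" ..
qed

end

text \<open>The expansion \<open>z / (1 - a z)\<close> of \<open>1 / (x - a)\<close> in \<open>z = 1 / x\<close>.\<close>
definition fps_geo :: "int \<Rightarrow> 'a::ring_1 fps" where
  "fps_geo a = Abs_fps (\<lambda>n. if n = 0 then 0 else of_int a ^ (n - 1))"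

lemma fps_geo_0: "fps_geo a $ 0 = 0"
  by (simp add: fps_geo_def)

lemma of_int_central: "(of_int k :: 'a::ring_1) * x = x * of_int k"
  by (rule mult_of_int_commute)

lemma fps_geo_comm: "fps_geo a * f = f * (fps_geo a :: 'a::ring_1 fps)"
proof (rule fps_ext)
  fix n
  have c: "fps_geo a $ i * y = y * (fps_geo a $ i :: 'a)" for i y
    by (simp add: fps_geo_def mult_of_int_commute flip: of_int_power)
  have "(fps_geo a * f) $ n = (\<Sum>i\<le>n. f $ i * fps_geo a $ (n - i))"
    unfolding fps_mult_nth c
    by (rule sum.reindex_bij_witness[of _ "\<lambda>i. n - i" "\<lambda>i. n - i"]) auto
  then show "(fps_geo a * f) $ n = (f * fps_geo a) $ n"
    by (simp add: fps_mult_nth atLeast0AtMost)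
qed

lemma fps_geo_eq: "(fps_geo a :: 'a::ring_1 fps) = fps_X + of_int a * fps_X * fps_geo a"
proof (rule fps_ext)
  fix n
  show "fps_geo a $ n = (fps_X + of_int a * fps_X * fps_geo a :: 'a fps) $ n"
  proof (cases n)
    case 0 then show ?thesis by (simp add: fps_geo_def mult.assoc)
  next
    case (Suc k)
    have "of_int a = (fps_const (of_int a) :: 'a fps)" by (simp add: fps_of_int)
    then show ?thesis
      by (cases k) (auto simp: Suc fps_geo_def mult.assoc)
  qed
qed

text \<open>Multiplying \<open>fps_geo_eq\<close> by a power gives Pascal's rule. The coefficients
  are those in \<open>shiftx\<close>, which makes \<open>shiftx\<close> a substitution and therefore
  multiplicative.\<close>

lemma fps_geo_power_nth:
  "(fps_geo a ^ Suc r :: 'a::ring_1 fps) $ n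
     = (if r < n then of_nat ((n - 1) choose (n - Suc r)) * of_int a ^ (n - Suc r) else 0)"
proof (induction n arbitrary: r)
  case 0
  show ?case by (simp add: fps_geo_0)
next
  case (Suc n)
  have e: "of_int a = (fps_const (of_int a) :: 'a fps)" by (simp add: fps_of_int)
  have "(fps_geo a ^ Suc r :: 'a fps) = fps_X * fps_geo a ^ r + of_int a * (fps_X * fps_geo a ^ Suc r)"
    by (subst (1) power_Suc, subst (1) fps_geo_eq) (simp add: algebra_simps)
  note * = this
  have *: "(fps_geo a ^ Suc r :: 'a fps) $ Suc n = (fps_geo a ^ r) $ n + of_int a * (fps_geo a ^ Suc r) $ n"
    by (subst *) (simp add: e del: power_Suc)
  show ?case
  proof (cases r)
    case 0
    then show ?thesis unfolding * using Suc.IH[of 0] by (cases n) auto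
  next
    case r: (Suc k)
    show ?thesis
    proof (cases "r < n")
      case True
      then obtain d where n: "n = Suc (r + d)" using less_imp_Suc_add by blast
      have "(fps_geo a ^ r :: 'a fps) $ n = of_nat (r + d choose Suc d) * of_int a ^ Suc d"
        using Suc.IH[of k] n r by simp
      moreover have "(fps_geo a ^ Suc r :: 'a fps) $ n = of_nat (r + d choose d) * of_int a ^ d"
        using Suc.IH[of r] n by simp
      ultimately have "(fps_geo a ^ Suc r :: 'a fps) $ Suc n
          = of_nat (r + d choose Suc d) * of_int a ^ Suc d
            + of_int a * (of_nat (r + d choose d) * of_int a ^ d)"
        unfolding * by (simp only:)
      also have "of_int a * (of_nat (r + d choose d) * of_int a ^ d)
          = (of_nat (r + d choose d) * of_int a ^ Suc d :: 'a)"
        by (metis of_int_central mult.assoc power_Suc2)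
      also have "of_nat (r + d choose Suc d) * of_int a ^ Suc d + of_nat (r + d choose d) * of_int a ^ Suc d
          = (of_nat (Suc (r + d) choose Suc d) * of_int a ^ Suc d :: 'a)"
        by (simp add: distrib_right del: power_Suc)
      finally show ?thesis
        using n by simp
    next
      case False
      have "(fps_geo a ^ Suc k :: 'a fps) $ n = (if r = n then 1 else 0)"
        unfolding Suc.IH[of k] using False r by auto
      moreover have "(fps_geo a ^ Suc r :: 'a fps) $ n = 0"
        unfolding Suc.IH[of r] using False by auto
      ultimately show ?thesis
        using * False by (auto simp: r simp del: power_Suc)
    qed
  qed
qed

subsection \<open>The RTT relation in two variables\<close>

lemma idx_2: "idx 2 = {[1, 1], [1, 2], [2, 1], [2, 2]}"
proof
  show "idx 2 \<subseteq> {[1, 1], [1, 2], [2, 1], [2, 2]}"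
    by (auto simp: idx_def length_Suc_conv numeral_2_eq_2)
qed (auto simp: idx_def)

lemma msgn_exp_pair: "msgn_exp [i, j] [k, l] [p, q]
    = (pty i + pty j + (pty k + pty l)) * (pty k + pty l + (pty p + pty q))
      + (pty j + pty l) * (pty k + pty p)"
  by (simp add: msgn_exp_def ptys_def)

lemma embk_pair:
  "embk 0 F [i, j] [k, l] = (if j = l then F i k else 0)"
  "embk 1 F [i, j] [k, l] = (if i = k then F j l else 0)"
  "Pk 0 [i, j] [k, l] = (if i = l \<and> j = k then (-1) ^ pty j else 0)"
  by (auto simp: embk_def Pk_def All_less_Suc)

lemma mmul_2: "mmul 2 X Y I L = (\<Sum>J\<leftarrow>[[1, 1], [1, 2], [2, 1], [2, 2]].
    (-1) ^ msgn_exp I J L * X I J * Y J L)"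
  by (simp add: mmul_def idx_2)

lemma pty_12: "pty 1 = 0" "pty 2 = 1"
  by (simp_all add: pty_def)

text \<open>At most one middle index contributes to each product, so an entry of RTT becomes a short
  signed sum.\<close>

lemma
  assumes "i \<in> {1, 2}" "j \<in> {1, 2}" "k \<in> {1, 2}" "l \<in> {1, 2}"
  shows mmul_embk_0_1: "mmul 2 (embk 0 F) (embk 1 G) [i, j] [k, l]
      = (-1) ^ ((pty i + pty k) * (pty j + pty l)) * F i k * G j l"
    and mmul_embk_1_0: "mmul 2 (embk 1 G) (embk 0 F) [i, j] [k, l] = G j l * F i k"
    and mmul_Pk_left: "mmul 2 (Pk 0) Z [i, j] [k, l]
      = (-1) ^ (pty j + (pty i + pty j) * (pty j + pty k)) * Z [j, i] [k, l]"
    and mmul_Pk_right: "mmul 2 Z (Pk 0) [i, j] [k, l]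
      = (-1) ^ (pty k + (pty j + pty k) * (pty l + pty k)) * Z [i, j] [l, k]"
  using assms unfolding mmul_2
  by (elim insertE emptyE; simp add: embk_pair msgn_exp_pair pty_12 del: One_nat_def)+

lemma eq_if_diff_eq:
  fixes a b c d :: "'b::ab_group_add"
  assumes "a = b"
  shows "c - d = a - b \<Longrightarrow> c = d" "c - d = b - a \<Longrightarrow> c = d"
  using assms by simp_all

section \<open>Power series in two independent variables\<close>

definition biv :: "(nat \<Rightarrow> nat \<Rightarrow> 'a::ring_1) \<Rightarrow> 'a fps fps" where
  "biv f = Abs_fps (\<lambda>r. Abs_fps (f r))"

text \<open>The outer variable is w = 1/u and the inner one z = 1/v: \<open>fps_outer f\<close> is
  f(u) and \<open>fps_const g\<close> is g(v). Accordingly \<open>biv_y\<close> is z - w and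
  \<open>biv_e\<close> is w z.\<close>

definition fps_outer :: "'a::ring_1 fps \<Rightarrow> 'a fps fps" where
  "fps_outer f = Abs_fps (\<lambda>r. fps_const (f $ r))"

definition biv_y :: "'a::ring_1 fps fps" where
  "biv_y = fps_const fps_X - fps_X"

definition biv_e :: "'a::ring_1 fps fps" where
  "biv_e = fps_X * fps_const fps_X"

lemma fps_outer_mult_const: "fps_outer f * fps_const g = biv (\<lambda>r s. f $ r * g $ s)"
  and fps_const_mult_outer: "fps_const g * fps_outer f = biv (\<lambda>r s. g $ s * f $ r)"
  by (auto simp: fps_eq_iff biv_def fps_outer_def)

lemma biv_diff: "biv f - biv g = biv (\<lambda>r s. f r s - g r s)"
  and biv_add: "biv f + biv g = biv (\<lambda>r s. f r s + g r s)"
  by (auto simp: fps_eq_iff biv_def)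

text \<open>The vanishing boundary values stand for the coefficients of index -1. They hold for the
  commutators and anticommutators below because the constant term of each T_ij is 0 or 1.\<close>

lemma biv_relation:
  assumes "\<And>r s. f (Suc r) s - f r (Suc s) = h r s"
    and "\<And>s. f 0 s = 0" "\<And>r. f r 0 = 0"
  shows "biv_y * biv f = biv_e * biv h"
proof (rule fps_ext, rule fps_ext)
  fix r s
  show "(biv_y * biv f) $ r $ s = (biv_e * biv h) $ r $ s"
    using assms(2,3) assms(1)[symmetric]
    by (cases r; cases s) (simp_all add: biv_y_def biv_e_def biv_def left_diff_distrib mult.assoc)
qed

lemma fps_X_central: "(fps_X :: 'a::ring_1 fps) * f = f * fps_X"
  by (simp add: fps_eq_iff)

lemma fps_const_central:
  fixes c :: "'a::ring_1"
  assumes "\<And>x. c * x = x * c"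
  shows "fps_const c * f = f * fps_const c"
  by (rule fps_ext) (simp add: assms)

lemma fps_X_mult_eq_0: "fps_X * f = 0 \<Longrightarrow> f = (0 :: 'a::ring_1 fps)"
proof (rule fps_ext)
  fix n assume "fps_X * f = 0"
  then have "(fps_X * f) $ Suc n = 0" by simp
  then show "f $ n = 0 $ n" by simp
qed

text \<open>For cancellation, compare coefficients of w^n in (z - w) x = 0: z x_n = x_(n-1), and z
  is cancellable.\<close>

lemma central_pair_biv: "central_pair (biv_y :: 'a::ring_1 fps fps) biv_e"
proof
  fix x :: "'a fps fps"
  have c: "fps_const fps_X * x = x * fps_const fps_X" for x :: "'a fps fps"
    by (rule fps_const_central) (rule fps_X_central)
  show "biv_y * x = x * biv_y"
    by (simp add: biv_y_def left_diff_distrib right_diff_distrib c fps_X_central)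
  show "biv_e * x = x * biv_e"
    unfolding biv_e_def by (metis c fps_X_central mult.assoc)
  assume *: "biv_y * x = 0"
  have "x $ n = 0" for n
  proof (induction n)
    case 0
    have "fps_X * x $ 0 = 0"
      using arg_cong[OF *, of "\<lambda>f. f $ 0"] by (simp add: biv_y_def left_diff_distrib)
    then show ?case by (rule fps_X_mult_eq_0)
  next
    case (Suc n)
    have "fps_X * x $ Suc n = 0"
      using arg_cong[OF *, of "\<lambda>f. f $ Suc n"] Suc by (simp add: biv_y_def left_diff_distrib)
    then show ?case by (rule fps_X_mult_eq_0)
  qed
  then show "x = 0" by (simp add: fps_eq_iff)
qed

locale yangian =
  fixes t :: "nat \<Rightarrow> nat \<Rightarrow> nat \<Rightarrow> 'a::ring_1"
  assumes rtt: "yangian_rtt t"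
begin

abbreviation "A \<equiv> Tser t 1 1"
abbreviation "B \<equiv> Tser t 1 2"
abbreviation "C \<equiv> Tser t 2 1"
abbreviation "D \<equiv> Tser t 2 2"
abbreviation "At \<equiv> fps_const A"
abbreviation "Bt \<equiv> fps_const B"
abbreviation "Ct \<equiv> fps_const C"
abbreviation "Dt \<equiv> fps_const D"
abbreviation "Au \<equiv> fps_outer A"
abbreviation "Bu \<equiv> fps_outer B"
abbreviation "Cu \<equiv> fps_outer C"
abbreviation "Du \<equiv> fps_outer D"
abbreviation "Y \<equiv> biv_y :: 'a fps fps"
abbreviation "E \<equiv> biv_e :: 'a fps fps"

lemma series_0: "A $ 0 = 1" "B $ 0 = 0" "C $ 0 = 0" "D $ 0 = 1"
  by (simp_all add: Tser_def tcoef_def)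

lemmas rtt_instance = rtt[unfolded yangian_rtt_def Let_def, rule_format]

lemma pair_in_idx: "[1, 1] \<in> idx 2" "[1, 2] \<in> idx 2" "[2, 1] \<in> idx 2" "[2, 2] \<in> idx 2"
  by (simp_all add: idx_def)

lemmas rtt_simps = mmul_embk_0_1 mmul_embk_1_0 mmul_Pk_left mmul_Pk_right pty_12 Tser_def algebra_simps

lemmas biv_simps = fps_outer_mult_const fps_const_mult_outer biv_add biv_diff

text \<open>This and the following relations are single matrix entries of RTT. Instantiating with
  \<open>s r\<close> instead of \<open>r s\<close> exchanges u and v. \<open>rel_BA\<close> and
  \<open>rel_BA'\<close> (likewise \<open>rel_CA\<close> and \<open>rel_CA'\<close>) share the left
  side but come from different entries.\<close>

lemma rel_AD: "Y * (Au * Dt - Dt * Au) = E * (Bu * Ct - Bt * Cu)"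
  unfolding biv_simps
proof (rule biv_relation, goal_cases)
  case (1 r s)
  show ?case
    by (rule eq_if_diff_eq(1)[OF rtt_instance[OF pair_in_idx(3) pair_in_idx(3), of s r]])
      (simp add: rtt_simps del: One_nat_def)
qed (simp_all add: series_0 del: One_nat_def)

lemma rel_AB: "Y * (Au * Bt - Bt * Au) = E * (Bu * At - Bt * Au)"
  unfolding biv_simps
proof (rule biv_relation, goal_cases)
  case (1 r s)
  show ?case
    by (rule eq_if_diff_eq(1)[OF rtt_instance[OF pair_in_idx(1) pair_in_idx(3), of s r]])
      (simp add: rtt_simps del: One_nat_def)
qed (simp_all add: series_0 del: One_nat_def)

lemma rel_AC: "Y * (Au * Ct - Ct * Au) = E * (Au * Ct - At * Cu)"
  unfolding biv_simps
proof (rule biv_relation, goal_cases)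
  case (1 r s)
  show ?case
    by (rule eq_if_diff_eq(1)[OF rtt_instance[OF pair_in_idx(3) pair_in_idx(1), of s r]])
      (simp add: rtt_simps del: One_nat_def)
qed (simp_all add: series_0 del: One_nat_def)

lemma rel_AA: "Y * (Au * At - At * Au) = E * (At * Au - Au * At)"
  unfolding biv_simps
proof (rule biv_relation, goal_cases)
  case (1 r s)
  show ?case
    by (rule eq_if_diff_eq(1)[OF rtt_instance[OF pair_in_idx(1) pair_in_idx(1), of r s]])
      (simp add: rtt_simps del: One_nat_def)
qed (simp_all add: series_0 del: One_nat_def)

lemma rel_BD: "Y * (Bu * Dt - Dt * Bu) = E * (Bt * Du - Bu * Dt)"
  unfolding biv_simps
proof (rule biv_relation, goal_cases)
  case (1 r s)
  show ?case
    by (rule eq_if_diff_eq(1)[OF rtt_instance[OF pair_in_idx(3) pair_in_idx(4), of s r]])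
      (simp add: rtt_simps del: One_nat_def)
qed (simp_all add: series_0 del: One_nat_def)

lemma rel_BB: "Y * (Bu * Bt + Bt * Bu) = E * (Bt * Bu - Bu * Bt)"
  unfolding biv_simps
proof (rule biv_relation, goal_cases)
  case (1 r s)
  show ?case
    by (rule eq_if_diff_eq(2)[OF rtt_instance[OF pair_in_idx(1) pair_in_idx(4), of r s]])
      (simp add: rtt_simps del: One_nat_def)
qed (simp_all add: series_0 del: One_nat_def)

lemma rel_BC: "Y * (Bu * Ct + Ct * Bu) = E * (Au * Dt - At * Du)"
  unfolding biv_simps
proof (rule biv_relation, goal_cases)
  case (1 r s)
  show ?case
    by (rule eq_if_diff_eq(1)[OF rtt_instance[OF pair_in_idx(3) pair_in_idx(2), of s r]])
      (simp add: rtt_simps del: One_nat_def)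
qed (simp_all add: series_0 del: One_nat_def)

lemma rel_BA: "Y * (Bu * At - At * Bu) = E * (Au * Bt - At * Bu)"
  unfolding biv_simps
proof (rule biv_relation, goal_cases)
  case (1 r s)
  show ?case
    by (rule eq_if_diff_eq(1)[OF rtt_instance[OF pair_in_idx(1) pair_in_idx(2), of s r]])
      (simp add: rtt_simps del: One_nat_def)
qed (simp_all add: series_0 del: One_nat_def)

lemma rel_BA': "Y * (Bu * At - At * Bu) = E * (Bt * Au - Bu * At)"
  unfolding biv_simps
proof (rule biv_relation, goal_cases)
  case (1 r s)
  show ?case
    by (rule eq_if_diff_eq(1)[OF rtt_instance[OF pair_in_idx(1) pair_in_idx(3), of r s]])
      (simp add: rtt_simps del: One_nat_def)
qed (simp_all add: series_0 del: One_nat_def)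

lemma rel_CC: "Y * (Cu * Ct + Ct * Cu) = E * (Cu * Ct - Ct * Cu)"
  unfolding biv_simps
proof (rule biv_relation, goal_cases)
  case (1 r s)
  show ?case
    by (rule eq_if_diff_eq(2)[OF rtt_instance[OF pair_in_idx(4) pair_in_idx(1), of r s]])
      (simp add: rtt_simps del: One_nat_def)
qed (simp_all add: series_0 del: One_nat_def)

lemma rel_CA: "Y * (Cu * At - At * Cu) = E * (Cu * At - Ct * Au)"
  unfolding biv_simps
proof (rule biv_relation, goal_cases)
  case (1 r s)
  show ?case
    by (rule eq_if_diff_eq(1)[OF rtt_instance[OF pair_in_idx(2) pair_in_idx(1), of s r]])
      (simp add: rtt_simps del: One_nat_def)
qed (simp_all add: series_0 del: One_nat_def)

lemma rel_CA': "Y * (Cu * At - At * Cu) = E * (At * Cu - Au * Ct)"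
  unfolding biv_simps
proof (rule biv_relation, goal_cases)
  case (1 r s)
  show ?case
    by (rule eq_if_diff_eq(1)[OF rtt_instance[OF pair_in_idx(3) pair_in_idx(1), of r s]])
      (simp add: rtt_simps del: One_nat_def)
qed (simp_all add: series_0 del: One_nat_def)

lemma rel_CB: "Y * (Cu * Bt + Bt * Cu) = E * (Dt * Au - Du * At)"
  unfolding biv_simps
proof (rule biv_relation, goal_cases)
  case (1 r s)
  show ?case
    by (rule eq_if_diff_eq(1)[OF rtt_instance[OF pair_in_idx(2) pair_in_idx(3), of s r]])
      (simp add: rtt_simps del: One_nat_def)
qed (simp_all add: series_0 del: One_nat_def)

lemma rel_CD: "Y * (Cu * Dt - Dt * Cu) = E * (Dt * Cu - Du * Ct)"
  unfolding biv_simps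
proof (rule biv_relation, goal_cases)
  case (1 r s)
  show ?case
    by (rule eq_if_diff_eq(1)[OF rtt_instance[OF pair_in_idx(4) pair_in_idx(3), of s r]])
      (simp add: rtt_simps del: One_nat_def)
qed (simp_all add: series_0 del: One_nat_def)

end

subsection \<open>Centrality of the Berezinian\<close>

lemma left_right_inverse_eq:
  fixes f :: "'b::monoid_mult"
  assumes "l * f = 1" "f * r = 1"
  shows "l = r"
proof -
  have "l = l * (f * r)" by (simp add: assms)
  also have "\<dots> = l * f * r" by (simp only: mult.assoc)
  also have "\<dots> = r" by (simp add: assms)
  finally show ?thesis .
qed

lemma commute_mult:
  fixes x :: "'b::semigroup_mult"
  assumes "x * a = a * x" "x * b = b * x"
  shows "x * (a * b) = a * b * x"
proof -
  have "x * (a * b) = x * a * b" by (simp only: mult.assoc)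
  also have "\<dots> = a * (x * b)" by (simp only: assms(1) mult.assoc)
  also have "\<dots> = a * b * x" by (simp only: assms(2) mult.assoc)
  finally show ?thesis .
qed

text \<open>A left and a right inverse coincide, so the description in \<open>sinv\<close> has
  exactly one solution.\<close>

lemma fps_sinv:
  fixes f :: "'a::ring_1 fps"
  assumes "f $ 0 = 1"
  shows "f * sinv f = 1" "sinv f * f = 1"
proof -
  have l: "fps_left_inverse f 1 * f = 1" and r: "f * fps_right_inverse f 1 = 1"
    using assms by (simp_all add: fps_left_inverse fps_right_inverse)
  have "fps_right_inverse f 1 * f = 1"
    using l by (simp only: left_right_inverse_eq[OF l r])
  then have "\<exists>!g. f * g = 1 \<and> g * f = 1"
    using r by (intro ex1I[of _ "fps_right_inverse f 1"]) (auto intro: left_right_inverse_eq)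
  from theI'[OF this] show "f * sinv f = 1" "sinv f * f = 1"
    by (simp_all add: sinv_def)
qed

text \<open>This says that f(u) and g(v) commute for independent u and v, see
  \<open>fps_ccomm_outer\<close>. Unlike f g = g f it survives different shifts of the two
  factors.\<close>

definition fps_ccomm :: "'a::ring_1 fps \<Rightarrow> 'a fps \<Rightarrow> bool" where
  "fps_ccomm f g \<longleftrightarrow> (\<forall>i j. f $ i * g $ j = g $ j * f $ i)"

lemma fps_ccomm_sym: "fps_ccomm f g \<Longrightarrow> fps_ccomm g f"
  by (simp add: fps_ccomm_def)

lemma fps_ccomm_iff_const: "fps_ccomm f g \<longleftrightarrow> (\<forall>i. fps_const (f $ i) * g = g * fps_const (f $ i))"
  by (auto simp: fps_ccomm_def fps_eq_iff)

lemma fps_ccomm_outer: "fps_ccomm f g \<longleftrightarrow> fps_outer f * fps_const g = fps_const g * fps_outer f"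
  unfolding fps_outer_mult_const fps_const_mult_outer
  by (auto simp: fps_ccomm_def biv_def fps_eq_iff)

lemma fps_ccomm_diff: "fps_ccomm f g \<Longrightarrow> fps_ccomm f h \<Longrightarrow> fps_ccomm f (g - h)"
  by (simp add: fps_ccomm_iff_const algebra_simps)

lemma fps_ccomm_mult: "fps_ccomm f g \<Longrightarrow> fps_ccomm f h \<Longrightarrow> fps_ccomm f (g * h)"
  unfolding fps_ccomm_iff_const by (blast intro: commute_mult)

lemma fps_ccomm_inverse:
  assumes "fps_ccomm f g" "g * g' = 1" "g' * g = 1"
  shows "fps_ccomm f g'"
  unfolding fps_ccomm_iff_const
proof
  fix i
  let ?c = "fps_const (f $ i)"
  have "?c * g' = g' * (g * ?c) * g'"
    using assms(3) by (simp flip: mult.assoc)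
  also have "g * ?c = ?c * g"
    using assms(1) by (simp add: fps_ccomm_iff_const)
  also have "g' * (?c * g) * g' = g' * ?c"
    using assms(2) by (simp add: mult.assoc)
  finally show "?c * g' = g' * ?c" .
qed

lemma fps_ccomm_imp_comm:
  assumes "fps_ccomm f g"
  shows "f * g = g * f"
proof (rule fps_ext)
  fix n
  have "(f * g) $ n = (\<Sum>i=0..n. g $ (n - i) * f $ i)"
    using assms by (simp add: fps_mult_nth fps_ccomm_def)
  also have "\<dots> = (\<Sum>i=0..n. g $ i * f $ (n - i))"
    by (rule sum.reindex_bij_witness[of _ "\<lambda>i. n - i" "\<lambda>i. n - i"]) auto
  finally show "(f * g) $ n = (g * f) $ n"
    by (simp add: fps_mult_nth)
qed

lemma biv_cancel:
  fixes x :: "'a::ring_1 fps fps"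
  assumes "(fps_const fps_X - fps_X * h) * x = 0"
  shows "x = 0"
proof -
  have "x $ n = 0" for n
  proof (induction n rule: less_induct)
    case (less n)
    have "(fps_X * (h * x)) $ n = 0"
      using less by (cases n) (auto simp: fps_mult_nth[of h x] intro!: sum.neutral)
    moreover have "fps_X * x $ n = (fps_X * (h * x)) $ n"
      using arg_cong[OF assms, of "\<lambda>f. f $ n"] by (simp add: left_diff_distrib mult.assoc)
    ultimately show ?case
      using fps_X_mult_eq_0 by metis
  qed
  then show ?thesis by (simp add: fps_eq_iff)
qed

context yangian
begin

definition A' where "A' = sinv A"
definition d where "d = D - B * A' * C"
definition s where "s = sinv d"
definition \<beta> where "\<beta> = A * s"

lemma A'_inverse: "A * A' = 1" "A' * A = 1"
  unfolding A'_def by (rule fps_sinv, rule series_0)+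

lemma s_inverse: "d * s = 1" "s * d = 1"
proof -
  have "d $ 0 = 1"
    by (simp add: d_def mult.assoc series_0 del: One_nat_def)
  then show "d * s = 1" "s * d = 1"
    unfolding s_def by (rule fps_sinv)+
qed

text \<open>RTT gives (y + e) [A(u), A(v)] = 0, and y + e = z - w (1 - z) has the form that
  \<open>biv_cancel\<close> can remove.\<close>

lemma ccomm_A_A: "fps_ccomm A A"
proof -
  have "(fps_const fps_X - fps_X * (1 - fps_const fps_X)) * (Au * At - At * Au)
      = Y * (Au * At - At * Au) - E * (At * Au - Au * At)"
    unfolding biv_y_def biv_e_def
    by (simp add: algebra_simps)
  also have "\<dots> = 0"
    unfolding rel_AA by (rule diff_self)
  finally have "(fps_const fps_X - fps_X * (1 - fps_const fps_X)) * (Au * At - At * Au) = 0" .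
  from biv_cancel[OF this] show ?thesis
    by (simp add: fps_ccomm_outer)
qed

interpretation schur_data Y E At Bt Ct Dt "fps_const A'" "fps_const s" "- (fps_const A' * Ct * fps_const s)"
proof (rule schur_data.intro[OF central_pair_biv], unfold_locales)
  show "fps_const A' * At = 1" "At * fps_const A' = 1"
    by (simp_all only: fps_const_mult A'_inverse fps_const_1_eq_1)
  show "fps_const s * (Dt - Bt * fps_const A' * Ct) = 1" "(Dt - Bt * fps_const A' * Ct) * fps_const s = 1"
    by (simp_all only: fps_const_mult fps_const_sub s_inverse fps_const_1_eq_1 flip: d_def)
qed rule

lemma ccomm_A_s: "fps_ccomm A s"
  using comm_A[OF rel_AD rel_AB rel_AC ccomm_A_A[unfolded fps_ccomm_outer]]
  unfolding fps_ccomm_outer by (rule sym)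

lemma A_s_comm: "s * A = A * s"
  by (rule fps_ccomm_imp_comm[OF ccomm_A_s, symmetric])

lemma At_s_comm: "fps_const s * At = At * fps_const s"
  by (simp only: fps_const_mult A_s_comm)

lemma ccomm_A_\<beta>: "fps_ccomm A \<beta>"
  unfolding \<beta>_def by (rule fps_ccomm_mult[OF ccomm_A_A ccomm_A_s])

lemma ccomm_B_\<beta>: "fps_ccomm B \<beta>"
  using comm_B[OF rel_BD rel_BB rel_BC rel_BA rel_BA' ccomm_A_A[unfolded fps_ccomm_outer] At_s_comm]
  unfolding fps_ccomm_outer \<beta>_def fps_const_mult[symmetric] by (rule sym)

lemma ccomm_C_\<beta>: "fps_ccomm C \<beta>"
  using comm_C[OF rel_CC rel_CA rel_CA' rel_CB rel_CD ccomm_A_A[unfolded fps_ccomm_outer] At_s_comm]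
  unfolding fps_ccomm_outer \<beta>_def fps_const_mult[symmetric] by (rule sym)

text \<open>This reduces commutation with \<open>D\<close> to commutation with \<open>A, B, C\<close>.\<close>
lemma D_nth: "D $ i = A $ i + (B $ 1 * C $ i + C $ i * B $ 1)"
proof -
  \<comment> \<open>Both sides of \<open>rel_BC\<close> are compared at w z^(i+1), where the
    constant terms of A and D isolate D_i - A_i.\<close>
  have "(Y * biv (\<lambda>r s. B $ r * C $ s + C $ s * B $ r)) $ 1 $ Suc i = B $ 1 * C $ i + C $ i * B $ 1"
    by (simp add: biv_y_def biv_def left_diff_distrib series_0[unfolded One_nat_def])
  moreover have "(E * biv (\<lambda>r s. A $ r * D $ s - A $ s * D $ r)) $ 1 $ Suc i = D $ i - A $ i"
    by (simp add: biv_e_def biv_def mult.assoc series_0[unfolded One_nat_def])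
  ultimately have "B $ 1 * C $ i + C $ i * B $ 1 = D $ i - A $ i"
    using rel_BC[unfolded biv_simps] by metis
  then show ?thesis by (simp del: One_nat_def)
qed

lemma ccomm_D_\<beta>: "fps_ccomm D \<beta>"
  unfolding fps_ccomm_def
proof (intro allI)
  fix i j
  have b: "\<beta> $ j * B $ 1 = B $ 1 * \<beta> $ j" "\<beta> $ j * C $ i = C $ i * \<beta> $ j"
    using ccomm_B_\<beta> ccomm_C_\<beta> unfolding fps_ccomm_def by metis+
  have "\<beta> $ j * (B $ 1 * C $ i) = B $ 1 * C $ i * \<beta> $ j"
    "\<beta> $ j * (C $ i * B $ 1) = C $ i * B $ 1 * \<beta> $ j"
    by (intro commute_mult b)+
  moreover have "A $ i * \<beta> $ j = \<beta> $ j * A $ i"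
    using ccomm_A_\<beta> unfolding fps_ccomm_def by blast
  ultimately show "D $ i * \<beta> $ j = \<beta> $ j * D $ i"
    unfolding D_nth distrib_left distrib_right by (simp only:)
qed

lemma ccomm_\<beta>_\<beta>: "fps_ccomm \<beta> \<beta>"
proof -
  note \<beta> = ccomm_A_\<beta> ccomm_B_\<beta> ccomm_C_\<beta> ccomm_D_\<beta>
  note \<beta> = \<beta>[THEN fps_ccomm_sym]
  have "fps_ccomm \<beta> A'"
    using \<beta>(1) A'_inverse by (rule fps_ccomm_inverse)
  then have "fps_ccomm \<beta> d"
    unfolding d_def by (intro fps_ccomm_diff fps_ccomm_mult \<beta>)
  then have "fps_ccomm \<beta> s"
    using s_inverse by (rule fps_ccomm_inverse)
  with \<beta>(1) have "fps_ccomm \<beta> (A * s)"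
    by (rule fps_ccomm_mult)
  then show ?thesis
    by (simp only: \<beta>_def[symmetric])
qed

end

subsection \<open>Specialization to integer shifts\<close>

lemma fps_subst_geo: "fps_subst (fps_const :: 'a::ring_1 \<Rightarrow> _) (fps_geo a)"
  by unfold_locales (simp_all add: fps_geo_0 fps_geo_comm)

lemma shiftx_eq_ev: "shiftx a f = fps_ev fps_const (fps_geo a) f"
proof (rule fps_ext)
  fix n
  show "shiftx a f $ n = fps_ev fps_const (fps_geo a) f $ n"
  proof (cases n)
    case 0 then show ?thesis by (simp add: shiftx_def fps_ev_def)
  next
    case (Suc k)
    have "(fps_const (f $ r) * fps_geo a ^ r) $ n
        = of_nat ((n - 1) choose (n - r)) * of_int a ^ (n - r) * f $ r" if "r \<in> {1..n}" for r
    proof -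
      from that obtain q where r: "r = Suc q" by (cases r) auto
      have c: "of_nat x * of_int a ^ y * f $ r = f $ r * (of_nat x * of_int a ^ y)" for x y
        using of_int_central[of "int x * a ^ y" "f $ r"] by simp
      show ?thesis
        unfolding c using that by (simp add: r fps_geo_power_nth del: power_Suc)
    qed
    then have "(\<Sum>r\<in>{1..n}. (fps_const (f $ r) * fps_geo a ^ r) $ n) = shiftx a f $ n"
      using Suc by (simp add: shiftx_def)
    moreover have "{..n} = insert 0 {1..n}" by auto
    ultimately show ?thesis
      using Suc by (simp add: fps_ev_def)
  qed
qed

lemma shiftx_add: "shiftx a (f + g) = shiftx a f + shiftx a g"
  and shiftx_diff: "shiftx a (f - g) = shiftx a f - shiftx a g"
  and shiftx_mult: "shiftx a (f * g) = shiftx a f * shiftx a g"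
  and shiftx_const: "shiftx a (fps_const x) = fps_const x"
  and shiftx_1: "shiftx a 1 = 1"
  and shiftx_X: "shiftx a fps_X = fps_geo a"
  unfolding shiftx_eq_ev
  by (rule fps_subst.ev_add[OF fps_subst_geo] fps_subst.ev_diff[OF fps_subst_geo]
      fps_subst.ev_mult[OF fps_subst_geo] fps_subst.ev_const[OF fps_subst_geo]
      fps_subst.ev_1[OF fps_subst_geo] fps_subst.ev_X[OF fps_subst_geo])+

lemma fps_subst_shiftx: "fps_subst (shiftx b :: 'a::ring_1 fps \<Rightarrow> _) (fps_geo a)"
  by unfold_locales (simp_all add: fps_geo_0 fps_geo_comm shiftx_add shiftx_mult shiftx_1)

lemma fps_geo_cancel: "fps_geo a * f = 0 \<Longrightarrow> f = (0 :: 'a::ring_1 fps)"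
proof -
  assume *: "fps_geo a * f = 0"
  have "fps_X * f = fps_geo a * f - of_int a * fps_X * (fps_geo a * f)"
    by (subst (1) fps_geo_eq) (simp add: algebra_simps)
  then have "fps_X * f = 0" using * by simp
  then show "f = 0" by (rule fps_X_mult_eq_0)
qed

text \<open>The resolvent identity for 1/(x - b) and 1/(x - a). It is checked after multiplication
  by the variable, which is cancellable.\<close>

lemma fps_geo_diff:
  "fps_geo b - fps_geo a = of_int (b - a) * (fps_geo a * fps_geo b :: 'a::ring_1 fps)"
proof -
  let ?a = "fps_geo a :: 'a fps" and ?b = "fps_geo b :: 'a fps" and ?X = "fps_X :: 'a fps"
  have X: "?X = fps_geo k - of_int k * ?X * fps_geo k" for k
    unfolding eq_diff_eq by (rule fps_geo_eq[symmetric])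
  have c: "?X * (of_int k * f) = of_int k * (?X * f)" for k f
    using of_int_central[of k ?X] by (simp only: flip: mult.assoc)
  have "?X * ?b = (?a - of_int a * ?X * ?a) * ?b"
    by (rule arg_cong[OF X])
  then have 1: "?X * ?b = ?a * ?b - of_int a * (?X * (?a * ?b))"
    by (simp add: algebra_simps)
  have "?X * ?a = (?b - of_int b * ?X * ?b) * ?a"
    by (rule arg_cong[OF X])
  then have 2: "?X * ?a = ?a * ?b - of_int b * (?X * (?a * ?b))"
    by (simp add: algebra_simps fps_geo_comm[of b ?a])
  have "?X * ((?b - ?a) - of_int (b - a) * (?a * ?b)) = 0"
    by (simp add: algebra_simps 1 2 c)
  from fps_X_mult_eq_0[OF this] show ?thesis by simp
qed

text \<open>Setting u = x - a and v = x - b makes u - v = b - a: by \<open>fps_geo_diff\<close>, y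
  becomes (b - a) times the value of e, and that value can be cancelled.\<close>

lemma biv_specialize:
  fixes b :: int and f h :: "'a::ring_1 fps fps"
  defines "ev a \<equiv> fps_ev (shiftx b) (fps_geo a)"
  assumes "biv_y * f = biv_e * h"
  shows "of_int (b - a) * ev a f = ev a h"
proof -
  note ev = fps_subst_shiftx[of b a]
  have "ev a (biv_y * f) = (fps_geo b - fps_geo a) * ev a f"
    unfolding biv_y_def ev_def
    by (simp only: fps_subst.ev_mult[OF ev] fps_subst.ev_diff[OF ev] fps_subst.ev_const[OF ev]
        fps_subst.ev_X[OF ev] shiftx_X)
  moreover have "ev a (biv_e * h) = fps_geo a * fps_geo b * ev a h"
    unfolding biv_e_def ev_def
    by (simp only: fps_subst.ev_mult[OF ev] fps_subst.ev_const[OF ev] fps_subst.ev_X[OF ev] shiftx_X)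
  moreover have "of_int (b - a) * (fps_geo a * fps_geo b) * ev a f
      = fps_geo a * fps_geo b * (of_int (b - a) * ev a f)"
    unfolding of_int_central[of "b - a" "fps_geo a * fps_geo b"] by (simp only: mult.assoc)
  ultimately have "fps_geo a * fps_geo b * (of_int (b - a) * ev a f) = fps_geo a * fps_geo b * ev a h"
    using assms(2) unfolding fps_geo_diff by (simp only:)
  then have "fps_geo a * (fps_geo b * (of_int (b - a) * ev a f - ev a h)) = 0"
    unfolding mult.assoc right_diff_distrib by (simp only: diff_self)
  then have "of_int (b - a) * ev a f - ev a h = 0"
    by (rule fps_geo_cancel[OF fps_geo_cancel])
  then show ?thesis by simp
qed

lemma ev_outer_const:
  "fps_ev (shiftx b) (fps_geo a) (fps_outer f * fps_const g) = shiftx a f * shiftx b g"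
  "fps_ev (shiftx b) (fps_geo a) (fps_const g * fps_outer f) = shiftx b g * shiftx a f"
  "fps_ev (shiftx b) (fps_geo a) (F + G) = fps_ev (shiftx b) (fps_geo a) F + fps_ev (shiftx b) (fps_geo a) G"
  "fps_ev (shiftx b) (fps_geo a) (F - G) = fps_ev (shiftx b) (fps_geo a) F - fps_ev (shiftx b) (fps_geo a) G"
proof -
  note ev = fps_subst_shiftx[of b a]
  have o: "fps_ev (shiftx b) (fps_geo a) (fps_outer f) = shiftx a f"
    by (simp add: shiftx_eq_ev[of a] fps_ev_def fps_outer_def shiftx_const)
  show "fps_ev (shiftx b) (fps_geo a) (fps_outer f * fps_const g) = shiftx a f * shiftx b g"
    "fps_ev (shiftx b) (fps_geo a) (fps_const g * fps_outer f) = shiftx b g * shiftx a f"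
    "fps_ev (shiftx b) (fps_geo a) (F + G) = fps_ev (shiftx b) (fps_geo a) F + fps_ev (shiftx b) (fps_geo a) G"
    "fps_ev (shiftx b) (fps_geo a) (F - G) = fps_ev (shiftx b) (fps_geo a) F - fps_ev (shiftx b) (fps_geo a) G"
    by (simp_all only: o fps_subst.ev_mult[OF ev] fps_subst.ev_const[OF ev]
      fps_subst.ev_add[OF ev] fps_subst.ev_diff[OF ev])
qed

lemma fps_ccomm_shiftx:
  assumes "fps_ccomm f g"
  shows "shiftx a f * shiftx b g = shiftx b g * shiftx a f"
  using assms ev_outer_const(1)[of b a f g] ev_outer_const(2)[of b a g f]
  unfolding fps_ccomm_outer by simp

section \<open>Relations between neighbouring shifts\<close>

context yangian
begin

abbreviation "Ak k \<equiv> shiftx (int k) A"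
abbreviation "Bk k \<equiv> shiftx (int k) B"
abbreviation "Ck k \<equiv> shiftx (int k) C"
abbreviation "Dk k \<equiv> shiftx (int k) D"

text \<open>At u - v = 1 the term B(v) A(u) occurs on both sides of \<open>rel_AB\<close> and
  cancels. \<open>shift_BD\<close> arises in the same way at u - v = -1.\<close>

lemma shift_AB: "Ak k * Bk (Suc k) = Bk k * Ak (Suc k)"
  using biv_specialize[OF rel_AB, where b = "int (Suc k)" and a = "int k"]
  by (simp add: ev_outer_const del: One_nat_def)

lemma shift_BD: "Bk k * Dk (Suc k) = Dk k * Bk (Suc k)"
  using biv_specialize[OF rel_BD, where b = "int k" and a = "int (Suc k)"]
  by (simp add: ev_outer_const algebra_simps del: One_nat_def)

text \<open>The factor 2 stays until scalars containing 1/2 are available, see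
  \<open>shift_BB_0\<close>.\<close>

lemma shift_BB: "2 * (Bk k * Bk (Suc k)) = 0"
  using biv_specialize[OF rel_BB, where b = "int (Suc k)" and a = "int k"]
  by (simp add: ev_outer_const algebra_simps del: One_nat_def flip: mult_2)

text \<open>The product D(x-k-1) A(x-k), whose arguments are in the wrong order, is eliminated
  between \<open>rel_AD\<close> and \<open>rel_CB\<close>.\<close>

lemma shift_AD: "Ak k * Dk (Suc k) - Bk k * Ck (Suc k) = Dk k * Ak (Suc k) + Ck k * Bk (Suc k)"
proof -
  have 1: "Ak k * Dk (Suc k) - Dk (Suc k) * Ak k = Bk k * Ck (Suc k) - Bk (Suc k) * Ck k"
    using biv_specialize[OF rel_AD, where b = "int (Suc k)" and a = "int k"]
    by (simp add: ev_outer_const del: One_nat_def)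
  have 2: "Dk (Suc k) * Ak k = Ck k * Bk (Suc k) + Bk (Suc k) * Ck k + Dk k * Ak (Suc k)"
    using biv_specialize[OF rel_CB, where b = "int (Suc k)" and a = "int k"]
    by (simp add: ev_outer_const del: One_nat_def)
  from 1 show ?thesis
    unfolding 2 by (simp add: algebra_simps del: One_nat_def of_nat_Suc)
qed

end

subsection \<open>Recursion for the fused diagonal entries\<close>

text \<open>Index \<open>k\<close> stands for the argument \<open>x - k\<close>. The locale is used once as it stands (for \<open>A\<^sub>m\<close>) and once with
  \<open>A\<close> and \<open>D\<close> exchanged and \<open>C\<close> negated (for \<open>H\<^sub>m\<close>).\<close>
locale fusion =
  fixes A B C D G \<beta> :: "nat \<Rightarrow> 'b::ring_1"
  assumes AB: "A k * B (Suc k) = B k * A (Suc k)"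
    and BD: "B k * D (Suc k) = D k * B (Suc k)"
    and AD: "A k * D (Suc k) - B k * C (Suc k) = D k * A (Suc k) + C k * B (Suc k)"
    and BB: "B k * B (Suc k) = 0"
    and D_\<beta>: "D (Suc k) * \<beta> (Suc k) - A (Suc k) = B (Suc k) * G (Suc k)"
    and DBG: "D k * (B (Suc k) * G (Suc k)) = B k * C (Suc k)"
    and \<beta>_comm: "\<beta> k * A l = A l * \<beta> k" "\<beta> k * B l = B l * \<beta> k" "\<beta> k * D l = D l * \<beta> k"
begin

lemma \<beta>_left_comm:
  "\<beta> k * (A l * x) = A l * (\<beta> k * x)" "\<beta> k * (B l * x) = B l * (\<beta> k * x)"
  "\<beta> k * (D l * x) = D l * (\<beta> k * x)"
  by (simp_all only: \<beta>_comm flip: mult.assoc)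

definition X where "X m = prod_list (map D [0..<m])"

primrec Z where
  "Z 0 = 0"
| "Z (Suc m) = Z m * D m + X m * C m"

text \<open>\<open>Y m\<close> has m + 1 factors. It is the sum of the last row, the only one
  without signs; \<open>Z m\<close> collects the words with one C among letters D.\<close>

definition Y where "Y m = X m * A m + Z m * B m"

text \<open>The letter at place s between the row word with its distinguished letter at j and the
  column word with its distinguished letter at i, Koszul signs left out.\<close>

definition entry where
  "entry j i s = (if s = j then if s = i then A s else B s else if s = i then C s else D s)"

definition W where "W m j i = prod_list (map (entry j i) [0..<m])"

lemma X_Suc: "X (Suc m) = X m * D m" and X_0: "X 0 = 1"
  by (simp_all add: X_def)

lemma W_Suc: "W (Suc m) j i = W m j i * entry j i m"
  by (simp add: W_def)

text \<open>\<open>AD\<close> and \<open>BD\<close> carry the distinguished letter of the row from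
  the last place to the one before it: the local form of the independence of the row in
  \<open>sum_W_row\<close>.\<close>

lemma Y_Suc: "Y (Suc m) = Y m * D (Suc m) - X m * (B m * C (Suc m))"
proof -
  have "Y m * D (Suc m) - X m * (B m * C (Suc m))
      = X m * (A m * D (Suc m) - B m * C (Suc m)) + Z m * (B m * D (Suc m))"
    by (simp add: Y_def algebra_simps)
  also have "\<dots> = Y (Suc m)"
    unfolding AD BD by (simp add: Y_def X_Suc algebra_simps)
  finally show ?thesis ..
qed

text \<open>With the column's letter beyond m, the word consists of one B among letters D, and
  \<open>BD\<close> moves the B to the end.\<close>

lemma W_row: "j \<le> m \<Longrightarrow> i > m \<Longrightarrow> W (Suc m) j i = X m * B m"
proof (induction m)
  case (Suc m)
  show ?case
  proof (cases "j = Suc m")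
    case True
    have "map (entry j i) [0..<Suc m] = map D [0..<Suc m]"
      using True Suc.prems by (intro map_cong) (auto simp: entry_def)
    then have "W (Suc m) j i = X (Suc m)"
      by (simp only: W_def X_def)
    then show ?thesis
      unfolding W_Suc[of "Suc m"] using True Suc.prems by (simp add: entry_def)
  next
    case False
    then have "W (Suc m) j i = X m * B m"
      using Suc by simp
    then show ?thesis
      unfolding W_Suc[of "Suc m"] using False Suc.prems by (simp add: entry_def X_Suc BD mult.assoc)
  qed
qed (simp add: W_def X_def entry_def)

lemma W_diag_free: "m \<le> j \<Longrightarrow> m \<le> i \<Longrightarrow> W m j i = X m"
  unfolding W_def X_def by (intro arg_cong[of _ _ prod_list] map_cong) (auto simp: entry_def)

lemma sum_W_column: "m \<le> j \<Longrightarrow> (\<Sum>i<m. W m j i) = Z m"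
proof (induction m)
  case (Suc m)
  have "(\<Sum>i<m. W (Suc m) j i) = (\<Sum>i<m. W m j i) * D m"
    unfolding sum_distrib_right using Suc.prems
    by (intro sum.cong) (auto simp: W_Suc entry_def)
  then show ?case
    using Suc by (simp add: W_Suc[of m j m] entry_def W_diag_free)
qed simp

text \<open>The last row is the definition of Y, by \<open>sum_W_column\<close>. In an earlier row
  the last letter is D, except for one word ending in C; by \<open>W_row\<close> that word is the
  same for all j, and \<open>Y_Suc\<close> matches the result.\<close>

lemma sum_W_row: "j \<le> m \<Longrightarrow> (\<Sum>i<Suc m. if j < i then - W (Suc m) j i else W (Suc m) j i) = Y m"
proof (induction m)
  case 0
  then show ?case by (simp add: W_def Y_def entry_def X_def)
next
  case (Suc m)
  let ?V = "\<lambda>m i. if j < i then - W m j i else W m j i"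
  show ?case
  proof (cases "j = Suc m")
    case True
    have "(\<Sum>i<Suc (Suc m). ?V (Suc (Suc m)) i)
        = (\<Sum>i<Suc m. W (Suc m) j i) * B (Suc m) + X (Suc m) * A (Suc m)"
      unfolding sum.lessThan_Suc[of _ "Suc m"] sum_distrib_right using True
      by (intro arg_cong2[of _ _ _ _ plus] sum.cong) (auto simp: W_Suc[of "Suc m"] entry_def W_diag_free)
    then show ?thesis
      using True by (simp only: sum_W_column order_refl Y_def add.commute)
  next
    case False
    have "(\<Sum>i<Suc (Suc m). ?V (Suc (Suc m)) i)
        = (\<Sum>i<Suc m. ?V (Suc m) i) * D (Suc m) - X m * B m * C (Suc m)"
      unfolding sum.lessThan_Suc[of _ "Suc m"] sum_distrib_right diff_conv_add_uminus
      using False Suc.prems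
      by (intro arg_cong2[of _ _ _ _ plus] sum.cong) (auto simp: W_Suc[of "Suc m"] entry_def W_row)
    then show ?thesis
      using False Suc by (simp add: Y_Suc mult.assoc)
  qed
qed

text \<open>\<open>DBG\<close> and \<open>D_\<beta>\<close> replace B C at neighbouring arguments by
  D (D \<open>\<beta>\<close> - A), so that C disappears from the recursion.\<close>

lemma Y_Suc_\<beta>:
  "Y (Suc m) = Y m * D (Suc m) + X (Suc m) * A (Suc m) - X (Suc (Suc m)) * \<beta> (Suc m)"
  unfolding Y_Suc DBG[symmetric] D_\<beta>[symmetric] by (simp add: X_Suc algebra_simps)

text \<open>By \<open>AB\<close> and \<open>BD\<close> the product equals -B(m) (D
  \<open>\<beta>\<close> - A)(m+1), which is -B(m) B(m+1) G(m+1).\<close>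

lemma \<beta>_shift: "(A m - D m * \<beta> (Suc m)) * B (Suc m) = 0"
proof -
  have "(A m - D m * \<beta> (Suc m)) * B (Suc m) = A m * B (Suc m) - D m * B (Suc m) * \<beta> (Suc m)"
    by (simp add: left_diff_distrib mult.assoc \<beta>_comm)
  also have "\<dots> = - (B m * (D (Suc m) * \<beta> (Suc m) - A (Suc m)))"
    unfolding AB BD[symmetric] by (simp add: algebra_simps)
  also have "\<dots> = 0"
    unfolding D_\<beta> using BB by (simp flip: mult.assoc)
  finally show ?thesis .
qed

text \<open>\<open>Y_Suc_\<beta>\<close> splits off a term killed by \<open>\<beta>_shift\<close>;
  in the other one \<open>BD\<close> moves B one place to the left, where the induction hypothesis
  applies.\<close>

lemma Y_\<beta>_B: "(Y m - X (Suc m) * \<beta> (Suc m)) * B (Suc m) = 0"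
proof (induction m)
  case 0
  show ?case using \<beta>_shift[of 0] by (simp add: Y_def X_def)
next
  case (Suc m)
  let ?n = "Suc m"
  have "(Y ?n - X (Suc ?n) * \<beta> (Suc ?n)) * B (Suc ?n)
      = (Y m - X ?n * \<beta> ?n) * (D ?n * B (Suc ?n)) + X ?n * ((A ?n - D ?n * \<beta> (Suc ?n)) * B (Suc ?n))"
    unfolding Y_Suc_\<beta> X_Suc[of ?n] by (simp add: algebra_simps \<beta>_comm \<beta>_left_comm)
  also have "\<dots> = (Y m - X ?n * \<beta> ?n) * B ?n * D (Suc ?n)"
    unfolding \<beta>_shift BD[symmetric] by (simp add: mult.assoc)
  also have "\<dots> = 0"
    unfolding Suc.IH by simp
  finally show ?case .
qed

text \<open>The difference of the two sides factors with D \<open>\<beta>\<close> - A = B G on the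
  right, and \<open>Y_\<beta>_B\<close> annihilates that B.\<close>

lemma Y_Suc_times_\<beta>: "Y (Suc m) * \<beta> (Suc m) = Y m * A (Suc m)"
proof -
  let ?n = "Suc m"
  have "Y ?n * \<beta> ?n - Y m * A ?n
      = (Y m - X ?n * \<beta> ?n) * (D ?n * \<beta> ?n - A ?n)"
    unfolding Y_Suc_\<beta> X_Suc[of ?n] by (simp add: algebra_simps \<beta>_comm \<beta>_left_comm)
  also have "\<dots> = (Y m - X ?n * \<beta> ?n) * B ?n * G ?n"
    unfolding D_\<beta> by (simp add: mult.assoc)
  also have "\<dots> = 0"
    unfolding Y_\<beta>_B by simp
  finally show ?thesis by simp
qed

text \<open>The coefficients of q1^2, q1 q2 and q2^2 are \<open>Y_Suc_times_\<beta>\<close>,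
  \<open>Y_Suc_\<beta>\<close> and \<open>X_Suc\<close>.\<close>

lemma fusion_step:
  assumes q1: "\<And>x. x * q1 = q1 * x" and q2: "\<And>x. x * q2 = q2 * x"
  shows "(q1 * Y (Suc m) - q2 * X (Suc (Suc m))) * (q1 * \<beta> (Suc m) - q2)
    = (q1 * Y m - q2 * X (Suc m)) * (q1 * A (Suc m) - q2 * D (Suc m))"
proof -
  let ?n = "Suc m"
  have q: "x * (q1 * z) = q1 * (x * z)" "x * (q2 * z) = q2 * (x * z)" for x z
    by (simp_all add: q1 q2 flip: mult.assoc)
  have "(q1 * Y ?n - q2 * X (Suc ?n)) * (q1 * \<beta> ?n - q2)
      = q1 * (q1 * (Y ?n * \<beta> ?n)) - q1 * (q2 * (Y ?n + X (Suc ?n) * \<beta> ?n)) + q2 * (q2 * X (Suc ?n))"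
    by (simp add: algebra_simps q[of "Y ?n"] q[of "X (Suc ?n)"] q(1)[of q2] q1[of "Y ?n"] q2[of "Y ?n"]
        q2[of "X (Suc ?n)"])
  also have "Y ?n + X (Suc ?n) * \<beta> ?n = Y m * D ?n + X ?n * A ?n"
    by (simp add: Y_Suc_\<beta>)
  also have "q1 * (q1 * (Y ?n * \<beta> ?n)) - q1 * (q2 * (Y m * D ?n + X ?n * A ?n)) + q2 * (q2 * X (Suc ?n))
      = (q1 * Y m - q2 * X ?n) * (q1 * A ?n - q2 * D ?n)"
    by (simp add: algebra_simps Y_Suc_times_\<beta> X_Suc[of ?n] q[of "Y m"] q[of "X ?n"] q(1)[of q2])
  finally show ?thesis .
qed

end

subsection \<open>Removing the Koszul signs\<close>

definition gexp :: "nat list \<Rightarrow> nat list \<Rightarrow> nat" where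
  "gexp I J = (\<Sum>t<length I. \<Sum>s\<in>{t..<length I}. (pty (I ! t) + pty (J ! t)) * pty (J ! s))"

definition tw :: "(nat list \<Rightarrow> nat list \<Rightarrow> 'b::ring_1) \<Rightarrow> nat list \<Rightarrow> nat list \<Rightarrow> 'b" where
  "tw X I J = (-1) ^ gexp I J * X I J"

lemma minus_one_power_cong: "even (a + b) \<Longrightarrow> (-1 :: 'b::ring_1) ^ a = (-1) ^ b"
  by (simp add: minus_one_power_iff)

lemma finite_idx [simp]: "finite (idx m)"
  using finite_lists_length_eq[of "{1, 2 :: nat}" m] by (simp add: idx_def conj_commute)

lemma idx_length: "I \<in> idx m \<Longrightarrow> length I = m"
  by (simp add: idx_def)

lemma idx_nth: "I \<in> idx m \<Longrightarrow> s < m \<Longrightarrow> I ! s \<in> {1, 2}"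
  unfolding idx_def using nth_mem by blast

lemma idx_update: "I \<in> idx m \<Longrightarrow> i \<in> {1, 2} \<Longrightarrow> I[k := i] \<in> idx m"
  unfolding idx_def using set_update_subset_insert[of I k i] by auto

lemma ptys_eq_sum: "length I = m \<Longrightarrow> ptys I = (\<Sum>t<m. pty (I ! t))"
  by (simp add: ptys_def sum_list_sum_nth atLeast0LessThan)

text \<open>Only the parity matters; doubled sums are added on both sides to avoid subtraction in
  nat. The full product splits into the pairs s < t, which cancel the tensor sign modulo 2, and the
  pairs t \<le> s, which give the coboundary.\<close>

lemma koszul_coboundary:
  fixes p q r :: "nat \<Rightarrow> nat"
  shows "((\<Sum>t<m. p t) + (\<Sum>t<m. q t)) * ((\<Sum>s<m. q s) + (\<Sum>s<m. r s))
      + (\<Sum>t<m. \<Sum>s<t. (p t + q t) * (q s + r s)) + 2 * (\<Sum>t<m. \<Sum>s\<in>{t..<m}. r t * r s)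
    = (\<Sum>t<m. \<Sum>s\<in>{t..<m}. (p t + q t) * q s) + (\<Sum>t<m. \<Sum>s\<in>{t..<m}. (q t + r t) * r s)
      + (\<Sum>t<m. \<Sum>s\<in>{t..<m}. (p t + r t) * r s) + 2 * (\<Sum>t<m. \<Sum>s<t. (p t + q t) * (q s + r s))"
proof -
  have split: "(\<Sum>s<m. f s) = (\<Sum>s<t. f s) + (\<Sum>s\<in>{t..<m}. f s)" if "t < m" for t and f :: "nat \<Rightarrow> nat"
    using sum.union_disjoint[of "{..<t}" "{t..<m}" f] that by (simp add: ivl_disj_un ivl_disj_int)
  have "((\<Sum>t<m. p t) + (\<Sum>t<m. q t)) * ((\<Sum>s<m. q s) + (\<Sum>s<m. r s))
      = (\<Sum>t<m. \<Sum>s<m. (p t + q t) * (q s + r s))"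
    by (simp add: sum_product flip: sum.distrib)
  also have "\<dots> = (\<Sum>t<m. \<Sum>s<t. (p t + q t) * (q s + r s)) + (\<Sum>t<m. \<Sum>s\<in>{t..<m}. (p t + q t) * (q s + r s))"
    unfolding sum.distrib[symmetric] by (intro sum.cong) (simp_all add: split)
  finally show ?thesis
    by (simp add: algebra_simps sum.distrib mult_2_right mult_2)
qed

lemma minus_one_power_msgn:
  assumes "length I = m" "length J = m" "length L = m"
  shows "(-1 :: 'b::ring_1) ^ msgn_exp I J L = (-1) ^ (gexp I J + gexp J L + gexp I L)"
proof (rule minus_one_power_cong)
  have "msgn_exp I J L + 2 * (\<Sum>t<m. \<Sum>s\<in>{t..<m}. pty (L ! t) * pty (L ! s))
      = gexp I J + gexp J L + gexp I L
        + 2 * (\<Sum>t<m. \<Sum>s<t. (pty (I ! t) + pty (J ! t)) * (pty (J ! s) + pty (L ! s)))"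
    using assms unfolding msgn_exp_def gexp_def
    by (simp only: ptys_eq_sum koszul_coboundary)
  from arg_cong[OF this, of even]
  show "even (msgn_exp I J L + (gexp I J + gexp J L + gexp I L))"
    by simp
qed

lemma tw_mmul:
  assumes "I \<in> idx m" "L \<in> idx m"
  shows "tw (mmul m X Y) I L = (\<Sum>J\<in>idx m. tw X I J * tw Y J L)"
  unfolding tw_def mmul_def sum_distrib_left
proof (intro sum.cong refl)
  fix J assume "J \<in> idx m"
  then have "length I = m" "length J = m" "length L = m"
    using assms by (simp_all add: idx_length)
  note sg = minus_one_power_msgn[OF this]
  show "(-1) ^ gexp I L * ((-1) ^ msgn_exp I J L * X I J * Y J L)
      = (-1) ^ gexp I J * X I J * ((-1) ^ gexp J L * Y J L)"
    unfolding sg by (simp add: minus_one_power_iff)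
qed

lemma even_gexp_diag: "even (gexp I I)"
  unfolding gexp_def by (intro dvd_sum) simp

lemma str_eq_tw: "str m X = (\<Sum>I\<in>idx m. (-1) ^ ptys I * tw X I I)"
  by (simp add: str_def tw_def even_gexp_diag minus_one_power_iff[of "gexp _ _"])

lemma gexp_local:
  assumes "length I = m" "length J = m" "finite T" "T \<subseteq> {..<m}" "\<And>s. s < m \<Longrightarrow> s \<notin> T \<Longrightarrow> I ! s = J ! s"
  shows "even (gexp I J + (\<Sum>t\<in>T. (pty (I ! t) + pty (J ! t)) * (\<Sum>s\<in>{t..<m}. pty (J ! s))))"
proof -
  let ?f = "\<lambda>t. (pty (I ! t) + pty (J ! t)) * (\<Sum>s\<in>{t..<m}. pty (J ! s))"
  have "gexp I J = sum ?f {..<m}"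
    using assms by (simp add: gexp_def sum_distrib_left)
  also have "\<dots> = sum ?f T + sum ?f ({..<m} - T)"
    using assms by (simp add: sum.subset_diff add.commute)
  finally have "gexp I J + sum ?f T = 2 * sum ?f T + sum ?f ({..<m} - T)" by simp
  moreover have "even (sum ?f ({..<m} - T))"
    using assms by (intro dvd_sum) auto
  ultimately show ?thesis by simp
qed

lemma tw_embk:
  assumes "I \<in> idx m" "J \<in> idx m" "k < m"
  shows "tw (embk k F) I J = (if \<forall>s<m. s \<noteq> k \<longrightarrow> I ! s = J ! s
    then (-1) ^ ((pty (I ! k) + pty (J ! k)) * (\<Sum>s\<in>{k..<m}. pty (J ! s))) * F (I ! k) (J ! k) else 0)"
proof (cases "\<forall>s<m. s \<noteq> k \<longrightarrow> I ! s = J ! s")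
  case True
  then have "even (gexp I J + (pty (I ! k) + pty (J ! k)) * (\<Sum>s\<in>{k..<m}. pty (J ! s)))"
    using gexp_local[of I m J "{k}"] assms by (simp add: idx_length)
  note sg = minus_one_power_cong[OF this]
  have "tw (embk k F) I J = (-1) ^ gexp I J * F (I ! k) (J ! k)"
    using True assms by (simp add: tw_def embk_def idx_length)
  then show ?thesis
    unfolding sg using True by simp
next
  case False
  then show ?thesis using assms by (auto simp: tw_def embk_def idx_length)
qed

lemma sum_idx_update:
  assumes "I \<in> idx m" "k < m"
    and 0: "\<And>J. J \<in> idx m \<Longrightarrow> \<not> (\<forall>s<m. s \<noteq> k \<longrightarrow> I ! s = J ! s) \<Longrightarrow> f J = 0"
  shows "(\<Sum>J\<in>idx m. f J) = (\<Sum>i\<in>{1, 2}. f (I[k := i]))"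
proof -
  have inj: "inj_on (\<lambda>i. I[k := i]) {1, 2}"
    using assms by (intro inj_onI) (metis idx_length nth_list_update_eq)
  have "J \<in> (\<lambda>i. I[k := i]) ` {1, 2}" if "J \<in> idx m" "\<forall>s<m. s \<noteq> k \<longrightarrow> I ! s = J ! s" for J
  proof
    show "J = I[k := J ! k]"
      using that assms by (intro nth_equalityI) (auto simp: idx_length nth_list_update)
  qed (use that assms idx_nth in blast)
  then have "(\<Sum>J\<in>idx m. f J) = (\<Sum>J\<in>(\<lambda>i. I[k := i]) ` {1, 2}. f J)"
    using assms(1) 0 by (intro sum.mono_neutral_right) (auto intro: idx_update)
  then show ?thesis
    using sum.reindex[OF inj] by simp
qed

lemma tw_mmul_embk:
  assumes "I \<in> idx m" "L \<in> idx m" "k < m"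
  shows "tw (mmul m (embk k F) Y) I L = (\<Sum>j\<in>{1, 2}.
    (-1) ^ ((pty (I ! k) + pty j) * (pty j + (\<Sum>s\<in>{Suc k..<m}. pty (I ! s)))) * F (I ! k) j * tw Y (I[k := j]) L)"
proof -
  have "tw (mmul m (embk k F) Y) I L = (\<Sum>j\<in>{1, 2}. tw (embk k F) I (I[k := j]) * tw Y (I[k := j]) L)"
    unfolding tw_mmul[OF assms(1,2)] by (intro sum_idx_update) (use assms in \<open>auto simp: tw_embk\<close>)
  also have "\<dots> = (\<Sum>j\<in>{1, 2}.
    (-1) ^ ((pty (I ! k) + pty j) * (pty j + (\<Sum>s\<in>{Suc k..<m}. pty (I ! s)))) * F (I ! k) j * tw Y (I[k := j]) L)"
  proof (rule sum.cong[OF refl])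
    fix j :: nat assume j: "j \<in> {1, 2}"
    have "(\<Sum>s\<in>{k..<m}. pty (I[k := j] ! s)) = pty j + (\<Sum>s\<in>{Suc k..<m}. pty (I ! s))"
      using assms by (simp add: sum.atLeast_Suc_lessThan idx_length)
    then show "tw (embk k F) I (I[k := j]) * tw Y (I[k := j]) L
      = (-1) ^ ((pty (I ! k) + pty j) * (pty j + (\<Sum>s\<in>{Suc k..<m}. pty (I ! s)))) * F (I ! k) j * tw Y (I[k := j]) L"
      using assms idx_update[OF assms(1) j] by (subst tw_embk[of _ m]) (auto simp: idx_length)
  qed
  finally show ?thesis .
qed

lemma tw_mmul_Qk:
  assumes "I \<in> idx m" "L \<in> idx m" "k < m"
  shows "tw (mmul m (Qk c q1 q2 k) Y) I L = fps_const (c (if I ! k = 1 then q1 else q2)) * tw Y I L"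
proof -
  have "I ! k \<in> {1, 2}" using idx_nth assms by blast
  then show ?thesis
    unfolding Qk_def tw_mmul_embk[OF assms]
    by (elim insertE emptyE) (simp_all add: mult_2[symmetric] flip: power_mult, (metis list_update_id)+)
qed

lemma tw_mone: "I \<in> idx m \<Longrightarrow> tw mone I L = (if I = L then 1 else 0)"
  by (simp add: tw_def mone_def even_gexp_diag minus_one_power_iff)

text \<open>The chain treats the places 0, ..., m-1 in turn. At place s the later places still carry
  the letters of I, which is why the sum over u > s involves I and not L.\<close>

definition chain_entry :: "(complex \<Rightarrow> 'a::ring_1) \<Rightarrow> complex \<Rightarrow> complex \<Rightarrow> (nat \<Rightarrow> nat \<Rightarrow> nat \<Rightarrow> 'a) \<Rightarrow> nat
    \<Rightarrow> nat list \<Rightarrow> nat list \<Rightarrow> nat \<Rightarrow> 'a fps" where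
  "chain_entry c q1 q2 t m I L s = fps_const (c (if I ! s = 1 then q1 else q2))
     * ((-1) ^ ((pty (I ! s) + pty (L ! s)) * (pty (L ! s) + (\<Sum>u\<in>{Suc s..<m}. pty (I ! u))))
        * shiftx (int s) (Tser t (I ! s) (L ! s)))"

text \<open>Downward induction on k with I arbitrary. The factor at k may change only the letter at
  k, and the remaining factors no longer touch it, so the sum over the new letter collapses to
  \<open>L ! k\<close>.\<close>

lemma tw_chain_suffix:
  assumes "k \<le> m" "I \<in> idx m" "L \<in> idx m"
  shows "tw (mprod m (concat (map (\<lambda>k. [Qk c q1 q2 k, embk k (\<lambda>i j. shiftx (int k) (Tser t i j))]) [k..<m]))) I L
    = (if \<forall>s<k. I ! s = L ! s then prod_list (map (chain_entry c q1 q2 t m I L) [k..<m]) else 0)"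
  using assms
proof (induction k arbitrary: I rule: inc_induct)
  case base
  then have "(\<forall>s<m. I ! s = L ! s) \<longleftrightarrow> I = L"
    by (metis idx_length nth_equalityI)
  with base show ?case
    by (simp add: mprod_def tw_mone)
next
  case (step k)
  let ?F = "\<lambda>i j. shiftx (int k) (Tser t i j)"
  let ?R = "mprod m (concat (map (\<lambda>k. [Qk c q1 q2 k, embk k (\<lambda>i j. shiftx (int k) (Tser t i j))]) [Suc k..<m]))"
  let ?sg = "\<lambda>j. (-1) ^ ((pty (I ! k) + pty j) * (pty j + (\<Sum>s\<in>{Suc k..<m}. pty (I ! s)))) :: 'a fps"
  have k: "k < m" by (rule step)
  have Lk: "L ! k \<in> {1, 2}" using step.prems k idx_nth by blast
  have R: "tw ?R (I[k := j]) L = (if j = L ! k then if \<forall>s<k. I ! s = L ! s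
        then prod_list (map (chain_entry c q1 q2 t m I L) [Suc k..<m]) else 0 else 0)"
    if "j \<in> {1, 2}" for j
  proof -
    have e: "chain_entry c q1 q2 t m (I[k := j]) L s = chain_entry c q1 q2 t m I L s" if "Suc k \<le> s" for s
    proof -
      have "(\<Sum>u\<in>{Suc s..<m}. pty (I[k := j] ! u)) = (\<Sum>u\<in>{Suc s..<m}. pty (I ! u))"
        using that by (intro sum.cong) auto
      then show ?thesis using that by (simp add: chain_entry_def)
    qed
    have 1: "(\<forall>s<Suc k. I[k := j] ! s = L ! s) \<longleftrightarrow> j = L ! k \<and> (\<forall>s<k. I ! s = L ! s)"
      using step.prems k by (auto simp: All_less_Suc idx_length)
    have 2: "map (chain_entry c q1 q2 t m (I[k := j]) L) [Suc k..<m] = map (chain_entry c q1 q2 t m I L) [Suc k..<m]"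
      by (intro map_cong) (auto simp: e)
    show ?thesis
      unfolding step.IH[OF idx_update[OF step.prems(1) that] step.prems(2)] 1 2 by simp
  qed
  have "tw (mmul m (Qk c q1 q2 k) (mmul m (embk k ?F) ?R)) I L
      = fps_const (c (if I ! k = 1 then q1 else q2)) * (\<Sum>j\<in>{1, 2}. ?sg j * ?F (I ! k) j * tw ?R (I[k := j]) L)"
    using step.prems k by (simp only: tw_mmul_Qk tw_mmul_embk)
  also have "(\<Sum>j\<in>{1, 2}. ?sg j * ?F (I ! k) j * tw ?R (I[k := j]) L)
      = (\<Sum>j\<in>{1, 2}. if j = L ! k then ?sg j * ?F (I ! k) j * (if \<forall>s<k. I ! s = L ! s
        then prod_list (map (chain_entry c q1 q2 t m I L) [Suc k..<m]) else 0) else 0)"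
    by (intro sum.cong refl) (simp add: R)
  also have "\<dots> = ?sg (L ! k) * ?F (I ! k) (L ! k) * (if \<forall>s<k. I ! s = L ! s
        then prod_list (map (chain_entry c q1 q2 t m I L) [Suc k..<m]) else 0)"
    using Lk by (subst sum.delta) auto
  finally have *: "tw (mmul m (Qk c q1 q2 k) (mmul m (embk k ?F) ?R)) I L
      = fps_const (c (if I ! k = 1 then q1 else q2)) * (?sg (L ! k) * ?F (I ! k) (L ! k)
        * (if \<forall>s<k. I ! s = L ! s then prod_list (map (chain_entry c q1 q2 t m I L) [Suc k..<m]) else 0))" .
  have upt: "[k..<m] = k # [Suc k..<m]"
    using k by (rule upt_conv_Cons)
  have chain: "mprod m (concat (map (\<lambda>k. [Qk c q1 q2 k, embk k (\<lambda>i j. shiftx (int k) (Tser t i j))]) [k..<m]))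
      = mmul m (Qk c q1 q2 k) (mmul m (embk k ?F) ?R)"
    unfolding upt by (simp add: mprod_def)
  have entry: "chain_entry c q1 q2 t m I L k
      = fps_const (c (if I ! k = 1 then q1 else q2)) * (?sg (L ! k) * ?F (I ! k) (L ! k))"
    by (simp only: chain_entry_def)
  show ?case
    unfolding chain * unfolding upt list.map prod_list.Cons entry
    by (cases "\<forall>s<k. I ! s = L ! s") (auto simp: mult.assoc)
qed

lemma tw_TQchain:
  assumes "I \<in> idx m" "L \<in> idx m"
  shows "tw (mprod m (TQchain c q1 q2 t m)) I L = prod_list (map (chain_entry c q1 q2 t m I L) [0..<m])"
  using tw_chain_suffix[OF _ assms, of 0] by (simp add: TQchain_def)

subsection \<open>The action of the symmetric group\<close>

text \<open>After the twist the sign is the symmetric one of the graded flip: -1 exactly when two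
  odd letters are exchanged.\<close>

lemma tw_Pk:
  assumes "I \<in> idx m" "K \<in> idx m" "Suc k < m"
  shows "tw (Pk k) I K = (if \<forall>a<m. K ! a = I ! Transposition.transpose k (Suc k) a
    then (-1) ^ (pty (I ! k) * pty (I ! Suc k)) else 0)"
proof -
  have len: "length I = m" "length K = m" using assms by (simp_all add: idx_length)
  have "(\<forall>a<m. K ! a = I ! Transposition.transpose k (Suc k) a) \<longleftrightarrow>
      (\<forall>s<m. s \<noteq> k \<and> s \<noteq> Suc k \<longrightarrow> I ! s = K ! s) \<and> I ! k = K ! Suc k \<and> I ! Suc k = K ! k"
    using assms(3) by (auto simp: Transposition.transpose_def)
  then show ?thesis
  proof (cases "\<forall>a<m. K ! a = I ! Transposition.transpose k (Suc k) a")
    case True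
    then have K: "K ! k = I ! Suc k" "K ! Suc k = I ! k"
      and off: "\<And>s. s < m \<Longrightarrow> s \<noteq> k \<Longrightarrow> s \<noteq> Suc k \<Longrightarrow> I ! s = K ! s"
      using assms(3) by (auto simp: Transposition.transpose_def)
    have IK: "I ! k \<in> {1, 2}" "I ! Suc k \<in> {1, 2}"
      using idx_nth[OF assms(1)] assms(3) by auto
    have "even (gexp I K + (\<Sum>t\<in>{k, Suc k}. (pty (I ! t) + pty (K ! t)) * (\<Sum>s\<in>{t..<m}. pty (K ! s))))"
      using len off assms(3) by (intro gexp_local) auto
    moreover have "(\<Sum>s\<in>{k..<m}. pty (K ! s)) = pty (K ! k) + (\<Sum>s\<in>{Suc k..<m}. pty (K ! s))"
      using assms(3) by (simp add: sum.atLeast_Suc_lessThan)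
    ultimately have "even (gexp I K + (pty (I ! k) + pty (K ! k)) * pty (K ! k))"
      by (simp add: K algebra_simps)
    then have "even (pty (I ! Suc k) + gexp I K + pty (I ! k) * pty (I ! Suc k))"
      using IK by (auto simp: K pty_def split: if_splits)
    then have "(-1) ^ (pty (I ! Suc k) + gexp I K) = ((-1) ^ (pty (I ! k) * pty (I ! Suc k)) :: 'a)"
      by (rule minus_one_power_cong)
    then show ?thesis
      using True K off len by (simp add: tw_def Pk_def add.commute flip: power_add)
  next
    case False
    with \<open>_ \<longleftrightarrow> _\<close> show ?thesis
      using len by (auto simp: tw_def Pk_def)
  qed
qed

text \<open>Sign picked up by the entries equal to \<open>c\<close> when \<open>\<sigma>\<close> moves them past each other.\<close>
definition inv_sign :: "nat \<Rightarrow> nat \<Rightarrow> (nat \<Rightarrow> nat) \<Rightarrow> nat list \<Rightarrow> int" where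
  "inv_sign c m \<sigma> J = (\<Prod>(a, b)\<in>{(a, b). a < b \<and> b < m}. if J ! a = c \<and> J ! b = c \<and> \<sigma> b < \<sigma> a then -1 else 1)"

lemma finite_pairs: "finite {(a, b). a < b \<and> b < (m :: nat)}"
  by (rule finite_subset[of _ "{..<m} \<times> {..<m}"]) auto

text \<open>An adjacent transposition reverses the order of the values k and Suc k only, so a single
  pair of places is affected.\<close>

lemma inv_sign_transpose:
  assumes "\<sigma> permutes {..<m}" "Suc k < m" "\<sigma> x = k" "\<sigma> y = Suc k"
  shows "inv_sign c m (Transposition.transpose k (Suc k) \<circ> \<sigma>) J
    = inv_sign c m \<sigma> J * (if J ! x = c \<and> J ! y = c then -1 else 1)"
proof -
  let ?P = "{(a, b). a < b \<and> b < m}" and ?t = "Transposition.transpose k (Suc k)"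
  let ?f = "\<lambda>\<sigma>. \<lambda>(a, b). if J ! a = c \<and> J ! b = c \<and> \<sigma> b < \<sigma> a then -1 else (1 :: int)"
  let ?p = "(min x y, max x y)"
  have inj: "\<sigma> a = \<sigma> b \<longleftrightarrow> a = b" for a b
    using permutes_inj[OF assms(1)] by (simp add: inj_eq)
  have xy: "x < m" "y < m" "x \<noteq> y"
    using assms permutes_in_image[OF assms(1), of x] permutes_in_image[OF assms(1), of y] by auto
  then have p: "?p \<in> ?P" by auto
  have "?f (?t \<circ> \<sigma>) q = ?f \<sigma> q" if "q \<in> ?P - {?p}" for q
  proof -
    obtain a b where q: "q = (a, b)" by (cases q)
    with that have q: "q = (a, b)" "a < b" "(a, b) \<noteq> ?p" by auto
    have "{a, b} \<noteq> {x, y}"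
      using q by (auto simp: doubleton_eq_iff min_def max_def split: if_splits)
    then have "{\<sigma> a, \<sigma> b} \<noteq> {\<sigma> x, \<sigma> y}"
      by (simp only: doubleton_eq_iff inj not_False_eq_True)
    then have "{\<sigma> a, \<sigma> b} \<noteq> {k, Suc k}"
      by (simp only: assms(3,4) not_False_eq_True)
    moreover have "\<sigma> a \<noteq> \<sigma> b" using q inj by simp
    ultimately have "?t (\<sigma> b) < ?t (\<sigma> a) \<longleftrightarrow> \<sigma> b < \<sigma> a"
      by (auto simp: Transposition.transpose_def)
    then show ?thesis by (simp add: q)
  qed
  then have "prod (?f (?t \<circ> \<sigma>)) (?P - {?p}) = prod (?f \<sigma>) (?P - {?p})"
    by (rule prod.cong[OF refl])
  moreover have "?f (?t \<circ> \<sigma>) ?p = ?f \<sigma> ?p * (if J ! x = c \<and> J ! y = c then -1 else 1)"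
    using assms(3,4) xy by (auto simp: min_def max_def Transposition.transpose_def)
  ultimately show ?thesis
    unfolding inv_sign_def prod.remove[OF finite_pairs p] by (simp only: mult_ac)
qed

definition adj_word :: "nat \<Rightarrow> nat list \<Rightarrow> bool" where
  "adj_word m w \<longleftrightarrow> (\<forall>i\<in>set w. Suc i < m)"

lemma perm_of_word_eq: "perm_of_word w = apply_adj_transps w"
  by (induction w) (simp_all add: perm_of_word_def)

lemma perm_of_word_Cons: "perm_of_word (k # w) = Transposition.transpose k (Suc k) \<circ> perm_of_word w"
  by (simp add: perm_of_word_def)

lemma perm_of_word_permutes: "adj_word m w \<Longrightarrow> perm_of_word w permutes {..<m}"
  unfolding perm_of_word_eq adj_word_def by (rule permutes_apply_adj_transps) auto

lemma perm_of_word_append: "perm_of_word (v @ w) = perm_of_word v \<circ> perm_of_word w"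
  by (induction v) (simp_all add: perm_of_word_def comp_assoc)

text \<open>Ensures that the SOME in \<open>rho\<close> picks a word with the required property:
  transpositions generate, and each is a product of adjacent ones.\<close>

lemma ex_adj_word:
  assumes "\<sigma> permutes {..<m}"
  shows "\<exists>w. adj_word m w \<and> perm_of_word w = \<sigma>"
proof -
  obtain xs where xs: "\<forall>(a, b)\<in>set xs. a \<noteq> b \<and> a \<in> {..<m} \<and> b \<in> {..<m}" "apply_transps xs = \<sigma>"
    using permutes_from_transpositions[OF assms] by auto
  have "\<exists>w. adj_word m w \<and> perm_of_word w = apply_transps xs"
    using xs(1)
  proof (induction xs)
    case Nil
    show ?case by (intro exI[of _ "[]"]) (simp add: adj_word_def perm_of_word_def)
  next
    case (Cons p xs)
    then obtain w where w: "adj_word m w" "perm_of_word w = apply_transps xs" by auto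
    obtain a b where p: "p = (a, b)" "a \<noteq> b" "a < m" "b < m" using Cons.prems by auto
    let ?v = "adj_transp_seq (min a b) (max a b)"
    have lt: "min a b < max a b" using p by auto
    have "adj_word m ?v"
      using p unfolding adj_word_def set_adj_transp_seq[OF lt] by auto
    moreover have "perm_of_word ?v = Transposition.transpose a b"
      unfolding perm_of_word_eq adj_transp_seq_correct[OF lt]
      by (auto simp: min_def max_def transpose_commute)
    ultimately show ?case
      using w p by (intro exI[of _ "?v @ w"]) (auto simp: perm_of_word_append adj_word_def)
  qed
  then show ?thesis using xs(2) by simp
qed

lemma permuted_idx:
  assumes "I \<in> idx m" "\<sigma> permutes {..<m}"
  shows "map (\<lambda>a. I ! \<sigma> a) [0..<m] \<in> idx m"
proof -
  have "I ! \<sigma> a \<in> {1, 2}" if "a < m" for a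
    using idx_nth[OF assms(1)] permutes_in_image[OF assms(2), of a] that by auto
  then have "set (map (\<lambda>a. I ! \<sigma> a) [0..<m]) \<subseteq> {1, 2}"
    unfolding set_map by (intro image_subsetI) simp
  then show ?thesis by (simp add: idx_def)
qed

text \<open>By the first formula the sign does not depend on the word chosen by \<open>SOME\<close> in the definition of \<open>rho\<close>;
  the second one exposes \<open>sign \<sigma>\<close>, which makes repeated letters 2 cancel in \<open>H\<^sub>m\<close>.\<close>
lemma
  assumes "adj_word m w" "I \<in> idx m" "J \<in> idx m"
  shows tw_word: "tw (mprod m (map Pk w)) I J = (if \<forall>a<m. J ! a = I ! perm_of_word w a
      then of_int (inv_sign 2 m (perm_of_word w) J) else (0 :: 'b::ring_1))" (is "?A I w")
    and inv_sign_two: "(\<forall>a<m. J ! a = I ! perm_of_word w a) \<Longrightarrow> inv_sign 2 m (perm_of_word w) J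
      = sign (perm_of_word w) * (-1) ^ (\<Sum>a<m. a * pty (I ! a) + a * pty (J ! a)) * inv_sign 1 m (perm_of_word w) J"
      (is "_ \<Longrightarrow> ?B I w")
proof -
  have "?A I w \<and> ((\<forall>a<m. J ! a = I ! perm_of_word w a) \<longrightarrow> ?B I w)"
    using assms(1,2)
  proof (induction w arbitrary: I)
    case Nil
    have "inv_sign c m (\<lambda>a. a) J = 1" for c
      by (auto simp: inv_sign_def intro!: prod.neutral)
    moreover have "perm_of_word [] = (\<lambda>a. a)"
      by (simp add: perm_of_word_def id_def)
    moreover have "(\<forall>a<m. J ! a = I ! a) \<longleftrightarrow> I = J"
      using Nil assms(3) by (metis idx_length nth_equalityI)
    ultimately show ?case
      using Nil by (auto simp: mprod_def tw_mone simp flip: mult_2 sum_distrib_left)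
  next
    case (Cons k w)
    let ?t = "Transposition.transpose k (Suc k)" and ?\<sigma> = "perm_of_word w"
    define K where "K = map (\<lambda>a. I ! ?t a) [0..<m]"
    have k: "Suc k < m" and w: "adj_word m w" using Cons.prems by (auto simp: adj_word_def)
    have \<sigma>: "?\<sigma> permutes {..<m}" by (rule perm_of_word_permutes[OF w])
    have "?t permutes {..<m}" using k by (intro permutes_swap_id) auto
    then have K: "K \<in> idx m" unfolding K_def by (rule permuted_idx[OF Cons.prems(2)])
    have K_nth: "K ! a = I ! ?t a" if "a < m" for a using that by (simp add: K_def)
    have I_k: "I ! k = K ! Suc k" "I ! Suc k = K ! k" using k by (simp_all add: K_nth)
    have K_in: "K ! k \<in> {1, 2}" "K ! Suc k \<in> {1, 2}" using idx_nth[OF K] k by auto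
    have ex: "\<exists>x<m. ?\<sigma> x = z" if "z < m" for z
      using permutes_surj[OF \<sigma>] permutes_in_image[OF \<sigma>] that by (metis lessThan_iff surjD)
    obtain x y where x: "x < m" "?\<sigma> x = k" and y: "y < m" "?\<sigma> y = Suc k"
      using ex[of k] ex[of "Suc k"] k by auto
    note flip = inv_sign_transpose[OF \<sigma> k x(2) y(2)]
    have J_iff: "(\<forall>a<m. J ! a = I ! perm_of_word (k # w) a) \<longleftrightarrow> (\<forall>a<m. J ! a = K ! ?\<sigma> a)"
      using permutes_in_image[OF \<sigma>] by (auto simp: perm_of_word_Cons K_nth)
    have uniq: "K' = K" if "K' \<in> idx m" "\<forall>a<m. K' ! a = I ! ?t a" for K'
      using that K by (intro nth_equalityI) (auto simp: idx_length K_nth)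
    have "tw (mprod m (map Pk (k # w))) I J = (\<Sum>K'\<in>idx m. tw (Pk k) I K' * tw (mprod m (map Pk w)) K' J)"
      using tw_mmul[OF Cons.prems(2) assms(3)] by (simp add: mprod_def)
    also have "\<dots> = (\<Sum>K'\<in>idx m. if K' = K then tw (Pk k) I K * tw (mprod m (map Pk w)) K J else 0 :: 'b)"
    proof (rule sum.cong[OF refl])
      fix K' assume K': "K' \<in> idx m"
      show "tw (Pk k) I K' * tw (mprod m (map Pk w)) K' J
          = (if K' = K then tw (Pk k) I K * tw (mprod m (map Pk w)) K J else (0 :: 'b))"
      proof (cases "K' = K")
        case False
        then have "\<not> (\<forall>a<m. K' ! a = I ! ?t a)" using uniq[OF K'] by blast
        then show ?thesis
          using False by (simp only: tw_Pk[OF Cons.prems(2) K' k] if_False mult_zero_left)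
      qed simp
    qed
    also have "\<dots> = tw (Pk k) I K * tw (mprod m (map Pk w)) K J"
      using K by simp
    also have "tw (Pk k) I K = ((-1) ^ (pty (K ! Suc k) * pty (K ! k)) :: 'b)"
    proof -
      have "\<forall>a<m. K ! a = I ! ?t a" using K_nth by blast
      then show ?thesis unfolding tw_Pk[OF Cons.prems(2) K k] I_k by (rule if_P)
    qed
    finally have step: "tw (mprod m (map Pk (k # w))) I J
      = (-1) ^ (pty (K ! Suc k) * pty (K ! k)) * (tw (mprod m (map Pk w)) K J :: 'b)" .
    have JK: "J ! x = K ! k" "J ! y = K ! Suc k" if "\<forall>a<m. J ! a = K ! ?\<sigma> a"
      using that x y by auto
    have A: "?A I (k # w)"
    proof (cases "\<forall>a<m. J ! a = K ! ?\<sigma> a")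
      case True
      then have "tw (mprod m (map Pk w)) K J = (of_int (inv_sign 2 m ?\<sigma> J) :: 'b)"
        by (rule trans[OF conjunct1[OF Cons.IH[OF w K]] if_P])
      then show ?thesis
        unfolding step J_iff if_P[OF True] unfolding perm_of_word_Cons flip JK[OF True] using K_in
        by (elim insertE emptyE) (simp_all add: pty_def)
    next
      case False
      then have "tw (mprod m (map Pk w)) K J = (0 :: 'b)"
        by (rule trans[OF conjunct1[OF Cons.IH[OF w K]] if_not_P])
      then show ?thesis
        unfolding step J_iff if_not_P[OF False] by simp
    qed
    have split: "(\<Sum>a<m. f a) = f k + f (Suc k) + sum f ({..<m} - {k} - {Suc k})" for f :: "nat \<Rightarrow> nat"
      using k sum.remove[of "{..<m}" k f] sum.remove[of "{..<m} - {k}" "Suc k" f] by simp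
    \<comment> \<open>Exchanging the places k and k + 1 changes the sum of a |I_a| by 1 exactly when
      the two letters differ. This offsets the change of \<open>sign\<close> in that case; for equal
      letters one of the two \<open>inv_sign\<close> factors adjusts instead.\<close>
    have "(\<Sum>a<m. a * pty (I ! a)) = (\<Sum>a<m. ?t a * pty (K ! a))"
      by (rule sum.reindex_bij_witness[of _ ?t ?t]) (use k in \<open>auto simp: K_nth Transposition.transpose_def\<close>)
    also have "\<dots> = Suc k * pty (K ! k) + k * pty (K ! Suc k)
        + (\<Sum>a\<in>{..<m} - {k} - {Suc k}. ?t a * pty (K ! a))"
      by (simp add: split)
    also have "(\<Sum>a\<in>{..<m} - {k} - {Suc k}. ?t a * pty (K ! a)) = (\<Sum>a\<in>{..<m} - {k} - {Suc k}. a * pty (K ! a))"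
      by (intro sum.cong) (auto simp: Transposition.transpose_def)
    finally have "even ((\<Sum>a<m. a * pty (I ! a)) + (\<Sum>a<m. a * pty (K ! a)) + (pty (K ! k) + pty (K ! Suc k)))"
      unfolding split[of "\<lambda>a. a * pty (K ! a)"] by auto
    then have "even ((\<Sum>a<m. a * pty (I ! a) + a * pty (J ! a)) +
        ((\<Sum>a<m. a * pty (K ! a) + a * pty (J ! a)) + (pty (K ! k) + pty (K ! Suc k))))"
      by (auto simp: sum.distrib)
    from minus_one_power_cong[OF this]
    have \<nu>: "(-1 :: int) ^ (\<Sum>a<m. a * pty (I ! a) + a * pty (J ! a))
      = (-1) ^ (\<Sum>a<m. a * pty (K ! a) + a * pty (J ! a)) * (-1) ^ (pty (K ! k) + pty (K ! Suc k))"
      by (simp only: power_add)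
    have sgn: "sign (perm_of_word (k # w)) = - sign ?\<sigma>"
      unfolding perm_of_word_Cons unfolding perm_of_word_eq
      by (subst sign_compose) (simp_all add: permutation_swap_id permutation_apply_adj_transps sign_swap_id)
    have "?B I (k # w)" if "\<forall>a<m. J ! a = I ! perm_of_word (k # w) a"
    proof -
      have J: "\<forall>a<m. J ! a = K ! ?\<sigma> a" using that J_iff by blast
      then have IH: "?B K w" using Cons.IH[OF w K] by blast
      show ?thesis
        unfolding sgn \<nu> unfolding perm_of_word_Cons flip IH JK[OF J] using K_in
        by (elim insertE emptyE) (simp_all add: pty_def)
    qed
    with A show ?case by blast
  qed
  then show "?A I w" "(\<forall>a<m. J ! a = I ! perm_of_word w a) \<Longrightarrow> ?B I w" by blast+
qed

lemma
  assumes "\<sigma> permutes {..<m}" "I \<in> idx m" "J \<in> idx m"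
  shows tw_rho: "tw (rho m \<sigma>) I J = (if \<forall>a<m. J ! a = I ! \<sigma> a then of_int (inv_sign 2 m \<sigma> J) else 0)"
    and inv_sign_two_one: "(\<forall>a<m. J ! a = I ! \<sigma> a) \<Longrightarrow> inv_sign 2 m \<sigma> J
      = sign \<sigma> * (-1) ^ (\<Sum>a<m. a * pty (I ! a) + a * pty (J ! a)) * inv_sign 1 m \<sigma> J"
proof -
  define w where "w = (SOME w. (\<forall>i\<in>set w. Suc i < m) \<and> perm_of_word w = \<sigma>)"
  have "(\<forall>i\<in>set w. Suc i < m) \<and> perm_of_word w = \<sigma>"
    unfolding w_def by (rule someI_ex) (use ex_adj_word[OF assms(1)] in \<open>simp add: adj_word_def\<close>)
  then have w: "adj_word m w" "perm_of_word w = \<sigma>" by (simp_all add: adj_word_def)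
  show "tw (rho m \<sigma>) I J = (if \<forall>a<m. J ! a = I ! \<sigma> a then of_int (inv_sign 2 m \<sigma> J) else 0)"
    unfolding rho_def w_def[symmetric] using tw_word[OF w(1) assms(2,3)] by (simp only: w(2))
  show "(\<forall>a<m. J ! a = I ! \<sigma> a) \<Longrightarrow> inv_sign 2 m \<sigma> J
      = sign \<sigma> * (-1) ^ (\<Sum>a<m. a * pty (I ! a) + a * pty (J ! a)) * inv_sign 1 m \<sigma> J"
    using inv_sign_two[OF w(1) assms(2,3)] by (simp only: w(2))
qed

subsection \<open>Supertraces against symmetrizers\<close>

definition permute_idx :: "nat \<Rightarrow> (nat \<Rightarrow> nat) \<Rightarrow> nat list \<Rightarrow> nat list" where
  "permute_idx m \<sigma> I = map (\<lambda>a. I ! \<sigma> a) [0..<m]"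

lemma permute_idx_nth: "a < m \<Longrightarrow> permute_idx m \<sigma> I ! a = I ! \<sigma> a"
  and length_permute_idx: "length (permute_idx m \<sigma> I) = m"
  by (simp_all add: permute_idx_def)

lemma permute_idx_in: "I \<in> idx m \<Longrightarrow> \<sigma> permutes {..<m} \<Longrightarrow> permute_idx m \<sigma> I \<in> idx m"
  unfolding permute_idx_def by (rule permuted_idx)

lemma eq_permute_idx:
  assumes "J \<in> idx m"
  shows "(\<forall>a<m. J ! a = I ! \<sigma> a) \<longleftrightarrow> J = permute_idx m \<sigma> I"
  using assms by (auto simp: permute_idx_nth length_permute_idx idx_length intro!: nth_equalityI)

text \<open>Common form of \<open>Asym\<close> (\<open>\<chi>\<close> is \<open>sign\<close>) and
  \<open>Hsym\<close> (\<open>\<chi>\<close> is 1), with k the inverse of m!.\<close>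

definition symmetrizer :: "'b::ring_1 \<Rightarrow> ((nat \<Rightarrow> nat) \<Rightarrow> int) \<Rightarrow> nat \<Rightarrow> nat list \<Rightarrow> nat list \<Rightarrow> 'b" where
  "symmetrizer k \<chi> m = (\<lambda>I J. k * (\<Sum>\<sigma>\<in>{\<sigma>. \<sigma> permutes {..<m}}. of_int (\<chi> \<sigma>) * rho m \<sigma> I J))"

text \<open>Row I of a twisted \<open>rho m \<sigma>\<close> has a single nonzero entry, at
  \<open>permute_idx m \<sigma> I\<close>, so the middle index is determined by
  \<open>\<sigma>\<close>.\<close>

lemma str_mmul_symmetrizer:
  fixes k :: "'b::ring_1"
  assumes k: "\<And>x. x * k = k * x"
  shows "str m (mmul m (symmetrizer k \<chi> m) M) = k * (\<Sum>I\<in>idx m. (-1) ^ ptys I *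
    (\<Sum>\<sigma>\<in>{\<sigma>. \<sigma> permutes {..<m}}. of_int (\<chi> \<sigma> * inv_sign 2 m \<sigma> (permute_idx m \<sigma> I)) * tw M (permute_idx m \<sigma> I) I))"
proof -
  let ?S = "{\<sigma>. \<sigma> permutes {..<m}}"
  have diag: "tw (mmul m (symmetrizer k \<chi> m) M) I I
      = k * (\<Sum>\<sigma>\<in>?S. of_int (\<chi> \<sigma> * inv_sign 2 m \<sigma> (permute_idx m \<sigma> I)) * tw M (permute_idx m \<sigma> I) I)"
    if I: "I \<in> idx m" for I
  proof -
    have tw: "tw (symmetrizer k \<chi> m) I J = k * (\<Sum>\<sigma>\<in>?S. of_int (\<chi> \<sigma>) * tw (rho m \<sigma>) I J)" for J
      unfolding tw_def symmetrizer_def sum_distrib_left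
      by (intro sum.cong refl) (simp add: minus_one_power_iff)
    have "tw (mmul m (symmetrizer k \<chi> m) M) I I
        = (\<Sum>J\<in>idx m. k * (\<Sum>\<sigma>\<in>?S. of_int (\<chi> \<sigma>) * tw (rho m \<sigma>) I J * tw M J I))"
      by (simp add: tw_mmul[OF I I] tw mult.assoc sum_distrib_right)
    also have "\<dots> = k * (\<Sum>\<sigma>\<in>?S. \<Sum>J\<in>idx m. of_int (\<chi> \<sigma>) * tw (rho m \<sigma>) I J * tw M J I)"
      by (simp only: sum_distrib_left[symmetric] sum.swap[of _ _ "idx m"])
    also have "(\<Sum>\<sigma>\<in>?S. \<Sum>J\<in>idx m. of_int (\<chi> \<sigma>) * tw (rho m \<sigma>) I J * tw M J I)
        = (\<Sum>\<sigma>\<in>?S. of_int (\<chi> \<sigma> * inv_sign 2 m \<sigma> (permute_idx m \<sigma> I)) * tw M (permute_idx m \<sigma> I) I)"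
    proof (rule sum.cong[OF refl])
      fix \<sigma> assume "\<sigma> \<in> ?S"
      then have \<sigma>: "\<sigma> permutes {..<m}" by simp
      have "of_int (\<chi> \<sigma>) * tw (rho m \<sigma>) I J * tw M J I = (if J = permute_idx m \<sigma> I
          then of_int (\<chi> \<sigma> * inv_sign 2 m \<sigma> (permute_idx m \<sigma> I)) * tw M (permute_idx m \<sigma> I) I else 0)"
        if "J \<in> idx m" for J
        unfolding tw_rho[OF \<sigma> I that] eq_permute_idx[OF that] by simp
      then have "(\<Sum>J\<in>idx m. of_int (\<chi> \<sigma>) * tw (rho m \<sigma>) I J * tw M J I)
          = (\<Sum>J\<in>idx m. if J = permute_idx m \<sigma> I
          then of_int (\<chi> \<sigma> * inv_sign 2 m \<sigma> (permute_idx m \<sigma> I)) * tw M (permute_idx m \<sigma> I) I else 0)"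
        by (rule sum.cong[OF refl])
      then show "(\<Sum>J\<in>idx m. of_int (\<chi> \<sigma>) * tw (rho m \<sigma>) I J * tw M J I)
          = of_int (\<chi> \<sigma> * inv_sign 2 m \<sigma> (permute_idx m \<sigma> I)) * tw M (permute_idx m \<sigma> I) I"
        using permute_idx_in[OF I \<sigma>] by simp
    qed
    finally show ?thesis .
  qed
  have "str m (mmul m (symmetrizer k \<chi> m) M) = (\<Sum>I\<in>idx m. (-1) ^ ptys I * (k *
    (\<Sum>\<sigma>\<in>?S. of_int (\<chi> \<sigma> * inv_sign 2 m \<sigma> (permute_idx m \<sigma> I)) * tw M (permute_idx m \<sigma> I) I)))"
    unfolding str_eq_tw by (intro sum.cong refl) (simp only: diag)
  also have "\<dots> = (\<Sum>I\<in>idx m. k * ((-1) ^ ptys I *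
    (\<Sum>\<sigma>\<in>?S. of_int (\<chi> \<sigma> * inv_sign 2 m \<sigma> (permute_idx m \<sigma> I)) * tw M (permute_idx m \<sigma> I) I)))"
    by (simp only: k flip: mult.assoc)
  finally show ?thesis
    by (simp only: sum_distrib_left)
qed

text \<open>Exchanging two equal entries \<open>e\<close> reverses \<open>sign \<sigma>\<close> and nothing else.\<close>
lemma sum_permutations_vanish:
  fixes F :: "nat list \<Rightarrow> 'b::ring_1"
  assumes two: "\<And>x :: 'b. 2 * x = 0 \<Longrightarrow> x = 0"
    and ab: "a < m" "b < m" "a \<noteq> b" "I ! a = e" "I ! b = e" and "e \<noteq> e'"
  shows "(\<Sum>\<sigma>\<in>{\<sigma>. \<sigma> permutes {..<m}}. of_int (sign \<sigma> * \<theta> (permute_idx m \<sigma> I) * inv_sign e' m \<sigma> (permute_idx m \<sigma> I))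
    * F (permute_idx m \<sigma> I)) = 0" (is "sum ?f ?S = 0")
proof -
  let ?t = "Transposition.transpose a b"
  have t: "?t permutes {..<m}" using ab by (intro permutes_swap_id) auto
  have "?f (?t \<circ> \<sigma>) = - ?f \<sigma>" if "\<sigma> \<in> ?S" for \<sigma>
  proof -
    have \<sigma>: "\<sigma> permutes {..<m}" using that by simp
    have p: "permute_idx m (?t \<circ> \<sigma>) I = permute_idx m \<sigma> I"
      using ab by (auto simp: permute_idx_def Transposition.transpose_def)
    have "?t (\<sigma> x) = \<sigma> x" if "x < m" "permute_idx m \<sigma> I ! x = e'" for x
      using that ab \<open>e \<noteq> e'\<close> by (auto simp: permute_idx_nth Transposition.transpose_def)
    then have "inv_sign e' m (?t \<circ> \<sigma>) (permute_idx m \<sigma> I) = inv_sign e' m \<sigma> (permute_idx m \<sigma> I)"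
      unfolding inv_sign_def by (intro prod.cong) auto
    moreover have "permutation \<sigma>"
      using \<sigma> permutation_permutes by blast
    then have "sign (?t \<circ> \<sigma>) = - sign \<sigma>"
      using ab by (simp add: sign_compose permutation_swap_id sign_swap_id)
    ultimately show ?thesis by (simp add: p)
  qed
  then have "(\<Sum>\<sigma>\<in>?S. ?f (?t \<circ> \<sigma>)) = - sum ?f ?S"
    by (simp add: sum_negf)
  then have "sum ?f ?S = - sum ?f ?S"
    using setum_permutations_compose_left[OF t, of ?f] by simp
  then have "2 * sum ?f ?S = 0"
    by (simp only: mult_2 eq_neg_iff_add_eq_0)
  then show ?thesis by (rule two)
qed

definition one_off :: "nat \<Rightarrow> nat \<Rightarrow> nat \<Rightarrow> nat \<Rightarrow> nat list" where
  "one_off m e e' j = (replicate m e')[j := e]"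

lemma one_off_nth: "s < m \<Longrightarrow> one_off m e e' j ! s = (if s = j then e else e')"
  by (auto simp: one_off_def nth_list_update)

lemma length_one_off: "length (one_off m e e' j) = m"
  by (simp add: one_off_def)

lemma permute_replicate:
  assumes "\<sigma> permutes {..<m}"
  shows "permute_idx m \<sigma> (replicate m e) = replicate m e"
proof -
  have "\<sigma> a < m" if "a < m" for a
    using permutes_in_image[OF assms, of a] that by simp
  then show ?thesis
    by (intro nth_equalityI) (auto simp: permute_idx_nth length_permute_idx)
qed

lemma permute_one_off:
  assumes "\<sigma> permutes {..<m}"
  shows "permute_idx m \<sigma> (one_off m e e' (\<sigma> i)) = one_off m e e' i"
proof -
  have "\<sigma> a < m" "\<sigma> a = \<sigma> i \<longleftrightarrow> a = i" if "a < m" for a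
    using permutes_in_image[OF assms, of a] permutes_inj[OF assms] that by (auto simp: inj_eq)
  then show ?thesis
    by (intro nth_equalityI) (auto simp: permute_idx_nth length_permute_idx length_one_off one_off_nth)
qed

lemma sum_idx_one_off:
  assumes e: "e \<in> {1, 2}" "e' \<in> {1, 2}" "e \<noteq> e'"
    and 0: "\<And>I a b. I \<in> idx m \<Longrightarrow> a < m \<Longrightarrow> b < m \<Longrightarrow> a \<noteq> b \<Longrightarrow> I ! a = e \<Longrightarrow> I ! b = e \<Longrightarrow> f I = 0"
  shows "(\<Sum>I\<in>idx m. f I) = f (replicate m e') + (\<Sum>j<m. f (one_off m e e' j))"
proof -
  let ?T = "insert (replicate m e') (one_off m e e' ` {..<m})"
  have sub: "?T \<subseteq> idx m"
  proof -
    have "replicate m e' \<in> idx m"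
      using e(2) by (auto simp: idx_def)
    then show ?thesis
      unfolding one_off_def by (intro insert_subsetI image_subsetI idx_update[OF _ e(1)])
  qed
  have "f I = 0" if I: "I \<in> idx m - ?T" for I
  proof (rule ccontr)
    assume "f I \<noteq> 0"
    then have uniq: "a = b" if "a < m" "b < m" "I ! a = e" "I ! b = e" for a b
      using 0[of I a b] I that by blast
    have I_in: "I ! s = e \<or> I ! s = e'" if "s < m" for s
    proof -
      have "I ! s \<in> {1, 2}" using idx_nth I that by blast
      then show ?thesis using e by auto
    qed
    have len: "length I = m" using I idx_length by blast
    show False
    proof (cases "\<exists>j<m. I ! j = e")
      case True
      then obtain j where j: "j < m" "I ! j = e" by blast
      then have "I = one_off m e e' j"
        using I_in uniq len by (intro nth_equalityI) (auto simp: one_off_nth length_one_off)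
      then show False using I j by blast
    next
      case False
      then have "I = replicate m e'"
        using I_in len by (intro nth_equalityI) auto
      then show False using I by blast
    qed
  qed
  then have "(\<Sum>I\<in>idx m. f I) = sum f ?T"
    using sub by (intro sum.mono_neutral_right) auto
  moreover have "inj_on (one_off m e e') {..<m}"
  proof (rule inj_onI)
    fix x y assume x: "x \<in> {..<m}" and "one_off m e e' x = one_off m e e' y"
    then have "one_off m e e' x ! x = one_off m e e' y ! x" by simp
    then show "x = y" using x e(3) by (simp add: one_off_nth split: if_splits)
  qed
  moreover have "replicate m e' \<notin> one_off m e e' ` {..<m}"
  proof
    assume "replicate m e' \<in> one_off m e e' ` {..<m}"
    then obtain x where x: "x < m" "replicate m e' = one_off m e e' x" by auto
    from arg_cong[OF x(2), of "\<lambda>xs. xs ! x"] show False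
      using x(1) e(3) by (simp add: one_off_nth)
  qed
  ultimately show ?thesis
    by (simp add: sum.reindex)
qed

text \<open>The sum over permutations does not depend on i; summed over all i, each permutation
  contributes the full sum of h. The factor m avoids a division.\<close>

lemma sum_permutations_eval:
  fixes h :: "nat \<Rightarrow> 'b::ring_1"
  assumes "i < m"
  shows "of_nat m * (\<Sum>\<sigma>\<in>{\<sigma>. \<sigma> permutes {..<m}}. h (\<sigma> i)) = of_nat (fact m) * (\<Sum>j<m. h j)"
proof -
  let ?S = "{\<sigma>. \<sigma> permutes {..<m}}"
  have eq: "(\<Sum>\<sigma>\<in>?S. h (\<sigma> j)) = (\<Sum>\<sigma>\<in>?S. h (\<sigma> i))" if "j < m" for j
    using sum_permutations_compose_right[of "Transposition.transpose i j" "{..<m}" "\<lambda>\<sigma>. h (\<sigma> j)"] that assms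
    by (simp add: permutes_swap_id)
  have "of_nat m * (\<Sum>\<sigma>\<in>?S. h (\<sigma> i)) = (\<Sum>j<m. \<Sum>\<sigma>\<in>?S. h (\<sigma> j))"
    by (simp add: eq)
  also have "\<dots> = (\<Sum>\<sigma>\<in>?S. \<Sum>j<m. h (\<sigma> j))"
    by (rule sum.swap)
  also have "\<dots> = (\<Sum>\<sigma>\<in>?S. \<Sum>j<m. h j)"
  proof (rule sum.cong[OF refl])
    fix \<sigma> assume "\<sigma> \<in> ?S"
    then have "\<sigma> permutes {..<m}" by simp
    from sum.permute[OF this, of h] show "(\<Sum>j<m. h (\<sigma> j)) = (\<Sum>j<m. h j)"
      by (simp add: comp_def)
  qed
  also have "\<dots> = of_nat (fact m) * (\<Sum>j<m. h j)"
    using card_permutations[of "{..<m}" m] by simp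
  finally show ?thesis .
qed

subsection \<open>Evaluation of the supertraces\<close>

text \<open>From \<open>\<beta>\<close> (D - B A^-1 C) = A one gets D \<open>\<beta>\<close> - A = B
  s C. Expanding s around D^-1 leaves B D^-1 C and a term containing B D^-1 B.\<close>

lemma schur_identity:
  fixes A :: "'b::ring_1"
  assumes A': "A * A' = 1" "A' * A = 1" and D': "D * D' = 1" "D' * D = 1"
    and s: "(D - B * A' * C) * s = 1" "s * (D - B * A' * C) = 1"
    and As: "s * A = A * s" and \<beta>: "\<beta> = A * s" and \<beta>B: "\<beta> * B = B * \<beta>" and \<beta>D: "\<beta> * D = D * \<beta>"
    and BDB: "B * D' * B = 0"
  shows "D * \<beta> - A = B * (D' * C)"
proof -
  have \<beta>A': "\<beta> * A' = s"
    unfolding \<beta> As[symmetric] by (simp add: mult.assoc A')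
  have "\<beta> * (D - B * A' * C) = A"
    unfolding \<beta> by (simp only: mult.assoc[of A s "D - B * A' * C"] s mult_1_right)
  then have "A = \<beta> * D - \<beta> * B * A' * C"
    by (simp only: right_diff_distrib mult.assoc)
  then have "D * \<beta> - A = \<beta> * B * A' * C"
    unfolding \<beta>D[symmetric] by simp
  also have "\<dots> = B * (\<beta> * A') * C"
    by (simp only: \<beta>B mult.assoc)
  also have "\<dots> = B * s * C"
    by (simp only: \<beta>A')
  also have "s = D' + D' * B * A' * C * s"
  proof -
    have "D' * ((D - B * A' * C) * s) = s - D' * B * A' * C * s"
      by (simp add: left_diff_distrib right_diff_distrib D' flip: mult.assoc)
    then show ?thesis
      unfolding s mult_1_right eq_diff_eq by (rule sym)
  qed
  also have "B * (D' + D' * B * A' * C * s) * C = B * (D' * C) + B * D' * B * (A' * C * s * C)"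
    by (simp add: algebra_simps)
  finally show ?thesis
    unfolding BDB by simp
qed

section \<open>Complex scalars and averages over permutations\<close>

locale scalars =
  fixes c :: "complex \<Rightarrow> 'a::ring_1"
  assumes c_one: "c 1 = 1"
    and c_add: "c (a + b) = c a + c b"
    and c_mult: "c (a * b) = c a * c b"
    and c_central: "c a * y = y * c a"
begin

definition \<kappa> :: "complex \<Rightarrow> 'a fps" where "\<kappa> z = fps_const (c z)"

lemma \<kappa>_mult: "\<kappa> (a * b) = \<kappa> a * \<kappa> b"
  and \<kappa>_add: "\<kappa> (a + b) = \<kappa> a + \<kappa> b"
  and \<kappa>_1: "\<kappa> 1 = 1"
  by (simp_all add: \<kappa>_def c_one c_add c_mult)

lemma \<kappa>_0: "\<kappa> 0 = 0"
  using \<kappa>_add[of 0 0] by simp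

lemma \<kappa>_minus: "\<kappa> (- a) = - \<kappa> a"
  using \<kappa>_add[of "- a" a] by (simp add: \<kappa>_0 eq_neg_iff_add_eq_0)

lemma \<kappa>_central: "f * \<kappa> z = \<kappa> z * f"
  unfolding \<kappa>_def by (rule fps_const_central[symmetric]) (rule c_central)

lemma \<kappa>_of_nat: "\<kappa> (of_nat n) = of_nat n"
  by (induction n) (simp_all add: \<kappa>_0 \<kappa>_add \<kappa>_1)

lemma \<kappa>_power: "\<kappa> (a ^ n) = \<kappa> a ^ n"
  by (induction n) (simp_all add: \<kappa>_1 \<kappa>_mult)

text \<open>The image of 1/n under \<open>c\<close> inverts n in the ring.\<close>

lemma of_nat_cancel:
  assumes "of_nat n * x = of_nat n * (y :: 'a fps)" "n > 0"
  shows "x = y"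
proof -
  have "\<kappa> (inverse (of_nat n)) * \<kappa> (of_nat n) = 1"
    using assms(2) by (simp add: \<kappa>_1 flip: \<kappa>_mult)
  then have *: "\<kappa> (inverse (of_nat n)) * (of_nat n * z) = z" for z
    unfolding \<kappa>_of_nat by (simp flip: mult.assoc)
  have "x = \<kappa> (inverse (of_nat n)) * (of_nat n * x)" by (rule *[symmetric])
  also have "\<dots> = y" unfolding assms(1) by (rule *)
  finally show ?thesis .
qed

lemma two_cancel: "2 * x = 0 \<Longrightarrow> x = (0 :: 'a fps)"
  using of_nat_cancel[of 2 x 0] by simp

lemma prod_list_scalars:
  "prod_list (map (\<lambda>s. \<kappa> (z s) * g s) [0..<m]) = \<kappa> (\<Prod>s<m. z s) * prod_list (map g [0..<m])"
proof (induction m)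
  case (Suc m)
  let ?P = "\<Prod>s<m. z s" and ?G = "prod_list (map g [0..<m])"
  have "\<kappa> ?P * ?G * (\<kappa> (z m) * g m) = \<kappa> ?P * (?G * \<kappa> (z m)) * g m"
    by (simp only: mult.assoc)
  also have "?G * \<kappa> (z m) = \<kappa> (z m) * ?G"
    by (rule \<kappa>_central)
  finally show ?case
    by (simp add: Suc \<kappa>_mult mult.assoc)
qed (simp add: \<kappa>_1)

text \<open>For fixed i the values \<open>\<sigma> i\<close> are equidistributed, so only the row
  sums of g enter.\<close>

lemma sum_permutations_rows:
  fixes g :: "nat \<Rightarrow> nat \<Rightarrow> 'a fps"
  assumes "\<And>i. i < m \<Longrightarrow> (\<Sum>j<m. g i j) = y" "m > 0"
  shows "(\<Sum>\<sigma>\<in>{\<sigma>. \<sigma> permutes {..<m}}. \<Sum>i<m. g i (\<sigma> i)) = of_nat (fact m) * y"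
proof (rule of_nat_cancel[OF _ assms(2)])
  have "of_nat m * (\<Sum>\<sigma>\<in>{\<sigma>. \<sigma> permutes {..<m}}. \<Sum>i<m. g i (\<sigma> i))
      = (\<Sum>i<m. of_nat m * (\<Sum>\<sigma>\<in>{\<sigma>. \<sigma> permutes {..<m}}. g i (\<sigma> i)))"
    by (simp only: sum.swap[of _ "{..<m}"] sum_distrib_left)
  also have "\<dots> = (\<Sum>i<m. of_nat (fact m) * y)"
    by (intro sum.cong refl) (simp add: sum_permutations_eval assms(1))
  finally show "of_nat m * (\<Sum>\<sigma>\<in>{\<sigma>. \<sigma> permutes {..<m}}. \<Sum>i<m. g i (\<sigma> i)) = of_nat m * (of_nat (fact m) * y)"
    by simp
qed

lemma sum_permutations_columns:
  fixes g :: "nat \<Rightarrow> nat \<Rightarrow> 'a fps"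
  assumes "\<And>j. j < m \<Longrightarrow> (\<Sum>i<m. g i j) = y" "m > 0"
  shows "(\<Sum>\<sigma>\<in>{\<sigma>. \<sigma> permutes {..<m}}. \<Sum>i<m. g i (\<sigma> i)) = of_nat (fact m) * y"
proof -
  have "(\<Sum>i<m. g i (\<sigma> i)) = (\<Sum>j<m. g (inv \<sigma> j) j)" if "\<sigma> permutes {..<m}" for \<sigma>
    using sum.permute[OF that, of "\<lambda>j. g (inv \<sigma> j) j"] permutes_inverses(2)[OF that]
    by (simp add: comp_def)
  then have "(\<Sum>\<sigma>\<in>{\<sigma>. \<sigma> permutes {..<m}}. \<Sum>i<m. g i (\<sigma> i))
      = (\<Sum>\<sigma>\<in>{\<sigma>. \<sigma> permutes {..<m}}. \<Sum>j<m. g (inv \<sigma> j) j)"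
    by (rule sum.cong[OF refl]) (simp only: mem_Collect_eq)
  also have "\<dots> = (\<Sum>\<sigma>\<in>{\<sigma>. \<sigma> permutes {..<m}}. \<Sum>j<m. g (\<sigma> j) j)"
    by (rule sum_permutations_inverse[symmetric])
  also have "\<dots> = of_nat (fact m) * y"
    using assms by (intro sum_permutations_rows)
  finally show ?thesis .
qed

end

lemma inv_sign_eq_1:
  assumes "\<And>a b. a < m \<Longrightarrow> b < m \<Longrightarrow> J ! a = e \<Longrightarrow> J ! b = e \<Longrightarrow> a = b"
  shows "inv_sign e m \<sigma> J = 1"
  unfolding inv_sign_def
proof (intro prod.neutral ballI)
  fix x assume "x \<in> {(a, b). a < b \<and> b < m}"
  then obtain a b where x: "x = (a, b)" "a < b" "b < m" by auto
  then have "\<not> (J ! a = e \<and> J ! b = e)" using assms[of a b] by auto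
  then show "(case x of (a, b) \<Rightarrow> if J ! a = e \<and> J ! b = e \<and> \<sigma> b < \<sigma> a then - 1 else 1) = (1 :: int)"
    using x by auto
qed

lemma one_off_in_idx: "e \<in> {1, 2} \<Longrightarrow> e' \<in> {1, 2} \<Longrightarrow> one_off m e e' j \<in> idx m"
  unfolding one_off_def by (intro idx_update) (auto simp: idx_def)

lemma replicate_in_idx: "e \<in> {1, 2} \<Longrightarrow> replicate m e \<in> idx m"
  by (auto simp: idx_def)

lemma sum_one_off_reindex:
  assumes "\<And>\<sigma> i. \<sigma> permutes {..<m} \<Longrightarrow> i < m \<Longrightarrow>
    \<chi> \<sigma> * inv_sign 2 m \<sigma> (one_off m e e' i) = w i (\<sigma> i)"
  shows "(\<Sum>j<m. \<Sum>\<sigma>\<in>{\<sigma>. \<sigma> permutes {..<m}}.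
      of_int (\<chi> \<sigma> * inv_sign 2 m \<sigma> (permute_idx m \<sigma> (one_off m e e' j))) * F (permute_idx m \<sigma> (one_off m e e' j)) (one_off m e e' j))
    = (\<Sum>\<sigma>\<in>{\<sigma>. \<sigma> permutes {..<m}}. \<Sum>i<m. of_int (w i (\<sigma> i)) * (F (one_off m e e' i) (one_off m e e' (\<sigma> i)) :: 'b::ring_1))"
proof (subst sum.swap, rule sum.cong[OF refl])
  fix \<sigma> assume "\<sigma> \<in> {\<sigma>. \<sigma> permutes {..<m}}"
  then have \<sigma>: "\<sigma> permutes {..<m}" by simp
  show "(\<Sum>j<m. of_int (\<chi> \<sigma> * inv_sign 2 m \<sigma> (permute_idx m \<sigma> (one_off m e e' j))) * F (permute_idx m \<sigma> (one_off m e e' j)) (one_off m e e' j))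
    = (\<Sum>i<m. of_int (w i (\<sigma> i)) * F (one_off m e e' i) (one_off m e e' (\<sigma> i)))"
    by (subst sum.permute[OF \<sigma>], rule sum.cong[OF refl])
      (simp only: comp_def permute_one_off[OF \<sigma>] assms[OF \<sigma>] lessThan_iff)
qed

text \<open>\<open>inv_sign_two_one\<close> trades \<open>sign\<close> times the sign of the letters
  2 for the sign of the letters 1, which is trivial on words with at most one letter 1; other words
  cancel. What remains of the exchange is (-1)^(i + \<open>\<sigma> i\<close>).\<close>

lemma str_antisymmetrizer:
  fixes M :: "nat list \<Rightarrow> nat list \<Rightarrow> 'b::ring_1"
  assumes k: "\<And>x. x * k = k * x" and two: "\<And>x :: 'b. 2 * x = 0 \<Longrightarrow> x = 0"
  shows "str m (mmul m (symmetrizer k sign m) M) = k * ((-1) ^ m * (of_nat (fact m) * tw M (replicate m 2) (replicate m 2))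
    - (-1) ^ m * (\<Sum>\<sigma>\<in>{\<sigma>. \<sigma> permutes {..<m}}. \<Sum>i<m. (-1) ^ (i + \<sigma> i) * tw M (one_off m 1 2 i) (one_off m 1 2 (\<sigma> i))))"
proof -
  let ?S = "{\<sigma>. \<sigma> permutes {..<m}}"
  let ?g = "\<lambda>I. \<Sum>\<sigma>\<in>?S. of_int (sign \<sigma> * inv_sign 2 m \<sigma> (permute_idx m \<sigma> I)) * tw M (permute_idx m \<sigma> I) I"
  have w: "sign \<sigma> * inv_sign 2 m \<sigma> J = (-1) ^ (\<Sum>a<m. a * pty (I ! a) + a * pty (J ! a)) * inv_sign 1 m \<sigma> J"
    if "I \<in> idx m" "\<sigma> permutes {..<m}" "J = permute_idx m \<sigma> I" for I J \<sigma>
  proof -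
    have "\<forall>a<m. J ! a = I ! \<sigma> a"
      by (simp add: that(3) permute_idx_nth)
    moreover have "J \<in> idx m"
      unfolding that(3) using that(1,2) by (rule permute_idx_in)
    ultimately show ?thesis
      using inv_sign_two_one[OF that(2,1), of J] by (simp flip: mult.assoc)
  qed
  have "?g I = 0" if "I \<in> idx m" "a < m" "b < m" "a \<noteq> b" "I ! a = 1" "I ! b = 1" for I a b
    using sum_permutations_vanish[OF two that(2-6), of 2 "\<lambda>_. 1" "\<lambda>J. tw M J I"] by simp
  then have "(\<Sum>I\<in>idx m. (-1) ^ ptys I * ?g I)
      = (-1) ^ ptys (replicate m 2) * ?g (replicate m 2) + (\<Sum>j<m. (-1) ^ ptys (one_off m 1 2 j) * ?g (one_off m 1 2 j))"
    by (intro sum_idx_one_off) auto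
  also have "?g (replicate m 2) = (\<Sum>\<sigma>\<in>?S. tw M (replicate m 2) (replicate m 2))"
  proof (rule sum.cong[OF refl])
    fix \<sigma> assume "\<sigma> \<in> ?S"
    then have \<sigma>: "\<sigma> permutes {..<m}" by simp
    have "sign \<sigma> * inv_sign 2 m \<sigma> (replicate m 2) = (-1) ^ (\<Sum>a<m. a * pty (replicate m 2 ! a) + a * pty (replicate m 2 ! a))
        * inv_sign 1 m \<sigma> (replicate m 2)"
      by (rule w[OF replicate_in_idx \<sigma>]) (simp_all add: permute_replicate[OF \<sigma>])
    also have "\<dots> = 1"
      by (subst inv_sign_eq_1) (simp_all flip: mult_2 sum_distrib_left)
    finally show "of_int (sign \<sigma> * inv_sign 2 m \<sigma> (permute_idx m \<sigma> (replicate m 2))) * tw M (permute_idx m \<sigma> (replicate m 2)) (replicate m 2)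
        = tw M (replicate m 2) (replicate m 2)"
      unfolding permute_replicate[OF \<sigma>] by simp
  qed
  also have "\<dots> = of_nat (fact m) * tw M (replicate m 2) (replicate m 2)"
    using card_permutations[of "{..<m}" m] by simp
  also have "ptys (replicate m 2) = m"
    by (simp add: ptys_eq_sum pty_def)
  also have "(\<Sum>j<m. (-1) ^ ptys (one_off m 1 2 j) * ?g (one_off m 1 2 j)) = (\<Sum>j<m. - ((-1) ^ m * ?g (one_off m 1 2 j)))"
  proof (rule sum.cong[OF refl])
    fix j assume "j \<in> {..<m}"
    then have j: "j < m" by simp
    have "ptys (one_off m 1 2 j) = (\<Sum>a<m. if a = j then 0 else 1)"
      unfolding ptys_eq_sum[OF length_one_off] by (intro sum.cong refl) (simp add: one_off_nth pty_def)
    then have "ptys (one_off m 1 2 j) + 1 = (\<Sum>a<m. if a = j then 0 else 1) + (\<Sum>a<m. if a = j then 1 else 0)"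
      using j by simp
    also have "\<dots> = (\<Sum>a<m. 1)"
      unfolding sum.distrib[symmetric] by (rule sum.cong) auto
    finally have "m = Suc (ptys (one_off m 1 2 j))" by simp
    then have "(-1) ^ m = (-1 :: 'b) ^ Suc (ptys (one_off m 1 2 j))" by simp
    then have "(-1) ^ ptys (one_off m 1 2 j) = (- ((-1) ^ m) :: 'b)" by simp
    then show "(-1) ^ ptys (one_off m 1 2 j) * ?g (one_off m 1 2 j) = - ((-1) ^ m * ?g (one_off m 1 2 j))"
      by simp
  qed
  also have "\<dots> = - ((-1) ^ m * (\<Sum>j<m. ?g (one_off m 1 2 j)))"
    by (simp only: sum_negf flip: sum_distrib_left)
  also have "(\<Sum>j<m. ?g (one_off m 1 2 j))
      = (\<Sum>\<sigma>\<in>?S. \<Sum>i<m. of_int ((-1) ^ (i + \<sigma> i)) * tw M (one_off m 1 2 i) (one_off m 1 2 (\<sigma> i)))"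
  proof (rule sum_one_off_reindex[where w = "\<lambda>i j. (-1) ^ (i + j)" and \<chi> = sign and F = "tw M"])
    fix \<sigma> i assume \<sigma>: "\<sigma> permutes {..<m}" and i: "i < m"
    have \<sigma>i: "\<sigma> i < m" using permutes_in_image[OF \<sigma>, of i] i by simp
    \<comment> \<open>All letters but the one at j are odd, so the weighted parity sum is the sum of
      all places minus j.\<close>
    have \<nu>: "(\<Sum>a<m. a * pty (one_off m 1 2 j ! a)) + j = (\<Sum>a<m. a)" if "j < m" for j
    proof -
      have "(\<Sum>a<m. a * pty (one_off m 1 2 j ! a)) + j = (\<Sum>a<m. a * pty (one_off m 1 2 j ! a) + (if a = j then j else 0))"
        using that by (simp add: sum.distrib)
      also have "\<dots> = (\<Sum>a<m. a)"
        by (rule sum.cong) (auto simp: one_off_nth pty_def)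
      finally show ?thesis .
    qed
    have "sign \<sigma> * inv_sign 2 m \<sigma> (one_off m 1 2 i)
        = (-1) ^ (\<Sum>a<m. a * pty (one_off m 1 2 (\<sigma> i) ! a) + a * pty (one_off m 1 2 i ! a)) * inv_sign 1 m \<sigma> (one_off m 1 2 i)"
      by (rule w[OF one_off_in_idx \<sigma>]) (simp_all add: permute_one_off[OF \<sigma>])
    also have "inv_sign 1 m \<sigma> (one_off m 1 2 i) = 1"
      by (rule inv_sign_eq_1) (simp add: one_off_nth split: if_splits)
    also have "(-1 :: int) ^ (\<Sum>a<m. a * pty (one_off m 1 2 (\<sigma> i) ! a) + a * pty (one_off m 1 2 i ! a)) = (-1) ^ (i + \<sigma> i)"
    proof (rule minus_one_power_cong)
      have "(\<Sum>a<m. a * pty (one_off m 1 2 (\<sigma> i) ! a) + a * pty (one_off m 1 2 i ! a)) + (i + \<sigma> i) = 2 * (\<Sum>a<m. a)"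
        using \<nu>[OF i] \<nu>[OF \<sigma>i] by (simp add: sum.distrib)
      then show "even ((\<Sum>a<m. a * pty (one_off m 1 2 (\<sigma> i) ! a) + a * pty (one_off m 1 2 i ! a)) + (i + \<sigma> i))"
        by simp
    qed
    finally show "sign \<sigma> * inv_sign 2 m \<sigma> (one_off m 1 2 i) = (-1) ^ (i + \<sigma> i)" by simp
  qed
  finally show ?thesis
    unfolding str_mmul_symmetrizer[OF k] by simp
qed

text \<open>On words with at most one letter 2 no sign occurs at all.
  \<open>inv_sign_two_one\<close> serves only to make words with two letters 2 cancel.\<close>

lemma str_symmetrizer:
  fixes M :: "nat list \<Rightarrow> nat list \<Rightarrow> 'b::ring_1"
  assumes k: "\<And>x. x * k = k * x" and two: "\<And>x :: 'b. 2 * x = 0 \<Longrightarrow> x = 0"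
  shows "str m (mmul m (symmetrizer k (\<lambda>_. 1) m) M) = k * (of_nat (fact m) * tw M (replicate m 1) (replicate m 1)
    - (\<Sum>\<sigma>\<in>{\<sigma>. \<sigma> permutes {..<m}}. \<Sum>i<m. tw M (one_off m 2 1 i) (one_off m 2 1 (\<sigma> i))))"
proof -
  let ?S = "{\<sigma>. \<sigma> permutes {..<m}}"
  let ?g = "\<lambda>I. \<Sum>\<sigma>\<in>?S. of_int (1 * inv_sign 2 m \<sigma> (permute_idx m \<sigma> I)) * tw M (permute_idx m \<sigma> I) I"
  have "?g I = 0" if I: "I \<in> idx m" "a < m" "b < m" "a \<noteq> b" "I ! a = 2" "I ! b = 2" for I a b
  proof -
    let ?\<theta> = "\<lambda>J. (-1) ^ (\<Sum>a<m. a * pty (I ! a) + a * pty (J ! a)) :: int"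
    have "?g I = (\<Sum>\<sigma>\<in>?S. of_int (sign \<sigma> * ?\<theta> (permute_idx m \<sigma> I) * inv_sign 1 m \<sigma> (permute_idx m \<sigma> I)) * tw M (permute_idx m \<sigma> I) I)"
    proof (rule sum.cong[OF refl])
      fix \<sigma> assume "\<sigma> \<in> ?S"
      then have \<sigma>: "\<sigma> permutes {..<m}" by simp
      have "inv_sign 2 m \<sigma> (permute_idx m \<sigma> I) = sign \<sigma> * ?\<theta> (permute_idx m \<sigma> I) * inv_sign 1 m \<sigma> (permute_idx m \<sigma> I)"
        by (rule inv_sign_two_one[OF \<sigma> I(1) permute_idx_in[OF I(1) \<sigma>]]) (simp add: permute_idx_nth)
      then show "of_int (1 * inv_sign 2 m \<sigma> (permute_idx m \<sigma> I)) * tw M (permute_idx m \<sigma> I) I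
        = of_int (sign \<sigma> * ?\<theta> (permute_idx m \<sigma> I) * inv_sign 1 m \<sigma> (permute_idx m \<sigma> I)) * tw M (permute_idx m \<sigma> I) I"
        by (simp only: mult_1)
    qed
    also have "\<dots> = 0"
      by (rule sum_permutations_vanish[OF two I(2-6)]) simp_all
    finally show ?thesis .
  qed
  then have "(\<Sum>I\<in>idx m. (-1) ^ ptys I * ?g I)
      = (-1) ^ ptys (replicate m 1) * ?g (replicate m 1) + (\<Sum>j<m. (-1) ^ ptys (one_off m 2 1 j) * ?g (one_off m 2 1 j))"
    by (intro sum_idx_one_off) auto
  also have "?g (replicate m 1) = (\<Sum>\<sigma>\<in>?S. tw M (replicate m 1) (replicate m 1))"
  proof (rule sum.cong[OF refl])
    fix \<sigma> assume "\<sigma> \<in> ?S"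
    then have \<sigma>: "\<sigma> permutes {..<m}" by simp
    have "inv_sign 2 m \<sigma> (replicate m 1) = 1"
      by (rule inv_sign_eq_1) simp
    then show "of_int (1 * inv_sign 2 m \<sigma> (permute_idx m \<sigma> (replicate m 1))) * tw M (permute_idx m \<sigma> (replicate m 1)) (replicate m 1)
        = tw M (replicate m 1) (replicate m 1)"
      unfolding permute_replicate[OF \<sigma>] by simp
  qed
  also have "\<dots> = of_nat (fact m) * tw M (replicate m 1) (replicate m 1)"
    using card_permutations[of "{..<m}" m] by simp
  also have "ptys (replicate m 1) = 0"
    by (simp add: ptys_eq_sum pty_def)
  also have "(\<Sum>j<m. (-1) ^ ptys (one_off m 2 1 j) * ?g (one_off m 2 1 j)) = (\<Sum>j<m. - ?g (one_off m 2 1 j))"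
  proof (rule sum.cong[OF refl])
    fix j assume "j \<in> {..<m}"
    then have "ptys (one_off m 2 1 j) = 1"
      by (simp add: ptys_eq_sum length_one_off one_off_nth pty_def if_distrib cong: if_cong)
    then show "(-1) ^ ptys (one_off m 2 1 j) * ?g (one_off m 2 1 j) = - ?g (one_off m 2 1 j)"
      by simp
  qed
  also have "\<dots> = - (\<Sum>j<m. ?g (one_off m 2 1 j))"
    by (rule sum_negf)
  also have "(\<Sum>j<m. ?g (one_off m 2 1 j))
      = (\<Sum>\<sigma>\<in>?S. \<Sum>i<m. of_int 1 * tw M (one_off m 2 1 i) (one_off m 2 1 (\<sigma> i)))"
  proof (rule sum_one_off_reindex[where w = "\<lambda>_ _. 1" and \<chi> = "\<lambda>_. 1" and F = "tw M"])
    fix \<sigma> i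
    have "inv_sign 2 m \<sigma> (one_off m 2 1 i) = 1"
      by (rule inv_sign_eq_1) (simp add: one_off_nth split: if_splits)
    then show "1 * inv_sign 2 m \<sigma> (one_off m 2 1 i) = 1" by simp
  qed
  finally show ?thesis
    unfolding str_mmul_symmetrizer[OF k] by simp
qed

subsection \<open>Transfer matrices of the Yangian\<close>

definition chain_sign :: "nat \<Rightarrow> nat list \<Rightarrow> nat list \<Rightarrow> nat \<Rightarrow> nat" where
  "chain_sign m I L r = (pty (I ! r) + pty (L ! r)) * (pty (L ! r) + (\<Sum>u\<in>{Suc r..<m}. pty (I ! u)))"

lemma sum_chain_sign:
  assumes "i < m" "j < m" "i \<noteq> j" and eq: "\<And>r. r < m \<Longrightarrow> r \<noteq> i \<Longrightarrow> r \<noteq> j \<Longrightarrow> I ! r = L ! r"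
  shows "even ((\<Sum>r<m. chain_sign m I L r) + (chain_sign m I L i + chain_sign m I L j))"
proof -
  have "(\<Sum>r<m. chain_sign m I L r)
      = chain_sign m I L i + (chain_sign m I L j + (\<Sum>r\<in>{..<m} - {i} - {j}. chain_sign m I L r))"
    using assms by (simp add: sum.remove[of "{..<m}" i] sum.remove[of "{..<m} - {i}" j])
  moreover have "even (\<Sum>r\<in>{..<m} - {i} - {j}. chain_sign m I L r)"
    by (intro dvd_sum) (auto simp: chain_sign_def eq)
  ultimately show ?thesis by simp
qed

lemma even_chain_sign_diag: "even (\<Sum>r<m. chain_sign m I I r)"
  by (intro dvd_sum) (simp add: chain_sign_def)

text \<open>Only the places i and j count. To the right of k the row word has m - 1 - k letters 2,
  less one if its letter 1 lies there.\<close>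

lemma even_chain_sign_1_2:
  assumes "i < m" "j < m" "i \<noteq> j"
  shows "even ((\<Sum>r<m. chain_sign m (one_off m 1 2 i) (one_off m 1 2 j) r) + (1 + i + j + (if j < i then 1 else 0)))"
proof -
  let ?I = "one_off m 1 2 i" and ?L = "one_off m 1 2 j"
  let ?N = "\<lambda>k. \<Sum>u\<in>{Suc k..<m}. pty (?I ! u)"
  have N: "?N k + (if k < i then 1 else 0) = m - Suc k" for k
  proof -
    have "?N k + (if k < i then 1 else 0) = ?N k + (\<Sum>u\<in>{Suc k..<m}. if u = i then 1 else 0)"
      using assms by simp
    also have "\<dots> = (\<Sum>u\<in>{Suc k..<m}. 1)"
      unfolding sum.distrib[symmetric] by (rule sum.cong) (auto simp: one_off_nth pty_def)
    finally show ?thesis by simp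
  qed
  have "even ((\<Sum>r<m. chain_sign m ?I ?L r) + (chain_sign m ?I ?L i + chain_sign m ?I ?L j))"
    using assms by (intro sum_chain_sign) (simp_all add: one_off_nth)
  moreover have "chain_sign m ?I ?L i = 1 + ?N i" "chain_sign m ?I ?L j = ?N j"
    using assms by (simp_all add: chain_sign_def one_off_nth pty_def)
  moreover have "1 + ?N i + ?N j + (1 + i + j + (if j < i then 1 else 0)) = 2 * m"
    using N[of i] N[of j] assms by (auto split: if_splits)
  then have "even (1 + ?N i + ?N j + (1 + i + j + (if j < i then 1 else 0)))"
    by simp
  ultimately show ?thesis by (simp only: even_add add.assoc) blast
qed

lemma even_chain_sign_2_1:
  assumes "i < m" "j < m" "i \<noteq> j"
  shows "even ((\<Sum>r<m. chain_sign m (one_off m 2 1 i) (one_off m 2 1 j) r) + (1 + (if j < i then 1 else 0)))"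
proof -
  let ?I = "one_off m 2 1 i" and ?L = "one_off m 2 1 j"
  let ?N = "\<lambda>k. \<Sum>u\<in>{Suc k..<m}. pty (?I ! u)"
  have N: "?N k = (if k < i then 1 else 0)" for k
  proof -
    have "?N k = (\<Sum>u\<in>{Suc k..<m}. if u = i then 1 else 0)"
      by (rule sum.cong) (auto simp: one_off_nth pty_def)
    then show ?thesis using assms by simp
  qed
  have "even ((\<Sum>r<m. chain_sign m ?I ?L r) + (chain_sign m ?I ?L i + chain_sign m ?I ?L j))"
    using assms by (intro sum_chain_sign) (simp_all add: one_off_nth)
  moreover have "chain_sign m ?I ?L i = ?N i" "chain_sign m ?I ?L j = 1 + ?N j"
    using assms by (simp_all add: chain_sign_def one_off_nth pty_def)
  ultimately show ?thesis by (simp add: N del: One_nat_def)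
qed

lemma commute_prod_list:
  fixes a :: "'b::monoid_mult"
  assumes "\<And>x. x \<in> set xs \<Longrightarrow> a * x = x * a"
  shows "a * prod_list xs = prod_list xs * a"
  using assms
proof (induction xs)
  case (Cons x xs)
  have "a * prod_list xs = prod_list xs * a" using Cons by simp
  moreover have "a * x = x * a" using Cons.prems by simp
  ultimately show ?case using commute_mult[of a x "prod_list xs"] by simp
qed simp

text \<open>Telescoping without division: the accumulated b commute past the new T and r, so these
  are appended on the right and the T keep their order. The factors r are 1 for \<open>A_m\<close>
  and Berezinians for \<open>H_m\<close>.\<close>

lemma prod_list_recursion:
  fixes F :: "nat \<Rightarrow> 'b::monoid_mult"
  assumes step: "\<And>n. F (Suc (Suc n)) * b (Suc n) = F (Suc n) * (T (Suc n) * r (Suc n))"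
    and comm: "\<And>i j. b i * b j = b j * b i" "\<And>i j. T i * b j = b j * T i" "\<And>i j. r i * b j = b j * r i"
      "\<And>i j. r i * T j = T j * r i"
  shows "F (Suc n) * prod_list (map b [1..<Suc n])
    = F 1 * (prod_list (map T [1..<Suc n]) * prod_list (map r [1..<Suc n]))"
proof (induction n)
  case (Suc n)
  let ?b = "prod_list (map b [1..<Suc n])" and ?T = "prod_list (map T [1..<Suc n])"
    and ?r = "prod_list (map r [1..<Suc n])"
  have bb: "?b * b (Suc n) = b (Suc n) * ?b"
    by (rule commute_prod_list[symmetric]) (auto simp: comm)
  have Tr: "T (Suc n) * r (Suc n) * ?b = ?b * (T (Suc n) * r (Suc n))"
    by (rule commute_prod_list) (auto simp: comm intro!: commute_mult[symmetric])
  have rT: "?r * T (Suc n) = T (Suc n) * ?r"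
    by (rule commute_prod_list[symmetric]) (auto simp: comm)
  have "F (Suc (Suc n)) * prod_list (map b [1..<Suc (Suc n)]) = F (Suc (Suc n)) * (?b * b (Suc n))"
    by simp
  also have "\<dots> = F (Suc n) * (T (Suc n) * r (Suc n) * ?b)"
    unfolding bb by (simp only: step flip: mult.assoc)
  also have "\<dots> = F (Suc n) * ?b * (T (Suc n) * r (Suc n))"
    unfolding Tr by (simp only: mult.assoc)
  also have "\<dots> = F 1 * (?T * (?r * T (Suc n)) * r (Suc n))"
    unfolding Suc.IH by (simp only: mult.assoc)
  also have "\<dots> = F 1 * (?T * T (Suc n) * (?r * r (Suc n)))"
    unfolding rT by (simp only: mult.assoc)
  finally show ?case by simp
qed simp

locale yangian_scalars = yangian t + scalars c
  for t :: "nat \<Rightarrow> nat \<Rightarrow> nat \<Rightarrow> 'a::ring_1" and c :: "complex \<Rightarrow> 'a" +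
  fixes q1 q2 :: complex
  assumes q1: "q1 \<noteq> 0" and q2: "q2 \<noteq> 0"
begin

definition D' where "D' = sinv D"
definition \<beta>' where "\<beta>' = d * A'"

lemma D'_inverse: "D * D' = 1" "D' * D = 1"
  unfolding D'_def by (rule fps_sinv, rule series_0)+

lemma \<beta>'_inverse: "\<beta> * \<beta>' = 1" "\<beta>' * \<beta> = 1"
proof -
  have "\<beta> * \<beta>' = A * (s * d) * A'" by (simp only: \<beta>_def \<beta>'_def mult.assoc)
  then show "\<beta> * \<beta>' = 1" by (simp add: s_inverse A'_inverse del: One_nat_def)
  have "\<beta>' * \<beta> = d * (A' * A) * s" by (simp only: \<beta>_def \<beta>'_def mult.assoc)
  then show "\<beta>' * \<beta> = 1" by (simp add: s_inverse A'_inverse del: One_nat_def)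
qed

lemmas ccomm_\<beta>' = ccomm_A_\<beta>[THEN fps_ccomm_inverse, OF \<beta>'_inverse] ccomm_B_\<beta>[THEN fps_ccomm_inverse, OF \<beta>'_inverse]
  ccomm_D_\<beta>[THEN fps_ccomm_inverse, OF \<beta>'_inverse]

lemmas shift_comm = fps_ccomm_shiftx[OF fps_ccomm_sym]

lemma shift_BB_0: "Bk k * Bk (Suc k) = 0"
  by (rule two_cancel[OF shift_BB])

text \<open>After multiplication by the invertible D(x-k), \<open>shift_BD\<close> spreads the two B
  over neighbouring arguments, where their product vanishes.\<close>

lemma shift_BDB: "Bk (Suc k) * shiftx (int (Suc k)) D' * Bk (Suc k) = 0"
proof -
  let ?n = "Suc k"
  have DD: "shiftx a D * shiftx a D' = 1" "shiftx a D' * shiftx a D = 1" for a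
    by (simp_all only: D'_inverse shiftx_1 flip: shiftx_mult)
  have "Bk k = Bk k * (Dk ?n * shiftx (int ?n) D')"
    by (simp only: DD mult_1_right)
  also have "\<dots> = Dk k * Bk ?n * shiftx (int ?n) D'"
    by (simp only: shift_BD flip: mult.assoc)
  finally have "Dk k * (Bk ?n * shiftx (int ?n) D' * Bk ?n) = Bk k * Bk ?n"
    by (simp only: mult.assoc)
  then have "shiftx (int k) D' * (Dk k * (Bk ?n * shiftx (int ?n) D' * Bk ?n)) = 0"
    by (simp only: shift_BB_0 mult_zero_right)
  then show ?thesis
    by (simp only: DD mult_1_left flip: mult.assoc)
qed

lemma fusion_T: "fusion Ak Bk Ck Dk (\<lambda>n. shiftx (int n) (D' * C)) (\<lambda>n. shiftx (int n) \<beta>)"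
proof
  fix k l
  let ?n = "Suc k"
  let ?h = "shiftx (int ?n)"
  show "Ak k * Bk ?n = Bk k * Ak ?n" by (rule shift_AB)
  show "Bk k * Dk ?n = Dk k * Bk ?n" by (rule shift_BD)
  show "Ak k * Dk ?n - Bk k * Ck ?n = Dk k * Ak ?n + Ck k * Bk ?n" by (rule shift_AD)
  show "Bk k * Bk ?n = 0" by (rule shift_BB_0)
  have "Dk ?n * ?h \<beta> - Ak ?n = Bk ?n * (?h D' * ?h C)"
  proof (rule schur_identity)
    show "Ak ?n * ?h A' = 1" "?h A' * Ak ?n = 1" "Dk ?n * ?h D' = 1" "?h D' * Dk ?n = 1"
      by (simp_all only: A'_inverse D'_inverse shiftx_1 flip: shiftx_mult)
    show "(Dk ?n - Bk ?n * ?h A' * Ck ?n) * ?h s = 1" "?h s * (Dk ?n - Bk ?n * ?h A' * Ck ?n) = 1"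
      by (simp_all only: s_inverse shiftx_1 flip: shiftx_mult shiftx_diff d_def)
    show "?h s * Ak ?n = Ak ?n * ?h s"
      by (simp only: A_s_comm flip: shiftx_mult)
    show "?h \<beta> = Ak ?n * ?h s"
      by (simp only: \<beta>_def shiftx_mult)
    show "?h \<beta> * Bk ?n = Bk ?n * ?h \<beta>" "?h \<beta> * Dk ?n = Dk ?n * ?h \<beta>"
      by (rule shift_comm, rule ccomm_B_\<beta>, rule shift_comm, rule ccomm_D_\<beta>)
    show "Bk ?n * ?h D' * Bk ?n = 0" by (rule shift_BDB)
  qed
  then show "Dk ?n * ?h \<beta> - Ak ?n = Bk ?n * ?h (D' * C)"
    by (simp only: shiftx_mult)
  have "Dk k * (Bk ?n * ?h (D' * C)) = Bk k * (Dk ?n * ?h D') * Ck ?n"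
    unfolding shiftx_mult mult.assoc[symmetric] shift_BD ..
  then show "Dk k * (Bk ?n * ?h (D' * C)) = Bk k * Ck ?n"
    by (simp only: D'_inverse shiftx_1 mult_1_right flip: shiftx_mult)
  show "shiftx (int k) \<beta> * Ak l = Ak l * shiftx (int k) \<beta>" by (rule shift_comm, rule ccomm_A_\<beta>)
  show "shiftx (int k) \<beta> * Bk l = Bk l * shiftx (int k) \<beta>" by (rule shift_comm, rule ccomm_B_\<beta>)
  show "shiftx (int k) \<beta> * Dk l = Dk l * shiftx (int k) \<beta>" by (rule shift_comm, rule ccomm_D_\<beta>)
qed

text \<open>Here the analogue of \<open>schur_identity\<close> is immediate: A
  \<open>\<beta>'\<close> is the Schur complement d, and d - D = -B A^-1 C by definition. The minus
  sign of C is the one that keeps the relation between A and D intact when they are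
  exchanged.\<close>

lemma fusion_H: "fusion Dk Bk (\<lambda>n. - Ck n) Ak (\<lambda>n. - shiftx (int n) (A' * C)) (\<lambda>n. shiftx (int n) \<beta>')"
proof
  fix k l
  let ?n = "Suc k"
  let ?h = "shiftx (int ?n)"
  show "Dk k * Bk ?n = Bk k * Dk ?n" by (rule shift_BD[symmetric])
  show "Bk k * Ak ?n = Ak k * Bk ?n" by (rule shift_AB[symmetric])
  show "Dk k * Ak ?n - Bk k * (- Ck ?n) = Ak k * Dk ?n + - Ck k * Bk ?n"
    using shift_AD[of k] by (simp add: algebra_simps del: One_nat_def of_nat_Suc)
  show "Bk k * Bk ?n = 0" by (rule shift_BB_0)
  have "A * \<beta>' = d"
  proof -
    have "A * \<beta>' = (d * s) * A * d * A'" by (simp add: s_inverse \<beta>'_def mult.assoc del: One_nat_def)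
    also have "\<dots> = d * (s * A) * (d * A')" by (simp only: mult.assoc)
    also have "\<dots> = d * (A * (s * d) * A')" by (simp only: A_s_comm mult.assoc)
    also have "\<dots> = d" by (simp add: s_inverse A'_inverse del: One_nat_def)
    finally show ?thesis .
  qed
  then have "Ak ?n * ?h \<beta>' - Dk ?n = ?h (d - D)"
    by (simp only: shiftx_diff flip: shiftx_mult)
  also have "d - D = - (B * (A' * C))"
    by (simp add: d_def mult.assoc)
  also have "?h (- (B * (A' * C))) = Bk ?n * (- ?h (A' * C))"
    using shiftx_diff[of "int ?n" 0 "B * (A' * C)"] shiftx_diff[of "int ?n" 0 0]
    by (simp add: shiftx_mult del: One_nat_def of_nat_Suc)
  finally show "Ak ?n * ?h \<beta>' - Dk ?n = Bk ?n * (- ?h (A' * C))" .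
  have "Ak k * (Bk ?n * ?h (A' * C)) = Bk k * (Ak ?n * ?h A') * Ck ?n"
    unfolding shiftx_mult mult.assoc[symmetric] shift_AB ..
  then have "Ak k * (Bk ?n * ?h (A' * C)) = Bk k * Ck ?n"
    by (simp only: A'_inverse shiftx_1 mult_1_right flip: shiftx_mult)
  then show "Ak k * (Bk ?n * (- ?h (A' * C))) = Bk k * (- Ck ?n)"
    by (simp only: mult_minus_right)
  show "shiftx (int k) \<beta>' * Dk l = Dk l * shiftx (int k) \<beta>'" by (rule shift_comm, rule ccomm_\<beta>')
  show "shiftx (int k) \<beta>' * Bk l = Bk l * shiftx (int k) \<beta>'" by (rule shift_comm, rule ccomm_\<beta>')
  show "shiftx (int k) \<beta>' * Ak l = Ak l * shiftx (int k) \<beta>'" by (rule shift_comm, rule ccomm_\<beta>')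
qed

interpretation T: fusion Ak Bk Ck Dk "\<lambda>n. shiftx (int n) (D' * C)" "\<lambda>n. shiftx (int n) \<beta>"
  by (rule fusion_T)

interpretation H: fusion Dk Bk "\<lambda>n. - Ck n" Ak "\<lambda>n. - shiftx (int n) (A' * C)" "\<lambda>n. shiftx (int n) \<beta>'"
  by (rule fusion_H)

section \<open>Supertraces in terms of the fused entries\<close>

abbreviation "chainM m \<equiv> mprod m (TQchain c q1 q2 t m)"

lemma \<kappa>_minus_one_power: "\<kappa> ((-1) ^ n) = (-1) ^ n"
  by (simp add: \<kappa>_power \<kappa>_minus \<kappa>_1)

lemma tw_chainM:
  assumes "I \<in> idx m" "L \<in> idx m"
  shows "tw (chainM m) I L = \<kappa> ((\<Prod>r<m. if I ! r = 1 then q1 else q2) * (-1) ^ (\<Sum>r<m. chain_sign m I L r))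
    * prod_list (map (\<lambda>r. shiftx (int r) (Tser t (I ! r) (L ! r))) [0..<m])"
proof -
  have "chain_entry c q1 q2 t m I L = (\<lambda>r. \<kappa> ((if I ! r = 1 then q1 else q2) * (-1) ^ chain_sign m I L r)
      * shiftx (int r) (Tser t (I ! r) (L ! r)))"
    unfolding chain_entry_def chain_sign_def \<kappa>_mult \<kappa>_minus_one_power by (simp only: \<kappa>_def mult.assoc)
  then show ?thesis
    unfolding tw_TQchain[OF assms] by (simp only: prod_list_scalars prod.distrib power_sum)
qed

lemma prod_one_off:
  assumes "i < Suc n" "e \<noteq> e'"
  shows "(\<Prod>r<Suc n. if one_off (Suc n) e e' i ! r = e then x else y) = x * (y :: complex) ^ n"
proof -
  have "(\<Prod>r<Suc n. if one_off (Suc n) e e' i ! r = e then x else y) = (\<Prod>r<Suc n. if r = i then x else y)"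
    using assms(2) by (intro prod.cong) (auto simp: one_off_nth)
  also have "\<dots> = x * (\<Prod>r\<in>{..<Suc n} - {i}. y)"
    using assms(1) by (subst prod.remove[of _ i]) (auto intro!: arg_cong[of _ _ "(*) x"] prod.cong)
  finally show ?thesis using assms(1) by simp
qed

lemma tw_chainM_1_2:
  assumes "i < Suc n" "j < Suc n"
  shows "(-1) ^ (i + j) * tw (chainM (Suc n)) (one_off (Suc n) 1 2 i) (one_off (Suc n) 1 2 j)
    = \<kappa> (q1 * q2 ^ n) * (if i < j then - T.W (Suc n) i j else T.W (Suc n) i j)"
proof -
  let ?I = "one_off (Suc n) 1 2 i" and ?L = "one_off (Suc n) 1 2 j"
  let ?e = "\<Sum>r<Suc n. chain_sign (Suc n) ?I ?L r"
  \<comment> \<open>The first factor comes from \<open>str_antisymmetrizer\<close>; what is left is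
    the sign pattern of \<open>sum_W_row\<close>.\<close>
  have sg: "(-1 :: complex) ^ (i + j) * (-1) ^ ?e = (if i < j then -1 else 1)"
  proof (cases "i = j")
    case True
    then show ?thesis using even_chain_sign_diag[of "Suc n" ?I] by (simp del: sum.lessThan_Suc flip: mult_2)
  next
    case False
    from even_chain_sign_1_2[OF assms False]
    have e: "(-1 :: complex) ^ ?e = (-1) ^ (1 + i + j + (if j < i then 1 else 0))"
      by (rule minus_one_power_cong)
    show ?thesis
      unfolding e using False by (auto simp: minus_one_power_iff)
  qed
  have "prod_list (map (\<lambda>r. shiftx (int r) (Tser t (?I ! r) (?L ! r))) [0..<Suc n]) = T.W (Suc n) i j"
    unfolding T.W_def by (intro arg_cong[of _ _ prod_list] map_cong refl)
      (auto simp: one_off_nth T.entry_def simp del: One_nat_def)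
  then have "tw (chainM (Suc n)) ?I ?L = \<kappa> (q1 * q2 ^ n * (-1) ^ ?e) * T.W (Suc n) i j"
    using prod_one_off[OF assms(1), of 1 2 q1 q2] by (simp only: tw_chainM one_off_in_idx insertI1 insertI2)
  then have "(-1) ^ (i + j) * tw (chainM (Suc n)) ?I ?L
      = \<kappa> ((-1) ^ (i + j) * (q1 * q2 ^ n * (-1) ^ ?e)) * T.W (Suc n) i j"
    by (simp only: \<kappa>_mult \<kappa>_minus_one_power mult.assoc)
  also have "(-1) ^ (i + j) * (q1 * q2 ^ n * (-1) ^ ?e) = q1 * q2 ^ n * (if i < j then -1 else 1)"
    unfolding sg[symmetric] by (simp only: mult_ac)
  finally show ?thesis
    by (simp add: \<kappa>_minus)
qed

text \<open>Exchanging the letters 1 and 2 also exchanges T_12 and T_21. Hence the arguments of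
  \<open>H.W\<close> are transposed, and \<open>Hfrak_eq\<close> sums along columns.\<close>

lemma tw_chainM_2_1:
  assumes "i < Suc n" "j < Suc n"
  shows "tw (chainM (Suc n)) (one_off (Suc n) 2 1 i) (one_off (Suc n) 2 1 j)
    = \<kappa> (q2 * q1 ^ n) * (if j < i then - H.W (Suc n) j i else H.W (Suc n) j i)"
proof -
  let ?I = "one_off (Suc n) 2 1 i" and ?L = "one_off (Suc n) 2 1 j"
  let ?e = "\<Sum>r<Suc n. chain_sign (Suc n) ?I ?L r"
  \<comment> \<open>The interpretation \<open>H\<close> carries \<open>- Ck\<close>; this scalar
    undoes the sign at the place i of the letter C.\<close>
  let ?z = "\<lambda>r. if r = i \<and> i \<noteq> j then -1 else (1 :: complex)"
  have sg: "(-1 :: complex) ^ ?e * (if i = j then 1 else -1) = (if j < i then -1 else 1)"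
  proof (cases "i = j")
    case True
    then show ?thesis using even_chain_sign_diag[of "Suc n" ?I] by (simp del: sum.lessThan_Suc)
  next
    case False
    from even_chain_sign_2_1[OF assms False]
    have "(-1 :: complex) ^ ?e = (-1) ^ (1 + (if j < i then 1 else 0))"
      by (rule minus_one_power_cong)
    then show ?thesis using False by (auto simp del: sum.lessThan_Suc)
  qed
  have "prod_list (map (\<lambda>r. shiftx (int r) (Tser t (?I ! r) (?L ! r))) [0..<Suc n])
      = prod_list (map (\<lambda>r. \<kappa> (?z r) * H.entry j i r) [0..<Suc n])"
    by (intro arg_cong[of _ _ prod_list] map_cong refl)
      (auto simp: one_off_nth H.entry_def \<kappa>_minus \<kappa>_1 simp del: One_nat_def)
  also have "\<dots> = \<kappa> (\<Prod>r<Suc n. ?z r) * H.W (Suc n) j i"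
    unfolding H.W_def by (rule prod_list_scalars)
  also have "(\<Prod>r<Suc n. ?z r) = (if i = j then 1 else -1)"
    using assms(1) by (cases "i = j") (simp_all del: prod.lessThan_Suc)
  finally have P: "prod_list (map (\<lambda>r. shiftx (int r) (Tser t (?I ! r) (?L ! r))) [0..<Suc n])
      = \<kappa> (if i = j then 1 else -1) * H.W (Suc n) j i" .
  have q: "(\<Prod>r<Suc n. if ?I ! r = 1 then q1 else q2) = q2 * q1 ^ n"
  proof -
    have "(\<Prod>r<Suc n. if ?I ! r = 1 then q1 else q2) = (\<Prod>r<Suc n. if ?I ! r = 2 then q2 else q1)"
      by (rule prod.cong) (auto simp: one_off_nth)
    then show ?thesis using prod_one_off[OF assms(1), of 2 1 q2 q1] by simp
  qed
  have "tw (chainM (Suc n)) ?I ?L = \<kappa> (q2 * q1 ^ n * (-1) ^ ?e) * (\<kappa> (if i = j then 1 else -1) * H.W (Suc n) j i)"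
    by (subst tw_chainM) (simp_all only: one_off_in_idx insertI1 insertI2 P q)
  also have "\<dots> = \<kappa> (q2 * q1 ^ n * ((-1) ^ ?e * (if i = j then 1 else -1))) * H.W (Suc n) j i"
    by (simp only: \<kappa>_mult mult.assoc)
  finally show ?thesis
    unfolding sg by (simp add: \<kappa>_minus)
qed

lemma tw_chainM_replicate:
  "tw (chainM m) (replicate m 2) (replicate m 2) = \<kappa> (q2 ^ m) * T.X m"
  "tw (chainM m) (replicate m 1) (replicate m 1) = \<kappa> (q1 ^ m) * H.X m"
proof -
  have 1: "(-1 :: complex) ^ (\<Sum>r<m. chain_sign m I I r) = 1" for I
    using even_chain_sign_diag[of m I] by simp
  have 2: "map (\<lambda>r. shiftx (int r) (Tser t (replicate m e ! r) (replicate m e ! r))) [0..<m]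
      = map (\<lambda>r. shiftx (int r) (Tser t e e)) [0..<m]" for e
    by (intro map_cong) auto
  have 3: "(\<Prod>r<m. if replicate m e ! r = 1 then q1 else q2) = (if e = 1 then q1 else q2) ^ m" for e
    by simp
  have in_12: "1 \<in> {1, 2 :: nat}" "2 \<in> {1, 2 :: nat}" by simp_all
  show "tw (chainM m) (replicate m 2) (replicate m 2) = \<kappa> (q2 ^ m) * T.X m"
    unfolding tw_chainM[OF replicate_in_idx[OF in_12(2)] replicate_in_idx[OF in_12(2)]] 1 2 3 T.X_def by simp
  show "tw (chainM m) (replicate m 1) (replicate m 1) = \<kappa> (q1 ^ m) * H.X m"
    unfolding tw_chainM[OF replicate_in_idx[OF in_12(1)] replicate_in_idx[OF in_12(1)]] 1 2 3 H.X_def by simp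
qed

lemma \<kappa>_fact: "\<kappa> (inverse (of_nat (fact m))) * (of_nat (fact m) * x) = x"
  unfolding \<kappa>_of_nat[symmetric] mult.assoc[symmetric] \<kappa>_mult[symmetric] by (simp add: \<kappa>_1)

text \<open>All row sums agree, so the sum over permutations is m! times one of them and the
  normalization of the antisymmetrizer cancels. Here m = n + 1, the word length in
  \<open>T.Y n\<close>.\<close>

lemma Tfrak_eq: "Tfrak c q1 q2 t (Suc n) = \<kappa> ((- q2) ^ n) * (\<kappa> q1 * T.Y n - \<kappa> q2 * T.X (Suc n))"
proof -
  let ?k = "\<kappa> (inverse (of_nat (fact (Suc n))))" and ?m = "Suc n"
  have "Asym c ?m = symmetrizer ?k sign ?m"
    by (simp add: Asym_def symmetrizer_def \<kappa>_def)
  then have "Tfrak c q1 q2 t ?m = str ?m (mmul ?m (symmetrizer ?k sign ?m) (chainM ?m))"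
    by (simp add: Tfrak_def mprod_def)
  also have "\<dots> = ?k * ((-1) ^ ?m * (of_nat (fact ?m) * (\<kappa> (q2 ^ ?m) * T.X ?m))
      - (-1) ^ ?m * (of_nat (fact ?m) * (\<kappa> (q1 * q2 ^ n) * T.Y n)))"
  proof -
    have "(\<Sum>\<sigma>\<in>{\<sigma>. \<sigma> permutes {..<?m}}. \<Sum>i<?m. (-1) ^ (i + \<sigma> i) * tw (chainM ?m) (one_off ?m 1 2 i) (one_off ?m 1 2 (\<sigma> i)))
        = of_nat (fact ?m) * (\<kappa> (q1 * q2 ^ n) * T.Y n)"
    proof (rule sum_permutations_rows)
      fix i assume i: "i < ?m"
      have "(\<Sum>j<?m. (-1) ^ (i + j) * tw (chainM ?m) (one_off ?m 1 2 i) (one_off ?m 1 2 j))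
          = (\<Sum>j<?m. \<kappa> (q1 * q2 ^ n) * (if i < j then - T.W ?m i j else T.W ?m i j))"
        using i by (intro sum.cong refl tw_chainM_1_2) simp_all
      also have "\<dots> = \<kappa> (q1 * q2 ^ n) * T.Y n"
        using i by (simp only: T.sum_W_row less_Suc_eq_le flip: sum_distrib_left)
      finally show "(\<Sum>j<?m. (-1) ^ (i + j) * tw (chainM ?m) (one_off ?m 1 2 i) (one_off ?m 1 2 j))
          = \<kappa> (q1 * q2 ^ n) * T.Y n" .
    qed simp
    then show ?thesis
      by (subst str_antisymmetrizer[OF \<kappa>_central two_cancel]) (simp_all only: tw_chainM_replicate)
  qed
  also have "\<dots> = ?k * (of_nat (fact ?m) * ((-1) ^ ?m * (\<kappa> (q2 ^ ?m) * T.X ?m) - (-1) ^ ?m * (\<kappa> (q1 * q2 ^ n) * T.Y n)))"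
    by (simp add: minus_one_power_iff right_diff_distrib)
  also have "\<dots> = (-1) ^ ?m * (\<kappa> (q2 ^ ?m) * T.X ?m) - (-1) ^ ?m * (\<kappa> (q1 * q2 ^ n) * T.Y n)"
    by (rule \<kappa>_fact)
  also have "\<dots> = \<kappa> ((-1) ^ ?m * q2 ^ ?m) * T.X ?m - \<kappa> ((-1) ^ ?m * (q1 * q2 ^ n)) * T.Y n"
    by (simp only: \<kappa>_mult \<kappa>_minus_one_power mult.assoc)
  also have "(-1) ^ ?m * q2 ^ ?m = - ((- q2) ^ n * q2)" 
    by (simp add: power_minus[of q2 n])
  also have "(-1) ^ ?m * (q1 * q2 ^ n) = - ((- q2) ^ n * q1)"
    by (simp add: power_minus[of q2 n])
  finally show ?thesis
    by (simp add: \<kappa>_minus \<kappa>_mult right_diff_distrib mult.assoc)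
qed

lemma Hfrak_eq: "Hfrak c q1 q2 t (Suc n) = - (\<kappa> (q1 ^ n) * (\<kappa> q2 * H.Y n - \<kappa> q1 * H.X (Suc n)))"
proof -
  let ?k = "\<kappa> (inverse (of_nat (fact (Suc n))))" and ?m = "Suc n"
  have "Hsym c ?m = symmetrizer ?k (\<lambda>_. 1) ?m"
    by (simp add: Hsym_def symmetrizer_def \<kappa>_def)
  then have "Hfrak c q1 q2 t ?m = str ?m (mmul ?m (symmetrizer ?k (\<lambda>_. 1) ?m) (chainM ?m))"
    by (simp add: Hfrak_def mprod_def)
  also have "\<dots> = ?k * (of_nat (fact ?m) * (\<kappa> (q1 ^ ?m) * H.X ?m) - of_nat (fact ?m) * (\<kappa> (q2 * q1 ^ n) * H.Y n))"
  proof -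
    have "(\<Sum>\<sigma>\<in>{\<sigma>. \<sigma> permutes {..<?m}}. \<Sum>i<?m. tw (chainM ?m) (one_off ?m 2 1 i) (one_off ?m 2 1 (\<sigma> i)))
        = of_nat (fact ?m) * (\<kappa> (q2 * q1 ^ n) * H.Y n)"
    proof (rule sum_permutations_columns)
      fix j assume j: "j < ?m"
      have "(\<Sum>i<?m. tw (chainM ?m) (one_off ?m 2 1 i) (one_off ?m 2 1 j))
          = (\<Sum>i<?m. \<kappa> (q2 * q1 ^ n) * (if j < i then - H.W ?m j i else H.W ?m j i))"
        using j by (intro sum.cong refl tw_chainM_2_1) simp_all
      also have "\<dots> = \<kappa> (q2 * q1 ^ n) * H.Y n"
        using j by (simp only: H.sum_W_row less_Suc_eq_le flip: sum_distrib_left)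
      finally show "(\<Sum>i<?m. tw (chainM ?m) (one_off ?m 2 1 i) (one_off ?m 2 1 j)) = \<kappa> (q2 * q1 ^ n) * H.Y n" .
    qed simp
    then show ?thesis
      by (subst str_symmetrizer[OF \<kappa>_central two_cancel]) (simp_all only: tw_chainM_replicate)
  qed
  also have "\<dots> = \<kappa> (q1 ^ ?m) * H.X ?m - \<kappa> (q2 * q1 ^ n) * H.Y n"
    unfolding right_diff_distrib[symmetric] by (rule \<kappa>_fact)
  also have "\<kappa> (q1 ^ ?m) = \<kappa> (q1 ^ n) * \<kappa> q1"
    by (simp add: mult.commute flip: \<kappa>_mult)
  also have "\<kappa> (q2 * q1 ^ n) = \<kappa> (q1 ^ n) * \<kappa> q2"
    by (simp add: mult.commute flip: \<kappa>_mult)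
  finally show ?thesis
    by (simp add: right_diff_distrib mult.assoc)
qed

section \<open>Recursion in m and the product formulas\<close>

abbreviation "TQ k \<equiv> shiftx (int k) (TcalQ c q1 q2 t)"
abbreviation "Ber k \<equiv> shiftx (int k) (BerQ c q1 q2 t)"

lemma TQ_eq: "TQ k = \<kappa> q1 * Ak k - \<kappa> q2 * Dk k"
  unfolding TcalQ_def shiftx_diff shiftx_mult shiftx_const \<kappa>_def ..

lemma Ber_eq: "Ber k = \<kappa> (q1 / q2) * shiftx (int k) \<beta>"
proof -
  have "BerQ c q1 q2 t = \<kappa> (q1 / q2) * \<beta>"
    unfolding BerQ_def \<beta>_def s_def d_def A'_def \<kappa>_def by (rule mult.assoc)
  then show ?thesis by (simp only: shiftx_mult \<kappa>_def shiftx_const)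
qed

lemma Ber_comm:
  assumes "x * shiftx (int k) \<beta> = shiftx (int k) \<beta> * x"
  shows "x * Ber k = Ber k * x"
  unfolding Ber_eq by (rule commute_mult[OF \<kappa>_central assms])

lemma TQ_Ber_comm: "TQ j * Ber k = Ber k * TQ j"
proof -
  have *: "Ak j * shiftx (int k) \<beta> = shiftx (int k) \<beta> * Ak j" "Dk j * shiftx (int k) \<beta> = shiftx (int k) \<beta> * Dk j"
    by (rule fps_ccomm_shiftx, rule ccomm_A_\<beta>, rule fps_ccomm_shiftx, rule ccomm_D_\<beta>)
  note A = Ber_comm[OF *(1), symmetric] and D = Ber_comm[OF *(2), symmetric]
  have "Ber k * (\<kappa> q1 * Ak j) = \<kappa> q1 * Ak j * Ber k" "Ber k * (\<kappa> q2 * Dk j) = \<kappa> q2 * Dk j * Ber k"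
    by (rule commute_mult[OF \<kappa>_central A], rule commute_mult[OF \<kappa>_central D])
  then show ?thesis
    unfolding TQ_eq by (simp only: right_diff_distrib left_diff_distrib)
qed

lemma Ber_Ber_comm: "Ber j * Ber k = Ber k * Ber j"
  by (rule Ber_comm, rule Ber_comm[symmetric], rule fps_ccomm_shiftx, rule ccomm_\<beta>_\<beta>)

lemma Tfrak_step: "Tfrak c q1 q2 t (Suc (Suc n)) * (1 - Ber (Suc n)) = Tfrak c q1 q2 t (Suc n) * TQ (Suc n)"
proof -
  let ?F = "\<lambda>n. \<kappa> q1 * T.Y n - \<kappa> q2 * T.X (Suc n)"
  \<comment> \<open>One factor -q2 from \<open>Tfrak_eq\<close> turns 1 - Ber into the right factor
    of \<open>fusion_step\<close>.\<close>
  have b: "\<kappa> (- q2) * (1 - Ber (Suc n)) = \<kappa> q1 * shiftx (int (Suc n)) \<beta> - \<kappa> q2"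
  proof -
    have "\<kappa> (- q2) * Ber (Suc n) = \<kappa> (- q1) * shiftx (int (Suc n)) \<beta>"
      unfolding Ber_eq mult.assoc[symmetric] \<kappa>_mult[symmetric] using q2 by simp
    then show ?thesis by (simp add: right_diff_distrib \<kappa>_minus)
  qed
  have "Tfrak c q1 q2 t (Suc (Suc n)) * (1 - Ber (Suc n))
      = \<kappa> ((- q2) ^ n) * (\<kappa> (- q2) * ?F (Suc n)) * (1 - Ber (Suc n))"
    unfolding Tfrak_eq power_Suc2 \<kappa>_mult by (simp only: mult.assoc)
  also have "\<dots> = \<kappa> ((- q2) ^ n) * (?F (Suc n) * (\<kappa> (- q2) * (1 - Ber (Suc n))))"
    unfolding \<kappa>_central[of "?F (Suc n)", symmetric] by (simp only: mult.assoc)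
  also have "\<dots> = \<kappa> ((- q2) ^ n) * (?F n * TQ (Suc n))"
    unfolding b TQ_eq T.fusion_step[OF \<kappa>_central \<kappa>_central] ..
  finally show ?thesis
    unfolding Tfrak_eq by (simp only: mult.assoc)
qed

lemma Hfrak_step: "Hfrak c q1 q2 t (Suc (Suc n)) * (Ber (Suc n) - 1) = Hfrak c q1 q2 t (Suc n) * (TQ (Suc n) * Ber (Suc n))"
proof -
  let ?F = "\<lambda>n. \<kappa> q2 * H.Y n - \<kappa> q1 * H.X (Suc n)" and ?m = "Suc n"
  let ?\<beta> = "shiftx (int ?m) \<beta>" and ?\<beta>' = "shiftx (int ?m) \<beta>'"
  have \<beta>\<beta>: "?\<beta>' * ?\<beta> = 1"
    by (simp only: \<beta>'_inverse shiftx_1 flip: shiftx_mult)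
  \<comment> \<open>Uses Ber = (q1/q2) \<open>\<beta>\<close> and \<open>\<beta>'\<close>
    \<open>\<beta>\<close> = 1. The factors q1/q2 and \<open>\<beta>\<close> split off here
    reassemble into the Ber on the right side of the recursion.\<close>
  have b: "\<kappa> q1 * (Ber ?m - 1) = - (\<kappa> (q1 / q2) * ((\<kappa> q2 * ?\<beta>' - \<kappa> q1) * ?\<beta>))"
  proof -
    have "\<kappa> (q1 / q2) * \<kappa> q2 = \<kappa> q1"
      unfolding \<kappa>_mult[symmetric] using q2 by simp
    moreover have "\<kappa> (q1 / q2) * \<kappa> q1 = \<kappa> q1 * \<kappa> (q1 / q2)"
      by (rule \<kappa>_central)
    ultimately show ?thesis
      unfolding Ber_eq by (simp add: left_diff_distrib right_diff_distrib mult.assoc \<beta>\<beta> del: of_nat_Suc)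
        (simp flip: mult.assoc del: of_nat_Suc)
  qed
  have "Hfrak c q1 q2 t (Suc ?m) * (Ber ?m - 1) = - (\<kappa> (q1 ^ n) * (\<kappa> q1 * ?F ?m) * (Ber ?m - 1))"
    unfolding Hfrak_eq power_Suc2 \<kappa>_mult by (simp only: mult.assoc mult_minus_left)
  also have "\<dots> = - (\<kappa> (q1 ^ n) * (?F ?m * (\<kappa> q1 * (Ber ?m - 1))))"
    unfolding \<kappa>_central[of "?F ?m", symmetric] by (simp only: mult.assoc)
  also have "\<dots> = \<kappa> (q1 ^ n) * (?F ?m * \<kappa> (q1 / q2) * ((\<kappa> q2 * ?\<beta>' - \<kappa> q1) * ?\<beta>))"
    unfolding b by (simp only: mult_minus_right minus_minus mult.assoc)
  also have "\<dots> = \<kappa> (q1 ^ n) * (\<kappa> (q1 / q2) * (?F ?m * (\<kappa> q2 * ?\<beta>' - \<kappa> q1)) * ?\<beta>)"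
    unfolding \<kappa>_central[of "?F ?m"] by (simp only: mult.assoc)
  also have "\<dots> = \<kappa> (q1 ^ n) * (\<kappa> (q1 / q2) * (?F n * (\<kappa> q2 * Dk ?m - \<kappa> q1 * Ak ?m)) * ?\<beta>)"
    unfolding H.fusion_step[OF \<kappa>_central \<kappa>_central] ..
  also have "\<kappa> q2 * Dk ?m - \<kappa> q1 * Ak ?m = - TQ ?m"
    unfolding TQ_eq by (rule minus_diff_eq[symmetric])
  also have "\<kappa> (q1 ^ n) * (\<kappa> (q1 / q2) * (?F n * (- TQ ?m)) * ?\<beta>) = - (\<kappa> (q1 ^ n) * (?F n * TQ ?m * \<kappa> (q1 / q2) * ?\<beta>))"
    unfolding \<kappa>_central[of "?F n * TQ ?m"] by (simp only: mult_minus_left mult_minus_right mult.assoc)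
  finally show ?thesis
    unfolding Hfrak_eq Ber_eq by (simp only: mult_minus_left mult.assoc)
qed

lemma frak_1: "Tfrak c q1 q2 t (Suc 0) = TQ 0" "Hfrak c q1 q2 t (Suc 0) = TQ 0"
  unfolding Tfrak_eq Hfrak_eq TQ_eq
  by (simp_all add: T.Y_def H.Y_def T.X_def H.X_def \<kappa>_1 del: One_nat_def)

lemma prod_list_TQ: "prod_list (map (\<lambda>i. shiftx (int i - 1) (TcalQ c q1 q2 t)) [1..<Suc (Suc n)])
    = TQ 0 * prod_list (map TQ [1..<Suc n])"
proof -
  have "map (\<lambda>i. shiftx (int i - 1) (TcalQ c q1 q2 t)) [1..<Suc (Suc n)] = map TQ [0..<Suc n]"
    unfolding One_nat_def map_Suc_upt[symmetric] map_map by (intro map_cong) auto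
  then show ?thesis
    by (simp add: upt_conv_Cons[of 0] del: upt_Suc)
qed

lemma Tfrak_identity: "Tfrak c q1 q2 t (Suc n) * prod_list (map (\<lambda>i. 1 - Ber i) [1..<Suc n])
    = prod_list (map (\<lambda>i. shiftx (int i - 1) (TcalQ c q1 q2 t)) [1..<Suc (Suc n)])"
proof -
  have "Tfrak c q1 q2 t (Suc n) * prod_list (map (\<lambda>i. 1 - Ber i) [1..<Suc n])
      = Tfrak c q1 q2 t 1 * (prod_list (map TQ [1..<Suc n]) * prod_list (map (\<lambda>_. 1) [1..<Suc n]))"
    by (rule prod_list_recursion, simp only: Tfrak_step mult_1_right)
      (simp_all add: TQ_Ber_comm Ber_Ber_comm right_diff_distrib left_diff_distrib del: of_nat_Suc)
  also have "prod_list (map (\<lambda>_. 1) [1..<Suc n]) = (1 :: 'a fps)"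
    by (simp add: map_replicate_const)
  finally show ?thesis
    unfolding prod_list_TQ by (simp add: frak_1 mult.assoc del: upt_Suc)
qed

lemma Hfrak_identity: "Hfrak c q1 q2 t (Suc n) * prod_list (map (\<lambda>i. Ber i - 1) [1..<Suc n])
    = prod_list (map (\<lambda>i. shiftx (int i - 1) (TcalQ c q1 q2 t)) [1..<Suc (Suc n)]) * prod_list (map Ber [1..<Suc n])"
proof -
  have "Hfrak c q1 q2 t (Suc n) * prod_list (map (\<lambda>i. Ber i - 1) [1..<Suc n])
      = Hfrak c q1 q2 t 1 * (prod_list (map TQ [1..<Suc n]) * prod_list (map Ber [1..<Suc n]))"
    by (rule prod_list_recursion, rule Hfrak_step)
      (simp_all add: TQ_Ber_comm Ber_Ber_comm right_diff_distrib left_diff_distrib del: of_nat_Suc)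
  then show ?thesis
    unfolding prod_list_TQ by (simp add: frak_1 mult.assoc del: upt_Suc)
qed

end

theorem theorem6p10:
  fixes c :: "complex \<Rightarrow> 'a::ring_1" and q1 q2 :: complex
    and t :: "nat \<Rightarrow> nat \<Rightarrow> nat \<Rightarrow> 'a" and m :: nat
  assumes c_one: "c 1 = 1"
    and c_add: "\<And>a b. c (a + b) = c a + c b"
    and c_mult: "\<And>a b. c (a * b) = c a * c b"
    and c_central: "\<And>a y. c a * y = y * c a"
    and q1: "q1 \<noteq> 0" and q2: "q2 \<noteq> 0"
    and rtt: "yangian_rtt t"
    and m: "1 \<le> m"
  shows "(Tfrak c q1 q2 t m * prod_list (map (\<lambda>i. 1 - shiftx (int i) (BerQ c q1 q2 t)) [1..<m])
           = prod_list (map (\<lambda>i. shiftx (int i - 1) (TcalQ c q1 q2 t)) [1..<Suc m])) \<and>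
         (Hfrak c q1 q2 t m * prod_list (map (\<lambda>i. shiftx (int i) (BerQ c q1 q2 t) - 1) [1..<m])
           = prod_list (map (\<lambda>i. shiftx (int i - 1) (TcalQ c q1 q2 t)) [1..<Suc m])
             * prod_list (map (\<lambda>i. shiftx (int i) (BerQ c q1 q2 t)) [1..<m]))"
proof -
  interpret yangian_scalars t c q1 q2
    by unfold_locales (rule rtt c_one c_add c_mult c_central q1 q2)+
  obtain n where "m = Suc n"
    using m by (cases m) auto
  then show ?thesis
    using Tfrak_identity[of n] Hfrak_identity[of n] by simp
qed

end
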